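(* Let $f\in\mathcal{A}_c(\mathbb{R})$. Let $\psi\in L^1(\mathbb{R})$ with $\int_{-\infty}^\infty\psi(t)\,dt=1$, such that $\hat\psi$ is absolutely continuous, $p_2\hat\psi\in L^1(\mathbb{R})$, $p_2\hat\psi'\in L^1(\mathbb{R})$ and $p_2\hat\psi'\in\mathcal{BV}(\mathbb{R})$. For $a>0$ let $\psi_a(x)=\psi(x/a)/a$ and $K_a=\widehat{\psi_a}$. Let $e_x(s)=e^{xs}$ and $I_a[f](x)=\frac{1}{2\pi}\int_{-\infty}^\infty e_{ix}K_a\hat f$. Then $\lim_{a\to0^+}\|f-I_a[f]\|=0$.
   Context: $\mathcal{B}_c(\mathbb{R})$ is the set of $F:[-\infty,\infty]\to\mathbb{C}$ continuous on $\mathbb{R}$ with limits $F(\pm\infty)$ existing and $F(-\infty)=0$. $\mathcal{A}_c(\mathbb{R})$ is the set of tempered distributions $f=F'$ (distributional derivative) with $F\in\mathcal{B}_c(\mathbb{R})$; the Alexiewicz norm is $\|f\|=\sup_{x}|F(x)|$; for $g$ of bounded variation, $\int fg=F(\infty)g(\infty)-\int F\,dg$. $v_s(t)=(1-ist-e^{-ist})/t^2$ ($t\neq0$), $v_s(0)=s^2/2$; $\Omega_f(s)=\int v_sf$; the Fourier transform is $\hat f=\Omega_f''$ (second distributional derivative) and $\int e_{ix}K_a\hat f$ is a distributional integral. $p_n(x)=x^n$; $\mathcal{BV}(\mathbb{R})$ is the space of functions of bounded variation; $\hat\psi(s)=\int e^{-ist}\psi(t)dt$. *)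

theory Defs
  imports "HOL-Analysis.Analysis"
begin

text \<open>B_c(R): continuous primitives, F(-inf) = 0, F(+inf) exists.
  A distribution f in A_c(R) is represented by its primitive F in B_c(R).\<close>
definition Bc :: "(real \<Rightarrow> complex) \<Rightarrow> bool" where
  "Bc F \<longleftrightarrow> continuous_on UNIV F \<and> (F \<longlongrightarrow> 0) at_bot \<and> (\<exists>l. (F \<longlongrightarrow> l) at_top)"

definition at_infty :: "(real \<Rightarrow> complex) \<Rightarrow> complex" where
  "at_infty g = Lim at_top g"

definition bv_on_R :: "(real \<Rightarrow> complex) \<Rightarrow> bool" where
  "bv_on_R g \<longleftrightarrow> (\<exists>M. \<forall>(n::nat) (x::nat \<Rightarrow> real). (\<forall>i<n. x i \<le> x (Suc i)) \<longrightarrow>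
      (\<Sum>i<n. norm (g (x (Suc i)) - g (x i))) \<le> M)"

definition abs_cont_on :: "real set \<Rightarrow> (real \<Rightarrow> complex) \<Rightarrow> bool" where
  "abs_cont_on S g \<longleftrightarrow> (\<forall>e>0. \<exists>d>0. \<forall>(n::nat) (a::nat \<Rightarrow> real) b.
      (\<forall>i<n. a i \<le> b i \<and> {a i..b i} \<subseteq> S) \<and>
      (\<forall>i<n. \<forall>j<n. i \<noteq> j \<longrightarrow> b i \<le> a j \<or> b j \<le> a i) \<and>
      (\<Sum>i<n. b i - a i) < d \<longrightarrow> (\<Sum>i<n. norm (g (b i) - g (a i))) < e)"

definition rs_has_integral ::
  "(real \<Rightarrow> complex) \<Rightarrow> (real \<Rightarrow> complex) \<Rightarrow> complex \<Rightarrow> real \<Rightarrow> real \<Rightarrow> bool" where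
  "rs_has_integral h g I a b \<longleftrightarrow> (\<forall>e>0. \<exists>\<gamma>. gauge \<gamma> \<and> (\<forall>D. D tagged_division_of {a..b} \<and> \<gamma> fine D \<longrightarrow>
      norm ((\<Sum>(x,K)\<in>D. h x * (g (Sup K) - g (Inf K))) - I) < e))"

definition rs_integral :: "(real \<Rightarrow> complex) \<Rightarrow> (real \<Rightarrow> complex) \<Rightarrow> real \<Rightarrow> real \<Rightarrow> complex" where
  "rs_integral h g a b = (THE I. rs_has_integral h g I a b)"

definition rs_improper_has_integral ::
  "(real \<Rightarrow> complex) \<Rightarrow> (real \<Rightarrow> complex) \<Rightarrow> complex \<Rightarrow> bool" where
  "rs_improper_has_integral h g I \<longleftrightarrow>
     (\<forall>a b. a \<le> b \<longrightarrow> (\<exists>J. rs_has_integral h g J a b)) \<and>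
     ((\<lambda>(a,b). rs_integral h g a b) \<longlongrightarrow> I) (at_bot \<times>\<^sub>F at_top)"

definition rs_improper_integral :: "(real \<Rightarrow> complex) \<Rightarrow> (real \<Rightarrow> complex) \<Rightarrow> complex" where
  "rs_improper_integral h g = (THE I. rs_improper_has_integral h g I)"

text \<open>Integral of f = F' (F in B_c) against g of bounded variation:
  int f g = F(inf) g(inf) - int F dg.\<close>
definition alex_int :: "(real \<Rightarrow> complex) \<Rightarrow> (real \<Rightarrow> complex) \<Rightarrow> complex" where
  "alex_int F g = at_infty F * at_infty g - rs_improper_integral F g"

definition vfun :: "real \<Rightarrow> real \<Rightarrow> complex" where
  "vfun s t = (if t = 0 then complex_of_real (s^2 / 2)
     else (1 - \<i> * complex_of_real (s * t) - exp (- \<i> * complex_of_real (s * t))) / complex_of_real (t^2))"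

definition Omega :: "(real \<Rightarrow> complex) \<Rightarrow> real \<Rightarrow> complex" where
  "Omega F s = alex_int F (vfun s)"

text \<open>Distributional integral int phi hat(f), with hat(f) = Omega_f'', defined as the
  (improper Stieltjes) integral int Omega_f d(phi'); the argument dphi is phi'.\<close>
definition ft_pair :: "(real \<Rightarrow> complex) \<Rightarrow> (real \<Rightarrow> complex) \<Rightarrow> complex" where
  "ft_pair F dphi = rs_improper_integral (Omega F) dphi"

definition ft_pair_exists :: "(real \<Rightarrow> complex) \<Rightarrow> (real \<Rightarrow> complex) \<Rightarrow> bool" where
  "ft_pair_exists F dphi \<longleftrightarrow> (\<exists>I. rs_improper_has_integral (Omega F) dphi I)"

definition fourier :: "(real \<Rightarrow> complex) \<Rightarrow> real \<Rightarrow> complex" where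
  "fourier \<psi> s = (LINT t|lborel. exp (- \<i> * complex_of_real (s * t)) * \<psi> t)"

definition psi_a :: "(real \<Rightarrow> complex) \<Rightarrow> real \<Rightarrow> real \<Rightarrow> complex" where
  "psi_a \<psi> a x = \<psi> (x / a) / complex_of_real a"

definition Kker :: "(real \<Rightarrow> complex) \<Rightarrow> real \<Rightarrow> real \<Rightarrow> complex" where
  "Kker \<psi> a = fourier (psi_a \<psi> a)"

text \<open>Derivative of s \<mapsto> e^{ixs} K_a(s), where K_a' (s) = a \<psi>hat'(a s) and dpsi is \<psi>hat'.\<close>
definition dphi_ker :: "(real \<Rightarrow> complex) \<Rightarrow> (real \<Rightarrow> complex) \<Rightarrow> real \<Rightarrow> real \<Rightarrow> real \<Rightarrow> complex" where
  "dphi_ker \<psi> dpsi a x s = \<i> * complex_of_real x * exp (\<i> * complex_of_real (x * s)) * Kker \<psi> a s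
      + exp (\<i> * complex_of_real (x * s)) * (complex_of_real a * dpsi (a * s))"

definition Ia :: "(real \<Rightarrow> complex) \<Rightarrow> (real \<Rightarrow> complex) \<Rightarrow> (real \<Rightarrow> complex) \<Rightarrow> real \<Rightarrow> real \<Rightarrow> complex" where
  "Ia F \<psi> dpsi a x = ft_pair F (dphi_ker \<psi> dpsi a x) / complex_of_real (2 * pi)"

end

theory Submission
  imports Defs "HOL-Probability.Probability"
begin

text \<open>
  Write \<open>k = fourier \<psi>\<close> and \<open>g\<close> for the derivative of \<open>s \<mapsto> e\<^sup>i\<^sup>x\<^sup>s k s\<close>. Since \<open>Omega F s = - \<integral> F \<partial>\<^sub>t v\<^sub>s\<close>
  is bounded by a constant times \<open>s\<^sup>2 sup |F|\<close> and \<open>s\<^sup>2 g\<close> is integrable and of bounded variation up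
  to the factor \<open>e\<^sup>i\<^sup>x\<^sup>s\<close>, the functional sending \<open>F\<close> to the Stieltjes integral of \<open>Omega F\<close> against \<open>g\<close> is
  bounded in the supremum norm, locally uniformly in \<open>x\<close>. If \<open>F\<close> is the primitive of a continuous
  compactly supported \<open>f\<close>, then \<open>Omega F\<close> has second derivative \<open>fourier f\<close>, and two integrations by
  parts with Fourier inversion give \<open>2 \<pi> (f * \<psi>) x\<close>, the derivative of \<open>2 \<pi> (F * \<psi>)\<close> at \<open>x\<close>. By density the
  integral of the functional over \<open>{..x}\<close> is \<open>2 \<pi> (F * \<psi>) x\<close> for every \<open>F\<close>. Applied to \<open>psi_a \<psi> a\<close>
  this leaves the uniform convergence of \<open>F * psi_a \<psi> a\<close> to the uniformly continuous \<open>F\<close>.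
\<close>

subsection \<open>Gauge Riemann--Stieltjes integrals and absolute continuity\<close>

text \<open>The obstacle is the origin. The hypotheses control \<open>dpsi\<close> only after
  multiplication by s^2, so the integrator may be unbounded near 0 and has no ordinary total
  variation to work with there. Two facts compensate: \<open>Omega F\<close> vanishes to second
  order at 0, and absolute continuity of \<open>fourier \<psi>\<close> makes \<open>dpsi\<close>
  Lebesgue integrable near 0, hence on the line. A gauge ties each interval to its tag: away from 0
  the interval can be kept short compared with the distance of the tag from 0, and at the tag 0 the
  integrand is zero. This is why the variation is measured with the square of the tag as weight.

  The bound on the functional grows with |x|, since both the derivative and the increments of the
  factor e^(ixs) cost a factor |x|. It is therefore used only for x in compact intervals. The
  half-line is reached by letting the left endpoint tend to -\<infinity>, where F * \<psi> tends to
  0, so that the integral over \<open>{..x}\<close> is obtained as a limit and no absolute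
  integrability is claimed.\<close>

abbreviation rs_sum :: "(real \<Rightarrow> complex) \<Rightarrow> (real \<Rightarrow> complex) \<Rightarrow> (real \<times> real set) set \<Rightarrow> complex" where
  "rs_sum h g D \<equiv> (\<Sum>(x,K)\<in>D. h x * (g (Sup K) - g (Inf K)))"

text \<open>Increments on the two sides of the tag are kept apart: in the error of integration by
  parts the right one is multiplied by \<open>P v - P t\<close> and the left one by
  \<open>P u - P t\<close>.\<close>

abbreviation weighted_sum :: "(real \<Rightarrow> complex) \<Rightarrow> (real \<times> real set) set \<Rightarrow> real" where
  "weighted_sum g D \<equiv> (\<Sum>(t,K)\<in>D. t\<^sup>2 * (norm (g (Sup K) - g t) + norm (g t - g (Inf K))))"

lemma tagged_division_real_elem:
  fixes a b :: real
  assumes "D tagged_division_of {a..b}" "(t,K) \<in> D"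
  obtains u v where "K = {u..v}" "u \<le> t" "t \<le> v" "a \<le> u" "v \<le> b" "Sup K = v" "Inf K = u" "measure lborel K = v - u"
proof -
  obtain u v where K: "K = {u..v}"
    using tagged_division_ofD(4)[OF assms] by (metis box_real(2))
  have "t \<in> K" "K \<subseteq> {a..b}"
    using tagged_division_ofD(2,3)[OF assms] by auto
  then have "u \<le> t" "t \<le> v" "a \<le> u" "v \<le> b"
    using K by auto
  with K show thesis
    by (intro that[of u v]) auto
qed

text \<open>Errors of Riemann sums are always bounded by increments of a monotone function, which telescope.\<close>

lemma tagged_sum_telescope_le:
  fixes m :: "real \<Rightarrow> real"
  assumes D: "D tagged_division_of {a..b}" and "a \<le> b"
    and X: "\<And>t u v. (t,{u..v}) \<in> D \<Longrightarrow> u \<le> t \<Longrightarrow> t \<le> v \<Longrightarrow> X (t,{u..v}) \<le> m v - m u"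
  shows "sum X D \<le> m b - m a"
proof -
  have "sum X D \<le> (\<Sum>(t,K)\<in>D. m (Sup K) - m (Inf K))"
  proof (rule sum_mono)
    fix p assume p: "p \<in> D"
    obtain t K where tK: "p = (t,K)" by (cases p)
    with p have "(t,K) \<in> D" by simp
    then obtain u v where "K = {u..v}" "u \<le> t" "t \<le> v" "Sup K = v" "Inf K = u"
      by (rule tagged_division_real_elem[OF D])
    with \<open>(t,K) \<in> D\<close> show "X p \<le> (case p of (t,K) \<Rightarrow> m (Sup K) - m (Inf K))"
      using X[of t u v] by (simp add: tK)
  qed
  also have "\<dots> = m b - m a"
    using additive_tagged_division_1[OF \<open>a \<le> b\<close> D, of m] by simp
  finally show ?thesis .
qed

text \<open>Because the tag lies between the endpoints, the one-sided errors, relative to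
  \<open>v - t\<close> and \<open>t - u\<close>, add up to an error relative to the full length
  \<open>v - u\<close>. Errors of this form telescope.\<close>

lemma has_vector_derivative_straddle:
  fixes g :: "real \<Rightarrow> 'a::real_normed_vector"
  assumes "(g has_vector_derivative g') (at t)" "\<eta> > 0"
  shows "\<exists>d>0. \<forall>u v. u \<le> t \<and> t \<le> v \<and> u \<in> ball t d \<and> v \<in> ball t d \<longrightarrow>
           norm (g v - g u - (v - u) *\<^sub>R g') \<le> \<eta> * (v - u)"
proof -
  obtain d where d: "d > 0" "\<And>y. norm (y - t) < d \<Longrightarrow> norm (g y - g t - (y - t) *\<^sub>R g') \<le> \<eta> * norm (y - t)"
    using assms unfolding has_vector_derivative_def has_derivative_within_alt by (metis UNIV_I)
  show ?thesis
  proof (intro exI[of _ d] conjI d allI impI)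
    fix u v assume uv: "u \<le> t \<and> t \<le> v \<and> u \<in> ball t d \<and> v \<in> ball t d"
    have "g v - g u - (v - u) *\<^sub>R g' = (g v - g t - (v - t) *\<^sub>R g') - (g u - g t - (u - t) *\<^sub>R g')"
      by (simp add: algebra_simps)
    also have "norm \<dots> \<le> \<eta> * norm (v - t) + \<eta> * norm (u - t)"
      using uv by (intro order.trans[OF norm_triangle_ineq4] add_mono d(2)) (auto simp: dist_real_def)
    also have "\<dots> = \<eta> * (v - u)"
      using uv by (simp add: algebra_simps)
    finally show "norm (g v - g u - (v - u) *\<^sub>R g') \<le> \<eta> * (v - u)" .
  qed
qed

text \<open>A division fine for both gauges exists by Cousin's lemma. Uniqueness is what gives the
  THE in \<open>rs_integral\<close> its value.\<close>

lemma rs_has_integral_unique: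
  assumes "rs_has_integral h g I a b" "rs_has_integral h g J a b"
  shows "I = J"
proof (rule ccontr)
  assume "I \<noteq> J"
  then have e: "norm (I - J) / 2 > 0" by simp
  obtain \<gamma>1 where 1: "gauge \<gamma>1" "\<And>D. D tagged_division_of {a..b} \<Longrightarrow> \<gamma>1 fine D \<Longrightarrow>
      norm (rs_sum h g D - I) < norm (I - J) / 2"
    using assms(1) e unfolding rs_has_integral_def by meson
  obtain \<gamma>2 where 2: "gauge \<gamma>2" "\<And>D. D tagged_division_of {a..b} \<Longrightarrow> \<gamma>2 fine D \<Longrightarrow>
      norm (rs_sum h g D - J) < norm (I - J) / 2"
    using assms(2) e unfolding rs_has_integral_def by meson
  obtain D where D: "D tagged_division_of {a..b}" "(\<lambda>x. \<gamma>1 x \<inter> \<gamma>2 x) fine D"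
    using fine_division_exists_real[OF gauge_Int[OF 1(1) 2(1)]] by blast
  let ?S = "rs_sum h g D"
  have "norm (?S - I) < norm (I - J) / 2" "norm (?S - J) < norm (I - J) / 2"
    using 1(2)[OF D(1)] 2(2)[OF D(1)] D(2) unfolding fine_Int by auto
  then have "norm (I - J) < norm (I - J) / 2 + norm (I - J) / 2"
    using norm_triangle_ineq4[of "?S - J" "?S - I"] by simp
  then show False by simp
qed

lemma rs_integral_eq: "rs_has_integral h g I a b \<Longrightarrow> rs_integral h g a b = I"
  unfolding rs_integral_def using rs_has_integral_unique by blast

lemma at_bot_times_at_top_neq_bot: "(at_bot :: real filter) \<times>\<^sub>F (at_top :: real filter) \<noteq> bot"
  by (simp add: prod_filter_eq_bot)

lemma rs_improper_integral_eq:
  assumes "rs_improper_has_integral h g I"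
  shows "rs_improper_integral h g = I"
  unfolding rs_improper_integral_def
proof (rule the_equality)
  fix J assume "rs_improper_has_integral h g J"
  with assms show "J = I"
    unfolding rs_improper_has_integral_def
    using tendsto_unique[OF at_bot_times_at_top_neq_bot] by blast
qed (rule assms)

text \<open>The gauge may depend on the tag: dividing the straddle tolerance by
  \<open>norm (h t) + 1\<close> absorbs the factor \<open>h t\<close> without any bound on
  \<open>h\<close>, and the errors add up to \<open>\<eta> * (b - a)\<close>.\<close>

lemma rs_has_integral_C1:
  assumes ab: "a \<le> b"
    and g: "\<And>t. t \<in> {a..b} \<Longrightarrow> (g has_vector_derivative g' t) (at t)"
    and J: "((\<lambda>t. h t * g' t) has_integral J) {a..b}"
  shows "rs_has_integral h g J a b"
  unfolding rs_has_integral_def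
proof (intro allI impI)
  fix e :: real assume "e > 0"
  \<comment> \<open>The summand 1 keeps the denominator positive when the interval is a point and
    makes the resulting bound strict.\<close>
  define \<eta> where "\<eta> = e / 2 / (b - a + 1)"
  have \<eta>: "\<eta> > 0" "\<eta> * (b - a) < e / 2"
    using \<open>e > 0\<close> ab by (auto simp: \<eta>_def field_simps)
  obtain \<gamma> where \<gamma>: "gauge \<gamma>" "\<And>D. D tagged_division_of {a..b} \<Longrightarrow> \<gamma> fine D \<Longrightarrow>
      norm ((\<Sum>(x,K)\<in>D. measure lborel K *\<^sub>R (h x * g' x)) - J) < e / 2"
    using J \<open>e > 0\<close> unfolding has_integral_real by (metis half_gt_zero)
  have "\<exists>d>0. t \<in> {a..b} \<longrightarrow> (\<forall>u v. u \<le> t \<and> t \<le> v \<and> u \<in> ball t d \<and> v \<in> ball t d \<longrightarrow>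
           norm (g v - g u - (v - u) *\<^sub>R g' t) \<le> \<eta> / (norm (h t) + 1) * (v - u))" for t
  proof (cases "t \<in> {a..b}")
    case True
    have "\<eta> / (norm (h t) + 1) > 0"
      using \<eta> by (intro divide_pos_pos add_nonneg_pos) auto
    from has_vector_derivative_straddle[OF g[OF True] this] show ?thesis by blast
  qed (auto intro: exI[of _ 1])
  then obtain d where d: "\<And>t. d t > 0"
    "\<And>t u v. t \<in> {a..b} \<Longrightarrow> u \<le> t \<Longrightarrow> t \<le> v \<Longrightarrow> u \<in> ball t (d t) \<Longrightarrow> v \<in> ball t (d t) \<Longrightarrow>
           norm (g v - g u - (v - u) *\<^sub>R g' t) \<le> \<eta> / (norm (h t) + 1) * (v - u)"
    by metis
  show "\<exists>\<gamma>. gauge \<gamma> \<and> (\<forall>D. D tagged_division_of {a..b} \<and> \<gamma> fine D \<longrightarrow>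
      norm (rs_sum h g D - J) < e)"
  proof (intro exI[of _ "\<lambda>t. \<gamma> t \<inter> ball t (d t)"] conjI allI impI)
    show "gauge (\<lambda>t. \<gamma> t \<inter> ball t (d t))"
      using \<gamma>(1) d(1) by (intro gauge_Int gauge_ball_dependent) auto
    fix D assume "D tagged_division_of {a..b} \<and> (\<lambda>t. \<gamma> t \<inter> ball t (d t)) fine D"
    then have D: "D tagged_division_of {a..b}" "\<gamma> fine D" "(\<lambda>t. ball t (d t)) fine D"
      by (auto simp: fine_Int)
    let ?S = "rs_sum h g D"
    let ?T = "\<Sum>(x,K)\<in>D. measure lborel K *\<^sub>R (h x * g' x)"
    have "norm (?S - ?T) \<le> (\<Sum>p\<in>D. norm ((case p of (x,K) \<Rightarrow> h x * (g (Sup K) - g (Inf K))) - (case p of (x,K) \<Rightarrow> measure lborel K *\<^sub>R (h x * g' x))))"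
      unfolding sum_subtractf[symmetric] by (rule norm_sum)
    also have "\<dots> \<le> (\<lambda>y. \<eta> * y) b - (\<lambda>y. \<eta> * y) a"
    proof (rule tagged_sum_telescope_le[OF D(1) ab], unfold split)
      fix t u v assume p: "(t,{u..v}) \<in> D" "u \<le> t" "t \<le> v"
      have "{u..v} \<subseteq> ball t (d t)" using D(3) p by (auto simp: fine_def)
      moreover have "u \<in> {u..v}" "v \<in> {u..v}" using p by auto
      ultimately have uv: "u \<in> ball t (d t)" "v \<in> ball t (d t)" by blast+
      have t: "t \<in> {a..b}" using tag_in_interval[OF D(1) p(1)] by simp
      have "u \<le> v" using p by simp
      then have "norm (h t * (g (Sup {u..v}) - g (Inf {u..v})) - measure lborel {u..v} *\<^sub>R (h t * g' t))
        = norm (h t) * norm (g v - g u - (v - u) *\<^sub>R g' t)"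
        by (simp add: norm_mult[symmetric] algebra_simps)
      also have "\<dots> \<le> (norm (h t) + 1) * (\<eta> / (norm (h t) + 1) * (v - u))"
        using d(2)[OF t p(2,3) uv] by (intro mult_mono) auto
      also have "\<dots> = \<eta> * (v - u)"
        using norm_ge_zero[of "h t"] by (simp add: add_nonneg_eq_0_iff)
      finally show "norm (h t * (g (Sup {u..v}) - g (Inf {u..v})) - measure lborel {u..v} *\<^sub>R (h t * g' t)) \<le> \<eta> * v - \<eta> * u"
        by (simp add: algebra_simps)
    qed
    finally have "norm (?S - ?T) < e / 2"
      using \<eta> by (simp add: algebra_simps)
    with \<gamma>(2)[OF D(1,2)] show "norm (?S - J) < e"
      using norm_diff_triangle_less[of ?S ?T "e/2" J "e/2"] by simp
  qed
qed

section \<open>The fundamental theorem of calculus for absolutely continuous functions\<close>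

text \<open>Integrability of \<open>k'\<close> is a conclusion, as is natural for the gauge
  integral. Tags outside \<open>N\<close> are treated by the straddle lemma. At tags in
  \<open>N\<close> the gauge confines the intervals to an open set of measure less than
  \<open>\<delta>\<close>, so that absolute continuity bounds the sum of the increments of
  \<open>k\<close> over them.\<close>

lemma abs_cont_FTC:
  assumes ac: "abs_cont_on {a..b} k" and ab: "a \<le> b" and N: "negligible N"
    and der: "\<And>t. t \<in> {a..b} - N \<Longrightarrow> (k has_vector_derivative k' t) (at t)"
  shows "(k' has_integral (k b - k a)) {a..b}"
proof -
  \<comment> \<open>With value 0 on \<open>N\<close>, a tag in \<open>N\<close> contributes only the
    increment of \<open>k\<close> to the error. The null set is restored at the end by
    \<open>has_integral_spike\<close>.\<close>
  define f where "f t = (if t \<in> N then 0 else k' t)" for t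
  have "(f has_integral (k b - k a)) {a..b}"
    unfolding has_integral_real
  proof (intro allI impI)
    fix e :: real assume "e > 0"
    define \<eta> where "\<eta> = e / 2 / (b - a + 1)"
    have \<eta>: "\<eta> > 0" "\<eta> * (b - a) < e / 2"
      using \<open>e > 0\<close> ab by (auto simp: \<eta>_def field_simps)
    have "e / 2 > 0" using \<open>e > 0\<close> by simp
    then obtain \<delta> where \<delta>: "\<delta> > 0" "\<forall>(n::nat) (x::nat \<Rightarrow> real) y.
        (\<forall>i<n. x i \<le> y i \<and> {x i..y i} \<subseteq> {a..b}) \<and>
        (\<forall>i<n. \<forall>j<n. i \<noteq> j \<longrightarrow> y i \<le> x j \<or> y j \<le> x i) \<and>
        (\<Sum>i<n. y i - x i) < \<delta> \<longrightarrow> (\<Sum>i<n. norm (k (y i) - k (x i))) < e / 2"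
      using ac unfolding abs_cont_on_def by blast
    have Nl: "N \<in> sets lebesgue" "emeasure lebesgue N = 0"
      using N by (auto simp: negligible_iff_null_sets)
    obtain U where U: "open U" "N \<subseteq> U" "U - N \<in> lmeasurable" "emeasure lebesgue (U - N) < ennreal \<delta>"
      using sets_lebesgue_outer_open[OF Nl(1) \<delta>(1)] by metis
    have Uf: "emeasure lborel U < ennreal \<delta>"
    proof -
      have "U \<in> sets borel" using U by auto
      then have "emeasure lborel U = emeasure lebesgue U" by simp
      also have "\<dots> = emeasure lebesgue (N \<union> (U - N))" using U by (simp add: Un_absorb1)
      also have "\<dots> \<le> emeasure lebesgue N + emeasure lebesgue (U - N)"
        using U Nl by (intro emeasure_subadditive) auto
      finally show ?thesis using Nl U by simp
    qed
    \<comment> \<open>Tags in \<open>N\<close> have their intervals inside \<open>U\<close>, where increments of \<open>m\<close> are lengths.\<close>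
    define m where "m y = measure lborel (U \<inter> {a..y})" for y
    have fm: "U \<inter> S \<in> fmeasurable lborel" if "S \<in> sets borel" for S
      using U Uf that by (intro fmeasurableI order.strict_trans1[OF emeasure_mono[of _ U] order.strict_trans[OF Uf]]) auto
    have m_diff: "m v - m u = measure lborel (U \<inter> {u<..v})" if "a \<le> u" "u \<le> v" for u v
    proof -
      have "m v = measure lborel ((U \<inter> {a..u}) \<union> (U \<inter> {u<..v}))"
        unfolding m_def using that by (intro arg_cong[where f="measure lborel"]) auto
      also have "\<dots> = m u + measure lborel (U \<inter> {u<..v})"
        unfolding m_def by (intro measure_Un_AE) (auto intro: fm)
      finally show ?thesis by simp
    qed
    have mb: "m b - m a < \<delta>"
    proof -
      have "m b - m a \<le> measure lborel U"
        unfolding m_diff[OF order.refl ab] using fm[of UNIV] U by (intro measure_mono_fmeasurable) auto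
      also have "\<dots> < \<delta>"
        using Uf \<delta>(1) fm[of UNIV] by (simp add: emeasure_eq_measure2 ennreal_less_iff)
      finally show ?thesis .
    qed
    have "\<exists>d>0. (t \<in> {a..b} - N \<longrightarrow> (\<forall>u v. u \<le> t \<and> t \<le> v \<and> u \<in> ball t d \<and> v \<in> ball t d \<longrightarrow>
             norm (k v - k u - (v - u) *\<^sub>R k' t) \<le> \<eta> * (v - u))) \<and> (t \<in> N \<longrightarrow> ball t d \<subseteq> U)" for t
    proof (cases "t \<in> N")
      case True
      then show ?thesis using U openE by (metis DiffD2 subsetD)
    next
      case False
      then show ?thesis using has_vector_derivative_straddle[OF der \<eta>(1), of t]
        by (cases "t \<in> {a..b}") (auto intro: exI[of _ 1])
    qed
    then obtain d where d: "\<And>t. d t > 0"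
      "\<And>t u v. t \<in> {a..b} - N \<Longrightarrow> u \<le> t \<Longrightarrow> t \<le> v \<Longrightarrow> u \<in> ball t (d t) \<Longrightarrow> v \<in> ball t (d t) \<Longrightarrow>
             norm (k v - k u - (v - u) *\<^sub>R k' t) \<le> \<eta> * (v - u)"
      "\<And>t. t \<in> N \<Longrightarrow> ball t (d t) \<subseteq> U"
      by metis
    show "\<exists>\<gamma>. gauge \<gamma> \<and> (\<forall>D. D tagged_division_of {a..b} \<and> \<gamma> fine D \<longrightarrow>
        norm ((\<Sum>(x,K)\<in>D. measure lborel K *\<^sub>R f x) - (k b - k a)) < e)"
    proof (intro exI[of _ "\<lambda>t. ball t (d t)"] conjI allI impI)
      show "gauge (\<lambda>t. ball t (d t))"
        using d(1) by (intro gauge_ball_dependent) auto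
      fix D assume "D tagged_division_of {a..b} \<and> (\<lambda>t. ball t (d t)) fine D"
      then have D: "D tagged_division_of {a..b}" "(\<lambda>t. ball t (d t)) fine D" by auto
      have finD: "finite D" using D(1) by auto
      have el: "u \<in> ball t (d t)" "v \<in> ball t (d t)" "{u..v} \<subseteq> ball t (d t)" "t \<in> {a..b}" "{u..v} \<subseteq> {a..b}"
        if "(t,{u..v}) \<in> D" "u \<le> t" "t \<le> v" for t u v
      proof -
        show *: "{u..v} \<subseteq> ball t (d t)" using D(2) that by (auto simp: fine_def)
        have "u \<in> {u..v}" "v \<in> {u..v}" using that by auto
        with * show "u \<in> ball t (d t)" "v \<in> ball t (d t)" by blast+
        show "t \<in> {a..b}" using tag_in_interval[OF D(1) that(1)] by simp
        show "{u..v} \<subseteq> {a..b}" using tagged_division_ofD(3)[OF D(1) that(1)] .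
      qed
      \<comment> \<open>Degenerate intervals are discarded: they may lie inside others and so violate non-overlap.\<close>
      define E where "E = {p \<in> D. fst p \<in> N \<and> Inf (snd p) < Sup (snd p)}"
      let ?n = "\<lambda>p. norm (k (Sup (snd p)) - k (Inf (snd p)))"
      have E: "sum ?n E < e / 2"
      proof -
        have finE: "finite E" using finD by (simp add: E_def)
        obtain q where q: "bij_betw q {..<card E} E"
          using ex_bij_betw_nat_finite[OF finE] by (auto simp: atLeast0LessThan)
        have qE: "q i \<in> E" if "i < card E" for i
          using q that by (auto simp: bij_betw_def)
        have form: "\<exists>t u v. p = (t,{u..v}) \<and> u \<le> t \<and> t \<le> v \<and> t \<in> N \<and> u < v \<and> (t,{u..v}) \<in> D" if "p \<in> E" for p
        proof -
          obtain t K where tK: "p = (t,K)" by (cases p)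
          have "(t,K) \<in> D" using that tK by (simp add: E_def)
          then obtain u v where "K = {u..v}" "u \<le> t" "t \<le> v" "Sup K = v" "Inf K = u"
            by (rule tagged_division_real_elem[OF D(1)])
          with \<open>(t,K) \<in> D\<close> show ?thesis
            using that by (auto simp: tK E_def)
        qed
        have "(\<Sum>i<card E. norm (k (Sup (snd (q i))) - k (Inf (snd (q i))))) < e / 2"
        proof (rule \<delta>(2)[rule_format], intro conjI allI impI)
          fix i assume "i < card E"
          then obtain t u v where "q i = (t,{u..v})" "u \<le> t" "t \<le> v" "(t,{u..v}) \<in> D"
            using form[OF qE] by blast
          then show "Inf (snd (q i)) \<le> Sup (snd (q i))" "{Inf (snd (q i))..Sup (snd (q i))} \<subseteq> {a..b}"
            using el(5) by simp_all
        next
          fix i j assume ij: "i < card E" "j < card E" "i \<noteq> j"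
          obtain t u v where 1: "q i = (t,{u..v})" "u < v" "(t,{u..v}) \<in> D" using form[OF qE[OF ij(1)]] by blast
          obtain t' u' v' where 2: "q j = (t',{u'..v'})" "u' < v'" "(t',{u'..v'}) \<in> D" using form[OF qE[OF ij(2)]] by blast
          have "q i \<noteq> q j" using ij q unfolding bij_betw_def inj_on_def by auto
          then have "interior {u..v} \<inter> interior {u'..v'} = {}"
            using tagged_division_ofD(5)[OF D(1) 1(3) 2(3)] 1 2 by auto
          then have "{max u u'<..<min v v'} = {}" by (auto simp: set_eq_iff)
          then have "v \<le> u' \<or> v' \<le> u" using 1(2) 2(2) by (auto simp: greaterThanLessThan_empty_iff)
          then show "Sup (snd (q i)) \<le> Inf (snd (q j)) \<or> Sup (snd (q j)) \<le> Inf (snd (q i))"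
            using 1 2 by auto
        next
          have "(\<Sum>i<card E. Sup (snd (q i)) - Inf (snd (q i))) = (\<Sum>p\<in>E. Sup (snd p) - Inf (snd p))"
            using q by (rule sum.reindex_bij_betw)
          also have "\<dots> = (\<Sum>p\<in>D. if p \<in> E then Sup (snd p) - Inf (snd p) else 0)"
            using finD by (simp add: sum.If_cases E_def Int_def conj_commute)
          also have "\<dots> \<le> m b - m a"
          proof (rule tagged_sum_telescope_le[OF D(1) ab])
            fix t u v assume p: "(t,{u..v}) \<in> D" "u \<le> t" "t \<le> v"
            note el = el[OF p]
            have au: "a \<le> u" "u \<le> v" using el(5) p by auto
            show "(if (t,{u..v}) \<in> E then Sup (snd (t,{u..v})) - Inf (snd (t,{u..v})) else 0) \<le> m v - m u"
            proof (cases "(t,{u..v}) \<in> E")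
              case True
              then have "t \<in> N" by (simp add: E_def)
              then have "U \<inter> {u<..v} = {u<..v}" using d(3) el(3) by fastforce
              then show ?thesis using au by (simp add: m_diff)
            qed (use au in \<open>simp add: m_diff\<close>)
          qed
          finally show "(\<Sum>i<card E. Sup (snd (q i)) - Inf (snd (q i))) < \<delta>" using mb by simp
        qed
        also have "(\<Sum>i<card E. norm (k (Sup (snd (q i))) - k (Inf (snd (q i))))) = sum ?n E"
          using q by (rule sum.reindex_bij_betw)
        finally show ?thesis .
      qed
      have "k b - k a = (\<Sum>(x,K)\<in>D. k (Sup K) - k (Inf K))"
        using additive_tagged_division_1[OF ab D(1), of k] by simp
      then have "norm ((\<Sum>(x,K)\<in>D. measure lborel K *\<^sub>R f x) - (k b - k a))
        \<le> (\<Sum>p\<in>D. norm ((case p of (x,K) \<Rightarrow> measure lborel K *\<^sub>R f x) - (case p of (x,K) \<Rightarrow> k (Sup K) - k (Inf K))))"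
        by (simp only: sum_subtractf[symmetric] norm_sum)
      \<comment> \<open>The increments over \<open>E\<close> are split off. What remains is zero at
        every tag in \<open>N\<close>, also on degenerate intervals, so only the straddle error has
        to telescope.\<close>
      also have "\<dots> = (\<Sum>p\<in>D. (norm ((case p of (x,K) \<Rightarrow> measure lborel K *\<^sub>R f x) - (case p of (x,K) \<Rightarrow> k (Sup K) - k (Inf K))) - (if p \<in> E then ?n p else 0))) + sum ?n E"
        using finD by (simp add: sum_subtractf sum.If_cases E_def Int_def conj_commute)
      also have "(\<Sum>p\<in>D. (norm ((case p of (x,K) \<Rightarrow> measure lborel K *\<^sub>R f x) - (case p of (x,K) \<Rightarrow> k (Sup K) - k (Inf K))) - (if p \<in> E then ?n p else 0)))
          \<le> (\<lambda>y. \<eta> * y) b - (\<lambda>y. \<eta> * y) a"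
      proof (rule tagged_sum_telescope_le[OF D(1) ab], unfold split)
        fix t u v assume p: "(t,{u..v}) \<in> D" "u \<le> t" "t \<le> v"
        note el = el[OF p]
        have uv: "u \<le> v" using p by simp
        show "norm (measure lborel {u..v} *\<^sub>R f t - (k (Sup {u..v}) - k (Inf {u..v}))) - (if (t,{u..v}) \<in> E then ?n (t,{u..v}) else 0) \<le> \<eta> * v - \<eta> * u"
        proof (cases "t \<in> N")
          case True
          have "\<eta> * u \<le> \<eta> * v" using uv \<eta> by simp
          then show ?thesis using True uv p(1) by (cases "u = v") (simp_all add: f_def E_def norm_minus_commute)
        next
          case False
          then have "norm (k v - k u - (v - u) *\<^sub>R k' t) \<le> \<eta> * (v - u)"
            using d(2) el p by blast
          then show ?thesis using False uv
            by (simp add: f_def E_def norm_minus_commute algebra_simps)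
        qed
      qed
      finally show "norm ((\<Sum>(x,K)\<in>D. measure lborel K *\<^sub>R f x) - (k b - k a)) < e"
        using E \<eta>(2) by (simp add: algebra_simps)
    qed
  qed
  then show ?thesis
    by (rule has_integral_spike[OF N, rotated]) (simp add: f_def)
qed

subsection \<open>Bounded variation and weighted Riemann--Stieltjes sums\<close>

text \<open>The majorant is the variation up to \<open>x\<close>, the supremum over finite chains
  ending at or before \<open>x\<close>. Domination by increments of a bounded real function is the
  form of bounded variation that telescopes over tagged divisions.\<close>

lemma bv_on_R_majorant:
  assumes "bv_on_R h"
  obtains V M where "\<And>x y. x \<le> y \<Longrightarrow> norm (h y - h x) \<le> V y - V x" "\<And>x. \<bar>V x\<bar> \<le> (M::real)"
proof -
  obtain M where M: "\<And>(n::nat) p. (\<forall>i<n. p i \<le> p (Suc i)) \<Longrightarrow> (\<Sum>i<n. norm (h (p (Suc i)) - h (p i))) \<le> M"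
    using assms unfolding bv_on_R_def by blast
  define S where "S x = {(\<Sum>i<n. norm (h (p (Suc i)) - h (p i))) | n p. (\<forall>i<n. p i \<le> p (Suc i)) \<and> p n \<le> x}" for x :: real
  have S0: "0 \<in> S x" for x
    unfolding S_def by (intro CollectI exI[of _ 0] exI[of _ "\<lambda>_. x"]) auto
  have bdd: "bdd_above (S x)" for x
    using M unfolding S_def by (intro bdd_aboveI[of _ M]) blast
  define V where "V x = Sup (S x)" for x
  have "norm (h y - h x) \<le> V y - V x" if xy: "x \<le> y" for x y
  proof -
    have "s \<le> V y - norm (h y - h x)" if s: "s \<in> S x" for s
    proof -
      obtain n p where p: "s = (\<Sum>i<n. norm (h (p (Suc i)) - h (p i)))" "\<And>i. i < n \<Longrightarrow> p i \<le> p (Suc i)" "p n \<le> x"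
        using s unfolding S_def by blast
      \<comment> \<open>The chain is prolonged by the points \<open>x\<close> and \<open>y\<close>.
        The step from its old end to \<open>x\<close> only adds a nonnegative term; the step from
        \<open>x\<close> to \<open>y\<close> gives the increment in question.\<close>
      define p' where "p' i = (if i \<le> n then p i else if i = Suc n then x else y)" for i
      have "(\<Sum>i<n. norm (h (p' (Suc i)) - h (p' i))) = s"
        unfolding p by (intro sum.cong) (auto simp: p'_def)
      then have "(\<Sum>i<Suc (Suc n). norm (h (p' (Suc i)) - h (p' i))) = s + norm (h x - h (p n)) + norm (h y - h x)"
        by (simp add: p'_def)
      moreover have "(\<Sum>i<Suc (Suc n). norm (h (p' (Suc i)) - h (p' i))) \<in> S y"
        unfolding S_def using p(2,3) xy
        by (intro CollectI exI[of _ "Suc (Suc n)"] exI[of _ p']) (auto simp: p'_def less_Suc_eq)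
      ultimately have "s + norm (h x - h (p n)) + norm (h y - h x) \<le> V y"
        unfolding V_def using bdd by (metis cSup_upper)
      then show ?thesis
        using norm_ge_zero[of "h x - h (p n)"] by linarith
    qed
    then have "V x \<le> V y - norm (h y - h x)"
      unfolding V_def[of x] using S0 by (intro cSup_least) auto
    then show ?thesis by simp
  qed
  moreover have "\<bar>V x\<bar> \<le> M" for x
  proof -
    have "0 \<le> V x" unfolding V_def using S0 bdd by (intro cSup_upper) auto
    moreover have "V x \<le> M" unfolding V_def using S0 M by (intro cSup_least) (auto simp: S_def)
    ultimately show ?thesis by simp
  qed
  ultimately show thesis by (rule that)
qed

section \<open>Decay of integrable functions of bounded variation\<close>

text \<open>A Chebyshev-type bound: a lower bound for \<open>q\<close> on a single interval already
  bounds the whole integral from below. Below it contradicts integrability once the weight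
  \<open>w\<close> has large mass.\<close>

lemma weighted_integral_le:
  fixes q w :: "real \<Rightarrow> real"
  assumes q: "integrable lborel q" "\<And>s. 0 \<le> q s"
    and w: "(w has_integral J) {u..v}" "\<And>s. s \<in> {u..v} \<Longrightarrow> c * w s \<le> q s"
  shows "c * J \<le> (LINT s|lborel. q s)"
proof -
  have qi: "q integrable_on UNIV" "q integrable_on {u..v}"
    using integrable_on_lborel[OF q(1)] integrable_on_subinterval[of q UNIV u v] by auto
  have "c * J \<le> integral {u..v} q"
    using has_integral_le[OF has_integral_mult_right[OF w(1)] integrable_integral[OF qi(2)]] w(2) by auto
  also have "\<dots> \<le> integral UNIV q"
    using qi q(2) by (intro integral_subset_le) auto
  finally show ?thesis using integral_lborel[OF q(1)] by simp
qed

text \<open>The bounded monotone \<open>V\<close> is almost constant far to the right, so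
  \<open>H\<close> varies there by at most \<open>\<epsilon>\<close>. If \<open>H\<close> exceeded
  \<open>2 * \<epsilon>\<close> at one such point, it would exceed \<open>\<epsilon>\<close> from
  there on, and \<open>norm (H s)\<close> could not be integrable.\<close>

lemma bv_integrable_tendsto_0_at_top:
  fixes H :: "real \<Rightarrow> 'a::real_normed_vector" and V :: "real \<Rightarrow> real"
  assumes V: "\<And>x y. x \<le> y \<Longrightarrow> norm (H y - H x) \<le> V y - V x" "\<And>x. \<bar>V x\<bar> \<le> M"
    and int: "integrable lborel (\<lambda>s. norm (H s))"
  shows "(H \<longlongrightarrow> 0) at_top"
proof (rule tendstoI)
  fix e :: real assume "e > 0"
  define \<epsilon> where "\<epsilon> = e / 4"
  have \<epsilon>: "\<epsilon> > 0" using \<open>e > 0\<close> by (simp add: \<epsilon>_def)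
  have mono: "V x \<le> V y" if "x \<le> y" for x y
    using V(1)[OF that] norm_ge_zero[of "H y - H x"] by linarith
  have bdd: "bdd_above (range V)"
    using V(2) by (intro bdd_aboveI[of _ M]) (auto simp: abs_le_iff)
  obtain y0 where y0: "Sup (range V) - \<epsilon> < V y0"
    using less_cSup_iff[OF _ bdd, of "Sup (range V) - \<epsilon>"] \<epsilon> by auto
  have small: "V y - V x \<le> \<epsilon>" if "y0 \<le> x" for x y
    using mono[OF that] cSup_upper[OF _ bdd, of "V y"] y0 by auto
  have le: "norm (H x1) \<le> 2 * \<epsilon>" if x1: "y0 \<le> x1" for x1
  proof (rule ccontr)
    assume gt: "\<not> norm (H x1) \<le> 2 * \<epsilon>"
    define I where "I = (LINT s|lborel. norm (H s))"
    \<comment> \<open>The length is chosen so that \<open>\<epsilon> * T\<close> equals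
      \<open>\<bar>I\<bar> + 1\<close>, which is more than the integral allows.\<close>
    define T where "T = (\<bar>I\<bar> + 1) / \<epsilon>"
    have "\<epsilon> * T \<le> I"
      unfolding I_def
    proof (rule weighted_integral_le[OF int norm_ge_zero])
      show "((\<lambda>_. 1) has_integral T) {x1..x1 + T}"
        using has_integral_const_real[of "1::real" x1 "x1 + T"] \<epsilon> by (simp add: T_def)
      show "\<epsilon> * 1 \<le> norm (H s)" if "s \<in> {x1..x1 + T}" for s
      proof -
        have "norm (H s - H x1) \<le> \<epsilon>"
          using V(1)[of x1 s] small[OF x1, of s] that by auto
        moreover have "norm (H x1) \<le> norm (H s) + norm (H s - H x1)"
          by (metis norm_minus_commute norm_triangle_sub)
        ultimately show ?thesis using gt by auto
      qed
    qed
    then show False using \<epsilon> by (simp add: T_def)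
  qed
  have "dist (H x) 0 < e" if "y0 \<le> x" for x
    using le[OF that] \<open>e > 0\<close> by (simp add: \<epsilon>_def)
  then show "\<forall>\<^sub>F x in at_top. dist (H x) 0 < e"
    unfolding eventually_at_top_linorder by blast
qed

lemma bv_integrable_tendsto_0_at_bot:
  fixes H :: "real \<Rightarrow> 'a::real_normed_vector" and V :: "real \<Rightarrow> real"
  assumes V: "\<And>x y. x \<le> y \<Longrightarrow> norm (H y - H x) \<le> V y - V x" "\<And>x. \<bar>V x\<bar> \<le> M"
    and int: "integrable lborel (\<lambda>s. norm (H s))"
  shows "(H \<longlongrightarrow> 0) at_bot"
  unfolding filterlim_at_bot_mirror
proof (rule bv_integrable_tendsto_0_at_top)
  show "norm (H (- y) - H (- x)) \<le> - V (- y) - - V (- x)" if "x \<le> y" for x y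
    using V(1)[of "- y" "- x"] that by (simp add: norm_minus_commute)
  show "\<bar>- V (- x)\<bar> \<le> M" for x using V(2) by simp
  show "integrable lborel (\<lambda>s. norm (H (- s)))"
    using lborel_integrable_real_affine[OF int, of "-1" 0] by simp
qed

text \<open>The argument at infinity is repeated with the weight 1 / s^2, whose mass on intervals
  reaching down to 0 is infinite. Only monotonicity of \<open>V\<close> enters, since
  \<open>V 0\<close> bounds it from below on the right of 0.\<close>

lemma bv_integrable_tendsto_0_at_right:
  fixes H :: "real \<Rightarrow> 'a::real_normed_vector" and V :: "real \<Rightarrow> real"
  assumes V: "\<And>x y. x \<le> y \<Longrightarrow> norm (H y - H x) \<le> V y - V x"
    and int: "integrable lborel (\<lambda>s. norm (H s) / s\<^sup>2)"
  shows "(H \<longlongrightarrow> 0) (at_right 0)"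
proof (rule tendstoI)
  fix e :: real assume "e > 0"
  define \<epsilon> where "\<epsilon> = e / 4"
  have \<epsilon>: "\<epsilon> > 0" using \<open>e > 0\<close> by (simp add: \<epsilon>_def)
  have mono: "V x \<le> V y" if "x \<le> y" for x y
    using V(1)[OF that] norm_ge_zero[of "H y - H x"] by linarith
  have bdd: "bdd_below (V ` {0<..})"
    using mono by (intro bdd_belowI[of _ "V 0"]) auto
  have "\<exists>y0>0. V y0 < Inf (V ` {0<..}) + \<epsilon>"
    using cInf_less_iff[OF _ bdd, of "Inf (V ` {0<..}) + \<epsilon>"] \<epsilon> by auto
  then obtain y0 where y0: "y0 > 0" "V y0 < Inf (V ` {0<..}) + \<epsilon>" by blast
  have small: "V y - V x \<le> \<epsilon>" if "0 < x" "y \<le> y0" for x y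
    using mono[OF that(2)] cInf_lower[OF _ bdd, of "V x"] y0 that by auto
  have le: "norm (H x1) \<le> 2 * \<epsilon>" if x1: "0 < x1" "x1 \<le> y0" for x1
  proof (rule ccontr)
    assume gt: "\<not> norm (H x1) \<le> 2 * \<epsilon>"
    define I where "I = (LINT s|lborel. norm (H s) / s\<^sup>2)"
    \<comment> \<open>The mass of 1 / s^2 between \<open>1 / c\<close> and \<open>x1\<close> is
      \<open>c - 1 / x1\<close>; this choice makes it
      \<open>(\<bar>I\<bar> + 1) / \<epsilon>\<close>. The summand \<open>1 / x1\<close> also places
      \<open>1 / c\<close> at or below \<open>x1\<close>.\<close>
    define c where "c = 1 / x1 + (\<bar>I\<bar> + 1) / \<epsilon>"
    define \<delta> where "\<delta> = 1 / c"
    have "(\<bar>I\<bar> + 1) / \<epsilon> > 0" "1 / x1 > 0"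
      using x1 \<epsilon> by (auto intro!: divide_pos_pos add_nonneg_pos)
    then have c: "c > 0" "1 / x1 \<le> c"
      unfolding c_def by linarith+
    then have "1 \<le> c * x1" using x1 by (simp add: divide_le_eq)
    then have \<delta>: "\<delta> > 0" "\<delta> \<le> x1" "1 / \<delta> - 1 / x1 = (\<bar>I\<bar> + 1) / \<epsilon>"
      using c by (auto simp: \<delta>_def divide_le_eq mult.commute) (simp add: c_def)
    have "\<epsilon> * ((- 1 / x1) - (- 1 / \<delta>)) \<le> I"
      unfolding I_def
    proof (rule weighted_integral_le[OF int])
      show "((\<lambda>s. 1 / s\<^sup>2) has_integral ((- 1 / x1) - (- 1 / \<delta>))) {\<delta>..x1}"
        using \<delta> by (intro fundamental_theorem_of_calculus)
          (auto intro!: derivative_eq_intros simp: power2_eq_square simp flip: has_real_derivative_iff_has_vector_derivative)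
      show "\<epsilon> * (1 / s\<^sup>2) \<le> norm (H s) / s\<^sup>2" if "s \<in> {\<delta>..x1}" for s
      proof -
        have "norm (H x1 - H s) \<le> \<epsilon>"
          using V(1)[of s x1] small[of s x1] \<delta> x1 that by auto
        moreover have "norm (H x1) \<le> norm (H s) + norm (H x1 - H s)"
          by (metis norm_triangle_sub)
        ultimately have "\<epsilon> \<le> norm (H s)" using gt by auto
        then show ?thesis by (simp add: divide_right_mono)
      qed
    qed simp
    then have "\<epsilon> * ((\<bar>I\<bar> + 1) / \<epsilon>) \<le> I" using \<delta>(3) by simp
    then show False using \<epsilon> by simp
  qed
  have "dist (H x) 0 < e" if "0 < x" "x < y0" for x
    using le[of x] that \<open>e > 0\<close> by (simp add: \<epsilon>_def)
  then show "\<forall>\<^sub>F x in at_right 0. dist (H x) 0 < e"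
    unfolding eventually_at_right_field using y0 by blast
qed

lemma bv_integrable_tendsto_0_at_0:
  fixes H :: "real \<Rightarrow> 'a::real_normed_vector" and V :: "real \<Rightarrow> real"
  assumes V: "\<And>x y. x \<le> y \<Longrightarrow> norm (H y - H x) \<le> V y - V x"
    and int: "integrable lborel (\<lambda>s. norm (H s) / s\<^sup>2)"
  shows "(H \<longlongrightarrow> 0) (at 0)"
proof (rule filterlim_split_at)
  have "((\<lambda>x. H (- x)) \<longlongrightarrow> 0) (at_right 0)"
  proof (rule bv_integrable_tendsto_0_at_right)
    show "norm (H (- y) - H (- x)) \<le> - V (- y) - - V (- x)" if "x \<le> y" for x y
      using V(1)[of "- y" "- x"] that by (simp add: norm_minus_commute)
    show "integrable lborel (\<lambda>s. norm (H (- s)) / s\<^sup>2)"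
      using lborel_integrable_real_affine[OF int, of "-1" 0] by simp
  qed
  then show "(H \<longlongrightarrow> 0) (at_left 0)"
    by (simp add: filterlim_at_left_to_right)
qed (rule bv_integrable_tendsto_0_at_right[OF assms])

text \<open>The total variation of \<open>g\<close> with weight \<open>t\<^sup>2\<close>, as seen by fine tagged divisions; it stays finite although
  \<open>g\<close> may be unbounded near \<open>0\<close>.\<close>

definition weighted_var_le :: "(real \<Rightarrow> complex) \<Rightarrow> real \<Rightarrow> real \<Rightarrow> real \<Rightarrow> bool" where
  "weighted_var_le g a b M \<longleftrightarrow> (\<exists>\<gamma>. gauge \<gamma> \<and> (\<forall>D. D tagged_division_of {a..b} \<and> \<gamma> fine D \<longrightarrow>
     weighted_sum g D \<le> M))"

lemma weighted_var_leE:
  assumes "weighted_var_le g a b M"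
  obtains \<gamma> where "gauge \<gamma>" "\<And>D. D tagged_division_of {a..b} \<Longrightarrow> \<gamma> fine D \<Longrightarrow>
      weighted_sum g D \<le> M"
proof -
  from assms[unfolded weighted_var_le_def] obtain \<gamma> where "gauge \<gamma> \<and> (\<forall>D. D tagged_division_of {a..b} \<and> \<gamma> fine D \<longrightarrow>
     weighted_sum g D \<le> M)" ..
  then show thesis by (intro that[of \<gamma>]) simp_all
qed

lemma norm_exp_ii_diff_le:
  "norm (exp (\<i> * complex_of_real (x * v)) - exp (\<i> * complex_of_real (x * t))) \<le> \<bar>x\<bar> * \<bar>v - t\<bar>"
proof -
  have "norm (exp (\<i> * complex_of_real (x * v)) - exp (\<i> * complex_of_real (x * t)))
     = norm (exp (\<i> * complex_of_real (x * t)) * (exp (\<i> * complex_of_real (x * (v - t))) - 1))"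
    by (simp add: algebra_simps exp_diff)
  also have "\<dots> = norm (exp (\<i> * complex_of_real (x * (v - t))) - 1)"
    by (simp add: norm_mult)
  also have "\<dots> \<le> \<bar>x * (v - t)\<bar>"
    using iexp_approx1[of "x * (v - t)" 0] by simp
  finally show ?thesis by (simp add: abs_mult)
qed

text \<open>The increment of E H / s^2, with E the exponential, is split into the increment of
  \<open>H\<close> and those of the other two factors. Since \<open>v\<close> is within half of
  \<open>\<bar>t\<bar>\<close> of \<open>t\<close>, the quotient t^2 / v^2 is at most 4 and |t + v|
  at most (5/2) |t|; hence the 4, and 10 = 4 * 5/2. The first term is later absorbed by a variation
  majorant, the second is a Riemann summand of an integrable density.\<close>

lemma weighted_increment_le:
  fixes g H :: "real \<Rightarrow> complex"
  assumes g: "\<And>s. s \<noteq> 0 \<Longrightarrow> g s = exp (\<i> * complex_of_real (x * s)) * H s / complex_of_real (s\<^sup>2)"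
    and t: "t \<noteq> 0" "\<bar>v - t\<bar> < \<bar>t\<bar> / 2"
  shows "t\<^sup>2 * norm (g v - g t) \<le> 4 * norm (H v - H t) + norm (H t) * (10 / \<bar>t\<bar> + \<bar>x\<bar>) * \<bar>v - t\<bar>"
proof -
  define E where "E s = exp (\<i> * complex_of_real (x * s))" for s
  have E: "norm (E s) = 1" for s by (simp add: E_def)
  have v: "v \<noteq> 0" "\<bar>t\<bar> / 2 \<le> \<bar>v\<bar>" "\<bar>t + v\<bar> \<le> 5 / 2 * \<bar>t\<bar>" using t by arith+
  have "(\<bar>t\<bar> / 2)\<^sup>2 \<le> \<bar>v\<bar>\<^sup>2" using v by (intro power_mono) auto
  then have v2: "t\<^sup>2 \<le> 4 * v\<^sup>2" by (simp add: power_divide)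
  have eq: "of_real (t\<^sup>2) * (g v - g t) = of_real (t\<^sup>2 / v\<^sup>2) * E v * (H v - H t)
      + H t * (E v * of_real ((t\<^sup>2 - v\<^sup>2) / v\<^sup>2) + (E v - E t))"
  proof -
    have gE: "g v = E v * H v / of_real (v\<^sup>2)" "g t = E t * H t / of_real (t\<^sup>2)"
      using g t v by (simp_all add: E_def)
    show ?thesis unfolding gE using t(1) v(1) by (simp add: field_simps)
  qed
  have "t\<^sup>2 * norm (g v - g t) = norm (of_real (t\<^sup>2) * (g v - g t))"
    by (simp add: norm_mult norm_power)
  also have "\<dots> \<le> norm (of_real (t\<^sup>2 / v\<^sup>2) * E v * (H v - H t)) + norm (H t * (E v * of_real ((t\<^sup>2 - v\<^sup>2) / v\<^sup>2) + (E v - E t)))"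
    unfolding eq by (rule norm_triangle_ineq)
  also have "norm (of_real (t\<^sup>2 / v\<^sup>2) * E v * (H v - H t)) = t\<^sup>2 / v\<^sup>2 * norm (H v - H t)"
    by (simp only: norm_mult E norm_of_real) simp
  also have "\<dots> \<le> 4 * norm (H v - H t)"
    using v v2 by (intro mult_right_mono) (auto simp: divide_le_eq)
  also have "norm (H t * (E v * of_real ((t\<^sup>2 - v\<^sup>2) / v\<^sup>2) + (E v - E t)))
     \<le> norm (H t) * ((10 / \<bar>t\<bar> + \<bar>x\<bar>) * \<bar>v - t\<bar>)"
  proof -
    have "\<bar>(t\<^sup>2 - v\<^sup>2) / v\<^sup>2\<bar> = \<bar>v - t\<bar> * (\<bar>t + v\<bar> / v\<^sup>2)"
      by (simp add: power2_eq_square square_diff_square_factored abs_mult abs_minus_commute)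
    also have "\<bar>t + v\<bar> / v\<^sup>2 \<le> (5 / 2 * \<bar>t\<bar>) / (t\<^sup>2 / 4)"
      using v t v2 by (intro frac_le) auto
    also have "\<dots> = 10 / \<bar>t\<bar>"
      using t by (simp add: field_simps power2_eq_square abs_if)
    finally have 1: "\<bar>(t\<^sup>2 - v\<^sup>2) / v\<^sup>2\<bar> \<le> \<bar>v - t\<bar> * (10 / \<bar>t\<bar>)"
      by (simp add: mult_left_mono)
    have "norm (E v * of_real ((t\<^sup>2 - v\<^sup>2) / v\<^sup>2) + (E v - E t)) \<le> \<bar>(t\<^sup>2 - v\<^sup>2) / v\<^sup>2\<bar> + \<bar>x\<bar> * \<bar>v - t\<bar>"
      using norm_exp_ii_diff_le[of x v t, folded E_def]
      by (intro order.trans[OF norm_triangle_ineq] add_mono) (simp_all only: norm_mult E norm_of_real mult_1 order.refl)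
    also have "\<dots> \<le> (10 / \<bar>t\<bar> + \<bar>x\<bar>) * \<bar>v - t\<bar>"
      using 1 by (simp add: algebra_simps)
    finally show ?thesis by (simp only: norm_mult mult_left_mono norm_ge_zero)
  qed
  finally show ?thesis by (simp add: mult.assoc)
qed

text \<open>Summation of the bound for single increments: the variation part telescopes to
  \<open>4 * (V b - V a)\<close>, at most \<open>8 * M\<close>, and the density part is a Riemann
  sum which a fine gauge keeps within 1 of its integral. The result depends neither on the interval
  nor, once \<open>B\<close> and \<open>X\<close> are fixed, on \<open>x\<close>.\<close>

lemma weighted_var_le_kernel:
  fixes g H :: "real \<Rightarrow> complex" and V B :: "real \<Rightarrow> real"
  assumes ab: "a \<le> b"
    and V: "\<And>u v. u \<le> v \<Longrightarrow> norm (H v - H u) \<le> V v - V u" "\<And>u. \<bar>V u\<bar> \<le> M"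
    and g: "\<And>s. s \<noteq> 0 \<Longrightarrow> g s = exp (\<i> * complex_of_real (x * s)) * H s / complex_of_real (s\<^sup>2)"
    and B: "\<And>s. norm (H s) \<le> B s" "integrable lborel (\<lambda>s. B s * (10 / \<bar>s\<bar> + X))"
    and x: "\<bar>x\<bar> \<le> X"
  shows "weighted_var_le g a b (8 * M + (LINT s|lborel. B s * (10 / \<bar>s\<bar> + X)) + 1)"
proof -
  define \<rho> where "\<rho> s = B s * (10 / \<bar>s\<bar> + X)" for s
  have B0: "0 \<le> B s" for s using B(1)[of s] norm_ge_zero order.trans by blast
  have \<rho>0: "0 \<le> \<rho> s" for s using B0 x by (simp add: \<rho>_def)
  have \<rho>: "integrable lborel \<rho>" using B(2) unfolding \<rho>_def .
  have \<rho>i: "\<rho> integrable_on UNIV" "\<rho> integrable_on {a..b}"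
    using integrable_on_lborel[OF \<rho>] integrable_on_subinterval[of \<rho> UNIV a b] by auto
  have R: "integral {a..b} \<rho> \<le> (LINT s|lborel. \<rho> s)"
    using integral_subset_le[OF _ \<rho>i(2,1)] \<rho>0 integral_lborel[OF \<rho>] by simp
  obtain \<gamma> where \<gamma>: "gauge \<gamma>" "\<And>D. D tagged_division_of {a..b} \<Longrightarrow> \<gamma> fine D \<Longrightarrow>
      norm ((\<Sum>(t,K)\<in>D. measure lborel K *\<^sub>R \<rho> t) - integral {a..b} \<rho>) < 1"
    using integrable_integral[OF \<rho>i(2)] unfolding has_integral_real by (metis zero_less_one)
  \<comment> \<open>The radius at the tag 0 is arbitrary, because the weight vanishes there.
    Elsewhere it enforces the half-distance condition of
    \<open>weighted_increment_le\<close>.\<close>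
  define d where "d t = (if t = 0 then 1 else \<bar>t\<bar> / 2)" for t :: real
  have d: "d t > 0" for t by (simp add: d_def)
  show ?thesis
    unfolding weighted_var_le_def
  proof (intro exI[of _ "\<lambda>t. \<gamma> t \<inter> ball t (d t)"] conjI allI impI)
    show "gauge (\<lambda>t. \<gamma> t \<inter> ball t (d t))"
      using \<gamma>(1) d by (intro gauge_Int gauge_ball_dependent) auto
    fix D assume "D tagged_division_of {a..b} \<and> (\<lambda>t. \<gamma> t \<inter> ball t (d t)) fine D"
    then have D: "D tagged_division_of {a..b}" "\<gamma> fine D" "(\<lambda>t. ball t (d t)) fine D"
      by (auto simp: fine_Int)
    let ?W = "\<lambda>(t,K). t\<^sup>2 * (norm (g (Sup K) - g t) + norm (g t - g (Inf K)))"
    let ?R = "\<lambda>(t,K). measure lborel K *\<^sub>R \<rho> t"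
    have "(\<Sum>p\<in>D. ?W p - ?R p) \<le> (\<lambda>y. 4 * V y) b - (\<lambda>y. 4 * V y) a"
    proof (rule tagged_sum_telescope_le[OF D(1) ab], unfold split)
      fix t u v assume p: "(t,{u..v}) \<in> D" "u \<le> t" "t \<le> v"
      have "{u..v} \<subseteq> ball t (d t)" using D(3) p by (auto simp: fine_def)
      moreover have "u \<in> {u..v}" "v \<in> {u..v}" using p by auto
      ultimately have uv: "u \<in> ball t (d t)" "v \<in> ball t (d t)" by blast+
      have "t\<^sup>2 * (norm (g v - g t) + norm (g t - g u)) \<le> 4 * V v - 4 * V u + (v - u) * \<rho> t"
      proof (cases "t = 0")
        case True
        have "V u \<le> V v" using V(1)[of u v] p norm_ge_zero[of "H v - H u"] by linarith
        moreover have "0 \<le> (v - u) * \<rho> t" using p \<rho>0 by simp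
        ultimately show ?thesis using True by simp
      next
        case False
        have le: "norm (H t) * (10 / \<bar>t\<bar> + \<bar>x\<bar>) * y \<le> \<rho> t * y" if "y \<ge> 0" for y
          unfolding \<rho>_def using B(1)[of t] B0[of t] x that by (intro mult_right_mono mult_mono) auto
        have "t\<^sup>2 * norm (g v - g t) \<le> 4 * (V v - V t) + \<rho> t * (v - t)"
          using weighted_increment_le[OF g False, of v] uv False V(1)[OF p(3)] le[of "\<bar>v - t\<bar>"] p
          by (auto simp: d_def dist_real_def abs_minus_commute)
        moreover have "t\<^sup>2 * norm (g u - g t) \<le> 4 * (V t - V u) + \<rho> t * (t - u)"
          using weighted_increment_le[OF g False, of u] uv False V(1)[OF p(2)] le[of "\<bar>u - t\<bar>"] p
          by (auto simp: d_def dist_real_def norm_minus_commute)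
        ultimately show ?thesis by (simp add: norm_minus_commute algebra_simps)
      qed
      then show "t\<^sup>2 * (norm (g (Sup {u..v}) - g t) + norm (g t - g (Inf {u..v}))) - measure lborel {u..v} *\<^sub>R \<rho> t \<le> 4 * V v - 4 * V u"
        using p by simp
    qed
    also have "\<dots> \<le> 8 * M" using V(2)[of a] V(2)[of b] by simp
    finally have "sum ?W D \<le> 8 * M + sum ?R D" unfolding sum_subtractf by linarith
    also have "sum ?R D \<le> (LINT s|lborel. \<rho> s) + 1"
      using \<gamma>(2)[OF D(1,2)] R by (simp add: abs_less_iff)
    finally show "sum ?W D \<le> 8 * M + (LINT s|lborel. B s * (10 / \<bar>s\<bar> + X)) + 1"
      by (simp add: \<rho>_def)
  qed
qed

lemma norm_minus_diff_diff_le: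
  fixes x y z :: "'a::real_normed_vector"
  shows "norm (- x - y - z) \<le> norm x + norm y + norm z"
  using norm_triangle_ineq4[of "- x - y" z] norm_triangle_ineq4[of "- x" y] by simp

text \<open>A tag at \<open>0\<close> contributes nothing to the Stieltjes sum because \<open>P 0 = 0\<close>, so the singularity of \<open>g\<close> only
  enters through the boundary values of \<open>P g\<close>, which vanish at \<open>0\<close>.\<close>

lemma rs_has_integral_by_parts:
  assumes ab: "a \<le> b" and W: "weighted_var_le g a b M" and "M \<ge> 0"
    and der: "\<And>t. (P has_vector_derivative P' t) (at t)" and P0: "P 0 = 0" "P' 0 = 0"
    and Pg: "((\<lambda>s. P s * g s) \<longlongrightarrow> 0) (at 0)"
    and J: "((\<lambda>s. P' s * g s) has_integral J) {a..b}"
  shows "rs_has_integral P g (P b * g b - P a * g a - J) a b"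
  unfolding rs_has_integral_def
proof (intro allI impI)
  fix e :: real assume "e > 0"
  \<comment> \<open>The budget has three parts: \<open>\<eta> * M\<close> for the weighted
    variation, \<open>\<eta> * (b - a)\<close> for the straddle errors, and
    \<open>4 * \<eta>\<close> for intervals tagged at 0. One more unit makes the inequality
    strict.\<close>
  define \<eta> where "\<eta> = e / 2 / (M + (b - a) + 5)"
  have \<eta>: "\<eta> > 0" "\<eta> * (M + (b - a) + 4) < e / 2"
    using \<open>e > 0\<close> ab \<open>M \<ge> 0\<close> by (auto simp: \<eta>_def field_simps)
  obtain \<gamma>1 where \<gamma>1: "gauge \<gamma>1" "\<And>D. D tagged_division_of {a..b} \<Longrightarrow> \<gamma>1 fine D \<Longrightarrow>
      norm ((\<Sum>(x,K)\<in>D. measure lborel K *\<^sub>R (P' x * g x)) - J) < e / 2"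
    using J \<open>e > 0\<close> unfolding has_integral_real by (metis half_gt_zero)
  obtain \<gamma>2 where \<gamma>2: "gauge \<gamma>2" "\<And>D. D tagged_division_of {a..b} \<Longrightarrow> \<gamma>2 fine D \<Longrightarrow>
      weighted_sum g D \<le> M"
    by (rule weighted_var_leE[OF W]) blast
  have contP: "isCont P t" for t
    using der has_vector_derivative_continuous by blast
  \<comment> \<open>At a nonzero tag the increment of \<open>P\<close> is made small relative to
    t^2, to match the weight in \<open>weighted_sum\<close>, and the straddle tolerance compensates
    the size of \<open>g t\<close>. At the tag 0 only the boundary values of \<open>P g\<close> have
    to be small.\<close>
  define \<Phi> where "\<Phi> t d \<longleftrightarrow> (t \<noteq> 0 \<longrightarrow> (\<forall>u v. u \<le> t \<and> t \<le> v \<and> u \<in> ball t d \<and> v \<in> ball t d \<longrightarrow>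
           norm (P v - P u - (v - u) *\<^sub>R P' t) \<le> \<eta> / (norm (g t) + 1) * (v - u)) \<and>
           (\<forall>v\<in>ball t d. norm (P v - P t) \<le> \<eta> * t\<^sup>2)) \<and>
         (t = 0 \<longrightarrow> (\<forall>v\<in>ball t d. norm (P v * g v) \<le> \<eta>))" for t d
  have "\<exists>d>0. \<Phi> t d" for t
  proof (cases "t = 0")
    case True
    obtain d where d: "d > 0" "\<And>v. v \<noteq> 0 \<Longrightarrow> dist v 0 < d \<Longrightarrow> dist (P v * g v) 0 < \<eta>"
      using tendstoD[OF Pg \<eta>(1)] unfolding eventually_at by auto
    have "norm (P v * g v) \<le> \<eta>" if "v \<in> ball 0 d" for v
      using d(2)[of v] that P0 \<eta> by (cases "v = 0") (auto simp: dist_commute)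
    then show ?thesis using True d(1) unfolding \<Phi>_def by auto
  next
    case False
    have "\<eta> / (norm (g t) + 1) > 0"
      using \<eta> by (intro divide_pos_pos add_nonneg_pos) auto
    from has_vector_derivative_straddle[OF der this] obtain d1 where d1: "d1 > 0"
      "\<forall>u v. u \<le> t \<and> t \<le> v \<and> u \<in> ball t d1 \<and> v \<in> ball t d1 \<longrightarrow>
           norm (P v - P u - (v - u) *\<^sub>R P' t) \<le> \<eta> / (norm (g t) + 1) * (v - u)"
      by blast
    have pos: "\<eta> * t\<^sup>2 > 0" using \<eta> False by simp
    obtain d2 where d2: "d2 > 0" "\<And>v. dist v t < d2 \<Longrightarrow> dist (P v) (P t) < \<eta> * t\<^sup>2"
      using contP[of t, unfolded continuous_within_eps_delta, rule_format, OF pos] by auto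
    have "\<forall>v\<in>ball t (min d1 d2). norm (P v - P t) \<le> \<eta> * t\<^sup>2"
    proof
      fix v assume "v \<in> ball t (min d1 d2)"
      then show "norm (P v - P t) \<le> \<eta> * t\<^sup>2"
        using d2(2)[of v] by (simp add: dist_commute dist_norm norm_minus_commute)
    qed
    moreover have "\<forall>u v. u \<le> t \<and> t \<le> v \<and> u \<in> ball t (min d1 d2) \<and> v \<in> ball t (min d1 d2) \<longrightarrow>
           norm (P v - P u - (v - u) *\<^sub>R P' t) \<le> \<eta> / (norm (g t) + 1) * (v - u)"
      using d1(2) by simp
    ultimately show ?thesis using False d1(1) d2(1) unfolding \<Phi>_def by (intro exI[of _ "min d1 d2"]) simp
  qed
  then obtain d where d\<Phi>: "\<And>t. d t > 0" "\<And>t. \<Phi> t (d t)"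
    by metis
  have d: "\<And>t. d t > 0"
    "\<And>t u v. t \<noteq> 0 \<Longrightarrow> u \<le> t \<Longrightarrow> t \<le> v \<Longrightarrow> u \<in> ball t (d t) \<Longrightarrow> v \<in> ball t (d t) \<Longrightarrow>
           norm (P v - P u - (v - u) *\<^sub>R P' t) \<le> \<eta> / (norm (g t) + 1) * (v - u)"
    "\<And>t v. t \<noteq> 0 \<Longrightarrow> v \<in> ball t (d t) \<Longrightarrow> norm (P v - P t) \<le> \<eta> * t\<^sup>2"
    "\<And>v. v \<in> ball 0 (d 0) \<Longrightarrow> norm (P v * g v) \<le> \<eta>"
    using d\<Phi> unfolding \<Phi>_def by blast+
  show "\<exists>\<gamma>. gauge \<gamma> \<and> (\<forall>D. D tagged_division_of {a..b} \<and> \<gamma> fine D \<longrightarrow>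
      norm (rs_sum P g D - (P b * g b - P a * g a - J)) < e)"
  proof (intro exI[of _ "\<lambda>t. (\<gamma>1 t \<inter> \<gamma>2 t) \<inter> ball t (d t)"] conjI allI impI)
    show "gauge (\<lambda>t. (\<gamma>1 t \<inter> \<gamma>2 t) \<inter> ball t (d t))"
      using \<gamma>1(1) \<gamma>2(1) d(1) by (intro gauge_Int gauge_ball_dependent) auto
    fix D assume "D tagged_division_of {a..b} \<and> (\<lambda>t. (\<gamma>1 t \<inter> \<gamma>2 t) \<inter> ball t (d t)) fine D"
    then have D: "D tagged_division_of {a..b}" "\<gamma>1 fine D" "\<gamma>2 fine D" "(\<lambda>t. ball t (d t)) fine D"
      by (auto simp: fine_Int)
    let ?W = "\<lambda>(t,K). t\<^sup>2 * (norm (g (Sup K) - g t) + norm (g t - g (Inf K)))"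
    let ?R = "\<lambda>(x,K). measure lborel K *\<^sub>R (P' x * g x)"
    let ?S = "\<lambda>(x,K). P x * (g (Sup K) - g (Inf K))"
    let ?B = "\<lambda>(x::real,K). P (Sup K) * g (Sup K) - P (Inf K) * g (Inf K)"
    \<comment> \<open>Every nondegenerate interval containing \<open>0\<close> has an increment of \<open>q\<close> of at least 1, so at most two have tag \<open>0\<close>.\<close>
    define q :: "real \<Rightarrow> real" where "q y = (if y < 0 then 0 else if y = 0 then 1 else 2)" for y
    have "(\<Sum>p\<in>D. norm (?S p - (?B p - ?R p)) - \<eta> * ?W p) \<le> (\<lambda>y. \<eta> * y + 2 * \<eta> * q y) b - (\<lambda>y. \<eta> * y + 2 * \<eta> * q y) a"
    proof (rule tagged_sum_telescope_le[OF D(1) ab], unfold split)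
      fix t u v assume p: "(t,{u..v}) \<in> D" "u \<le> t" "t \<le> v"
      have "{u..v} \<subseteq> ball t (d t)" using D(4) p by (auto simp: fine_def)
      moreover have "u \<in> {u..v}" "v \<in> {u..v}" using p by auto
      ultimately have uv: "u \<in> ball t (d t)" "v \<in> ball t (d t)" by blast+
      have q: "q u \<le> q v" using p by (auto simp: q_def)
      have qe: "2 * \<eta> * q u \<le> 2 * \<eta> * q v" "\<eta> * u \<le> \<eta> * v" using q \<eta> p by auto
      have "norm (P t * (g v - g u) - (P v * g v - P u * g u - (v - u) *\<^sub>R (P' t * g t)))
         \<le> \<eta> * (t\<^sup>2 * (norm (g v - g t) + norm (g t - g u))) + (\<eta> * v + 2 * \<eta> * q v - (\<eta> * u + 2 * \<eta> * q u))"
      proof (cases "t = 0")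
        case True
        show ?thesis
        proof (cases "u = v")
          case True with \<open>t = 0\<close> show ?thesis using p by (simp add: P0)
        next
          case False
          with True p have "q u + 1 \<le> q v" by (auto simp: q_def)
          then have "2 * \<eta> * (q u + 1) \<le> 2 * \<eta> * q v" using \<eta> by (intro mult_left_mono) auto
          moreover have "norm (P v * g v - P u * g u) \<le> \<eta> + \<eta>"
            using uv True by (intro order.trans[OF norm_triangle_ineq4] add_mono d(4)) auto
          ultimately show ?thesis using True qe(2) by (simp add: P0 algebra_simps norm_minus_commute)
        qed
      next
        case False
        \<comment> \<open>The defect of the discrete product rule pairs each half increment of
          \<open>g\<close> with an increment of \<open>P\<close> starting at the same tag; the last
          term is the straddle error multiplied by \<open>g t\<close>.\<close>
        have "P t * (g v - g u) - (P v * g v - P u * g u - (v - u) *\<^sub>R (P' t * g t))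
          = - ((g v - g t) * (P v - P t)) - (g t - g u) * (P u - P t) - g t * (P v - P u - (v - u) *\<^sub>R P' t)"
          by (simp add: algebra_simps scaleR_conv_of_real)
        also have "norm \<dots> \<le> norm ((g v - g t) * (P v - P t)) + norm ((g t - g u) * (P u - P t)) + norm (g t * (P v - P u - (v - u) *\<^sub>R P' t))"
          by (rule norm_minus_diff_diff_le)
        also have "\<dots> \<le> norm (g v - g t) * (\<eta> * t\<^sup>2) + norm (g t - g u) * (\<eta> * t\<^sup>2) + (norm (g t) + 1) * (\<eta> / (norm (g t) + 1) * (v - u))"
          unfolding norm_mult using d(3)[OF False] d(2)[OF False p(2,3)] uv
          by (intro add_mono mult_mono mult_left_mono) auto
        also have "(norm (g t) + 1) * (\<eta> / (norm (g t) + 1) * (v - u)) = \<eta> * (v - u)"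
          using norm_ge_zero[of "g t"] by (simp add: add_nonneg_eq_0_iff)
        finally show ?thesis using qe(1) by (simp add: algebra_simps)
      qed
      then show "norm (P t * (g (Sup {u..v}) - g (Inf {u..v})) - (P (Sup {u..v}) * g (Sup {u..v}) - P (Inf {u..v}) * g (Inf {u..v}) - measure lborel {u..v} *\<^sub>R (P' t * g t)))
         - \<eta> * (t\<^sup>2 * (norm (g (Sup {u..v}) - g t) + norm (g t - g (Inf {u..v})))) \<le> \<eta> * v + 2 * \<eta> * q v - (\<eta> * u + 2 * \<eta> * q u)"
        using p by simp
    qed
    also have "\<dots> \<le> \<eta> * (b - a) + 4 * \<eta>"
    proof -
      have "2 * \<eta> * (q b - q a) \<le> 2 * \<eta> * 2" using \<eta> by (intro mult_left_mono) (auto simp: q_def)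
      then show ?thesis by (simp add: algebra_simps)
    qed
    finally have "(\<Sum>p\<in>D. norm (?S p - (?B p - ?R p))) \<le> \<eta> * sum ?W D + (\<eta> * (b - a) + 4 * \<eta>)"
      unfolding sum_subtractf sum_distrib_left by linarith
    also have "\<dots> \<le> \<eta> * M + (\<eta> * (b - a) + 4 * \<eta>)"
      using \<gamma>2(2)[OF D(1,3)] \<eta> by (intro add_right_mono mult_left_mono) auto
    also have "\<dots> < e / 2" using \<eta> by (simp add: algebra_simps)
    finally have "norm (\<Sum>p\<in>D. ?S p - (?B p - ?R p)) < e / 2"
      by (rule le_less_trans[OF norm_sum])
    moreover have "sum ?B D = P b * g b - P a * g a"
      using additive_tagged_division_1[OF ab D(1), of "\<lambda>y. P y * g y"] by simp
    ultimately have 1: "norm (sum ?S D - (P b * g b - P a * g a - sum ?R D)) < e / 2"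
      by (simp only: sum_subtractf)
    have 2: "norm (J - sum ?R D) < e / 2"
      using \<gamma>1(2)[OF D(1,2)] by (simp add: norm_minus_commute)
    have "sum ?S D - (P b * g b - P a * g a - J) = (sum ?S D - (P b * g b - P a * g a - sum ?R D)) + (J - sum ?R D)"
      by simp
    also have "norm \<dots> < e" using norm_add_less[OF 1 2] by simp
    finally show "norm (sum ?S D - (P b * g b - P a * g a - J)) < e" .
  qed
qed

section \<open>Stability of Stieltjes integrals under perturbation of the integrand\<close>

text \<open>The factor t^2 in the bound for \<open>P - Q\<close> is exactly the weight in
  \<open>weighted_sum\<close>. For transforms of two primitives that bound is supplied by
  \<open>Omega_diff_le\<close>.\<close>

lemma rs_sum_diff_le:
  fixes P Q g :: "real \<Rightarrow> complex"
  assumes D: "D tagged_division_of {a..b}" and c: "\<And>s. norm (P s - Q s) \<le> c * s\<^sup>2" "0 \<le> c"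
    and W: "weighted_sum g D \<le> M"
  shows "norm (rs_sum P g D - rs_sum Q g D) \<le> c * M"
proof -
  have "norm (rs_sum P g D - rs_sum Q g D)
     \<le> (\<Sum>(t,K)\<in>D. c * (t\<^sup>2 * (norm (g (Sup K) - g t) + norm (g t - g (Inf K)))))"
    unfolding sum_subtractf[symmetric]
  proof (rule order.trans[OF norm_sum sum_mono])
    fix p assume "p \<in> D"
    obtain t K where p: "p = (t,K)" by (cases p)
    have "norm (P t * (g (Sup K) - g (Inf K)) - Q t * (g (Sup K) - g (Inf K))) = norm (P t - Q t) * norm (g (Sup K) - g (Inf K))"
      by (simp only: norm_mult[symmetric] left_diff_distrib)
    also have "\<dots> \<le> (c * t\<^sup>2) * (norm (g (Sup K) - g t) + norm (g t - g (Inf K)))"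
      using c norm_triangle_ineq[of "g (Sup K) - g t" "g t - g (Inf K)"]
      by (intro mult_mono) auto
    finally show "norm ((case p of (x,K) \<Rightarrow> P x * (g (Sup K) - g (Inf K))) - (case p of (x,K) \<Rightarrow> Q x * (g (Sup K) - g (Inf K))))
      \<le> (case p of (t,K) \<Rightarrow> c * (t\<^sup>2 * (norm (g (Sup K) - g t) + norm (g t - g (Inf K)))))"
      by (simp add: p mult.assoc)
  qed
  also have "\<dots> = c * weighted_sum g D"
    unfolding sum_distrib_left by (rule sum.cong) (auto simp only: split)
  also have "\<dots> \<le> c * M" using W c(2) by (rule mult_left_mono)
  finally show ?thesis .
qed

lemma rs_has_integralE:
  assumes "rs_has_integral P g I a b" "e > 0"
  obtains \<gamma> where "gauge \<gamma>" "\<And>D. D tagged_division_of {a..b} \<Longrightarrow> \<gamma> fine D \<Longrightarrow>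
      norm (rs_sum P g D - I) < e"
proof -
  from assms(1)[unfolded rs_has_integral_def, rule_format, OF assms(2)]
  obtain \<gamma> where "gauge \<gamma> \<and> (\<forall>D. D tagged_division_of {a..b} \<and> \<gamma> fine D \<longrightarrow>
      norm (rs_sum P g D - I) < e)" ..
  then show thesis by (intro that[of \<gamma>]) simp_all
qed

lemma norm_diff_le_via:
  fixes x y s t :: "'a::real_normed_vector"
  shows "norm (x - y) \<le> norm (s - t) + norm (s - x) + norm (t - y)"
  using norm_triangle_ineq4[of "s - t" "s - x"] norm_triangle_ineq[of "s - t - (s - x)" "t - y"] by simp

lemma rs_has_integral_diff_le:
  assumes I: "rs_has_integral P g I a b" and J: "rs_has_integral Q g J a b"
    and W: "weighted_var_le g a b M"
    and c: "\<And>s. norm (P s - Q s) \<le> c * s\<^sup>2" "0 \<le> c"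
  shows "norm (I - J) \<le> c * M"
proof (rule field_le_epsilon)
  fix e :: real assume "e > 0"
  then have e2: "e / 2 > 0" by simp
  obtain \<gamma>1 where 1: "gauge \<gamma>1" "\<And>D. D tagged_division_of {a..b} \<Longrightarrow> \<gamma>1 fine D \<Longrightarrow>
      norm (rs_sum P g D - I) < e / 2"
    by (rule rs_has_integralE[OF I e2]) blast
  obtain \<gamma>2 where 2: "gauge \<gamma>2" "\<And>D. D tagged_division_of {a..b} \<Longrightarrow> \<gamma>2 fine D \<Longrightarrow>
      norm (rs_sum Q g D - J) < e / 2"
    by (rule rs_has_integralE[OF J e2]) blast
  obtain \<gamma>3 where 3: "gauge \<gamma>3" "\<And>D. D tagged_division_of {a..b} \<Longrightarrow> \<gamma>3 fine D \<Longrightarrow>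
      weighted_sum g D \<le> M"
    by (rule weighted_var_leE[OF W]) blast
  obtain D where "D tagged_division_of {a..b}" "(\<lambda>x. (\<gamma>1 x \<inter> \<gamma>2 x) \<inter> \<gamma>3 x) fine D"
    using fine_division_exists_real[OF gauge_Int[OF gauge_Int[OF 1(1) 2(1)] 3(1)]] by blast
  then have D: "D tagged_division_of {a..b}" "\<gamma>1 fine D" "\<gamma>2 fine D" "\<gamma>3 fine D"
    by (auto simp: fine_Int)
  let ?S = "rs_sum P g D" and ?T = "rs_sum Q g D"
  have ST: "norm (?S - ?T) \<le> c * M"
    by (rule rs_sum_diff_le[OF D(1) c]) (rule 3(2)[OF D(1,4)])
  have SI: "norm (?S - I) \<le> e / 2"
    by (rule less_imp_le[OF 1(2)[OF D(1,2)]])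
  have TJ: "norm (?T - J) \<le> e / 2"
    by (rule less_imp_le[OF 2(2)[OF D(1,3)]])
  show "norm (I - J) \<le> c * M + e"
    using order.trans[OF norm_diff_le_via add_mono[OF add_mono[OF ST SI] TJ]] by simp
qed

lemma Cauchy_rate_limit:
  fixes I :: "nat \<Rightarrow> 'a::banach" and r :: "nat \<Rightarrow> real"
  assumes diff: "\<And>m n. norm (I m - I n) \<le> r m + r n" and r: "r \<longlonglongrightarrow> 0"
  obtains L where "\<And>n. norm (L - I n) \<le> r n"
proof -
  have "Cauchy I"
    unfolding Cauchy_iff
  proof (intro allI impI)
    fix e :: real assume "e > 0"
    then obtain N where N: "\<And>n. n \<ge> N \<Longrightarrow> norm (r n) < e / 2"
      using LIMSEQ_D[OF r, of "e/2"] by auto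
    show "\<exists>N. \<forall>m\<ge>N. \<forall>n\<ge>N. norm (I m - I n) < e"
    proof (intro exI[of _ N] allI impI)
      fix m n assume "m \<ge> N" "n \<ge> N"
      then show "norm (I m - I n) < e"
        using N[of m] N[of n] diff[of m n] unfolding real_norm_def by linarith
    qed
  qed
  then obtain L where L: "I \<longlonglongrightarrow> L"
    using Cauchy_convergent_iff convergent_def by blast
  have "norm (L - I n) \<le> r n" for n
  proof (rule tendsto_le[OF _ _ tendsto_norm[OF tendsto_diff[OF L tendsto_const[of "I n"]]]])
    show "(\<lambda>m. r m + r n) \<longlonglongrightarrow> r n"
      using tendsto_add[OF r tendsto_const[of "r n"]] by simp
    show "\<forall>\<^sub>F m in sequentially. norm (I m - I n) \<le> r m + r n"
      using diff by simp
  qed simp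
  then show thesis by (rule that)
qed

text \<open>Nothing is assumed about differentiability of \<open>P\<close>, so its integral cannot
  come from integration by parts. The approximating integrals form a Cauchy sequence by the
  stability estimate, and Riemann sums for \<open>P\<close> and \<open>Q n\<close> over the same
  division differ by at most \<open>c n * M\<close>, so the limit is the integral.\<close>

lemma rs_has_integral_limit:
  assumes I: "\<And>n::nat. rs_has_integral (Q n) g (I n) a b" and W: "weighted_var_le g a b M"
    and c: "\<And>n s. norm (P s - Q n s) \<le> c n * s\<^sup>2" "\<And>n. 0 \<le> c n" "c \<longlonglongrightarrow> 0"
  obtains L where "rs_has_integral P g L a b" "\<And>n. norm (L - I n) \<le> c n * M"
proof -
  have diff: "norm (I m - I n) \<le> (c m + c n) * M" for m n
  proof (rule rs_has_integral_diff_le[OF I I W])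
    fix s show "norm (Q m s - Q n s) \<le> (c m + c n) * s\<^sup>2"
      using norm_triangle_ineq4[of "P s - Q n s" "P s - Q m s"] c(1)[of s m] c(1)[of s n]
      by (simp add: algebra_simps)
  qed (use c in auto)
  have cM: "(\<lambda>n. c n * M) \<longlonglongrightarrow> 0" using tendsto_mult_left_zero[OF c(3)] .
  have "norm (I m - I n) \<le> c m * M + c n * M" for m n
    using diff[of m n] by (simp add: distrib_right)
  then obtain L where LI: "\<And>n. norm (L - I n) \<le> c n * M"
    using cM by (rule Cauchy_rate_limit) blast
  have "rs_has_integral P g L a b"
    unfolding rs_has_integral_def
  proof (intro allI impI)
    fix e :: real assume "e > 0"
    then obtain n where n: "norm (c n * M) < e / 3"
      using LIMSEQ_D[OF cM, of "e/3"] by auto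
    have e3: "e / 3 > 0" using \<open>e > 0\<close> by simp
    obtain \<gamma>1 where 1: "gauge \<gamma>1" "\<And>D. D tagged_division_of {a..b} \<Longrightarrow> \<gamma>1 fine D \<Longrightarrow>
        norm (rs_sum (Q n) g D - I n) < e / 3"
      by (rule rs_has_integralE[OF I e3]) blast
    obtain \<gamma>3 where 3: "gauge \<gamma>3" "\<And>D. D tagged_division_of {a..b} \<Longrightarrow> \<gamma>3 fine D \<Longrightarrow>
        weighted_sum g D \<le> M"
      by (rule weighted_var_leE[OF W]) blast
    show "\<exists>\<gamma>. gauge \<gamma> \<and> (\<forall>D. D tagged_division_of {a..b} \<and> \<gamma> fine D \<longrightarrow>
        norm (rs_sum P g D - L) < e)"
    proof (intro exI[of _ "\<lambda>t. \<gamma>1 t \<inter> \<gamma>3 t"] conjI allI impI gauge_Int 1 3)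
      fix D assume "D tagged_division_of {a..b} \<and> (\<lambda>t. \<gamma>1 t \<inter> \<gamma>3 t) fine D"
      then have D: "D tagged_division_of {a..b}" "\<gamma>1 fine D" "\<gamma>3 fine D" by (auto simp: fine_Int)
      let ?S = "rs_sum P g D" and ?T = "rs_sum (Q n) g D"
      have ST: "norm (?T - ?S) \<le> c n * M"
        unfolding norm_minus_commute[of ?T] by (rule rs_sum_diff_le[OF D(1) c(1,2)]) (rule 3(2)[OF D(1,3)])
      have TI: "norm (?T - I n) < e / 3"
        by (rule 1(2)[OF D(1,2)])
      have LI': "norm (I n - L) \<le> c n * M" using LI[of n] by (simp only: norm_minus_commute)
      have "e / 3 + c n * M + c n * M < e" using n[unfolded real_norm_def] abs_ge_self[of "c n * M"] by linarith
      then show "norm (?S - L) < e"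
        by (rule less_trans[OF le_less_trans[OF norm_diff_le_via add_less_le_mono[OF add_less_le_mono[OF TI ST] LI']]])
    qed
  qed
  with LI show thesis using that by blast
qed

subsection \<open>Fourier inversion for convolutions\<close>

lemma bounded_kernel_Fubini:
  fixes u f :: "real \<Rightarrow> complex" and K :: "real \<Rightarrow> real \<Rightarrow> complex"
  assumes u: "integrable lborel u" and f: "integrable lborel f"
    and K: "(\<lambda>(x,y). K x y) \<in> borel_measurable (borel \<Otimes>\<^sub>M borel)" "\<And>x y. norm (K x y) \<le> C"
  shows "(LINT x|lborel. u x * (LINT y|lborel. f y * K x y)) = (LINT y|lborel. f y * (LINT x|lborel. u x * K x y))"
proof -
  have [measurable]: "u \<in> borel_measurable borel" "f \<in> borel_measurable borel"
    using u f by auto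
  note K(1)[measurable]
  have C: "0 \<le> C" using K(2)[of 0 0] norm_ge_zero order.trans by blast
  have inner: "integrable lborel (\<lambda>y. u x * f y * K x y)" for x
  proof (rule Bochner_Integration.integrable_bound)
    show "integrable lborel (\<lambda>y. norm (u x) * C * norm (f y))" using f by auto
    have "norm (u x) * norm (f y) * norm (K x y) \<le> norm (u x) * norm (f y) * C" for y
      using K(2)[of x y] by (intro mult_left_mono) auto
    then show "AE y in lborel. norm (u x * f y * K x y) \<le> norm (norm (u x) * C * norm (f y))"
      using C by (auto simp: norm_mult mult_ac abs_mult)
  qed measurable
  have "integrable (lborel \<Otimes>\<^sub>M lborel) (\<lambda>(x,y). u x * f y * K x y)"
  proof (rule lborel_pair.Fubini_integrable)
    show "integrable lborel (\<lambda>x. LINT y|lborel. norm (case (x,y) of (x,y) \<Rightarrow> u x * f y * K x y))"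
    proof (rule Bochner_Integration.integrable_bound)
      show "integrable lborel (\<lambda>x. norm (u x) * (C * (LINT y|lborel. norm (f y))))" using u by auto
      have "(LINT y|lborel. norm (u x * f y * K x y)) \<le> (LINT y|lborel. norm (u x) * C * norm (f y))" for x
      proof (rule integral_mono)
        show "integrable lborel (\<lambda>y. norm (u x * f y * K x y))" using inner by auto
        show "integrable lborel (\<lambda>y. norm (u x) * C * norm (f y))" using f by auto
        fix y
        have "norm (u x) * norm (f y) * norm (K x y) \<le> norm (u x) * norm (f y) * C"
          using K(2)[of x y] by (intro mult_left_mono) auto
        then show "norm (u x * f y * K x y) \<le> norm (u x) * C * norm (f y)"
          by (simp add: norm_mult mult_ac)
      qed
      then show "AE x in lborel. norm (LINT y|lborel. norm (case (x,y) of (x,y) \<Rightarrow> u x * f y * K x y))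
          \<le> norm (norm (u x) * (C * (LINT y|lborel. norm (f y))))"
        using C by (auto simp: abs_mult mult.assoc)
    qed measurable
    show "AE x in lborel. integrable lborel (\<lambda>y. case (x,y) of (x,y) \<Rightarrow> u x * f y * K x y)"
      using inner by simp
  qed measurable
  from lborel_pair.Fubini_integral[OF this] have
    "(LINT y|lborel. LINT x|lborel. u x * f y * K x y) = (LINT x|lborel. LINT y|lborel. u x * f y * K x y)" .
  moreover have "(LINT y|lborel. u x * f y * K x y) = u x * (LINT y|lborel. f y * K x y)" for x
    by (simp add: mult.assoc)
  moreover have "(LINT x|lborel. u x * f y * K x y) = f y * (LINT x|lborel. u x * K x y)" for y
  proof -
    have "(LINT x|lborel. u x * f y * K x y) = (LINT x|lborel. f y * (u x * K x y))"
      by (simp add: mult_ac)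
    then show ?thesis by simp
  qed
  ultimately show ?thesis by simp
qed

lemma norm_fourier_le:
  assumes "integrable lborel f"
  shows "norm (fourier f s) \<le> (LINT t|lborel. norm (f t))"
  unfolding fourier_def
  by (rule order.trans[OF integral_norm_bound]) (simp add: norm_mult)

lemma continuous_on_fourier:
  assumes "integrable lborel f"
  shows "continuous_on UNIV (fourier f)"
  unfolding continuous_on_sequentially
proof (intro allI ballI impI, elim conjE)
  fix x :: "nat \<Rightarrow> real" and a assume x: "x \<longlonglongrightarrow> a"
  have [measurable]: "f \<in> borel_measurable borel" using assms by auto
  show "(fourier f \<circ> x) \<longlonglongrightarrow> fourier f a"
    unfolding fourier_def comp_def
  proof (rule integral_dominated_convergence[where w="\<lambda>t. norm (f t)"])
    show "AE t in lborel. (\<lambda>i. exp (- \<i> * complex_of_real (x i * t)) * f t) \<longlonglongrightarrow> exp (- \<i> * complex_of_real (a * t)) * f t"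
      using x by (auto intro!: tendsto_intros)
    show "integrable lborel (\<lambda>t. norm (f t))" using assms by auto
  qed (auto simp: norm_mult)
qed

text \<open>The multiplication formula, by Fubini. The dilation \<open>c\<close> is 1 in the
  inversion theorem and becomes the frequency \<open>s\<close> in the integral representation of
  \<open>Omega\<close>.\<close>

lemma fourier_duality:
  assumes u: "integrable lborel u" and f: "integrable lborel f"
  shows "(LINT s|lborel. u s * fourier f (c * s)) = (LINT t|lborel. f t * (LINT s|lborel. u s * exp (- \<i> * complex_of_real (c * s * t))))"
proof -
  have "(LINT s|lborel. u s * fourier f (c * s)) = (LINT s|lborel. u s * (LINT t|lborel. f t * exp (- \<i> * complex_of_real (c * s * t))))"
    unfolding fourier_def by (simp add: mult.commute)
  also have "\<dots> = (LINT t|lborel. f t * (LINT s|lborel. u s * exp (- \<i> * complex_of_real (c * s * t))))"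
  proof (rule bounded_kernel_Fubini[OF u f, where C=1])
    show "(\<lambda>(s,t). exp (- \<i> * complex_of_real (c * s * t))) \<in> borel_measurable (borel \<Otimes>\<^sub>M borel)"
      by measurable
  qed simp
  finally show ?thesis .
qed

text \<open>The substitution s = n r reduces the integral to the characteristic function of the
  standard normal distribution.\<close>

lemma gaussian_fourier:
  assumes "n > 0"
  shows "(LINT s|lborel. exp (\<i> * complex_of_real (s * z)) * complex_of_real (exp (- ((s / n)\<^sup>2) / 2)))
    = complex_of_real (n * sqrt (2 * pi) * exp (- ((n * z)\<^sup>2) / 2))" (is "?L = ?R")
    and "integrable lborel (\<lambda>s. exp (- ((s / n)\<^sup>2) / 2))"
proof -
  have E: "exp (- (x\<^sup>2) / 2) = sqrt (2 * pi) * std_normal_density x" for x :: real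
    by (simp add: std_normal_density_def)
  have "integrable lborel (\<lambda>x::real. exp (- (x\<^sup>2) / 2))"
    unfolding E by auto
  from lborel_integrable_real_affine[OF this, of "1 / n" 0]
  show "integrable lborel (\<lambda>s. exp (- ((s / n)\<^sup>2) / 2))" using assms by simp
  have "?L = of_real n * (LINT r|lborel. exp (\<i> * complex_of_real (n * r * z)) * complex_of_real (exp (- (r\<^sup>2) / 2)))"
    using assms
    by (subst lborel_integral_real_affine[where c=n and t=0]) (auto simp: scaleR_conv_of_real)
  also have "(LINT r|lborel. exp (\<i> * complex_of_real (n * r * z)) * complex_of_real (exp (- (r\<^sup>2) / 2)))
      = of_real (sqrt (2 * pi)) * (LINT r|lborel. std_normal_density r *\<^sub>R exp (\<i> * complex_of_real ((n * z) * r)))"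
    unfolding E by (simp add: scaleR_conv_of_real mult_ac flip: integral_mult_right_zero)
  also have "(LINT r|lborel. std_normal_density r *\<^sub>R exp (\<i> * complex_of_real ((n * z) * r))) = char std_normal_distribution (n * z)"
    unfolding char_def by (subst integral_density) (auto)
  also have "\<dots> = complex_of_real (exp (- ((n * z)\<^sup>2) / 2))"
    by (simp add: char_std_normal_distribution)
  finally show "?L = ?R" by simp
qed

text \<open>Damping the inversion integral by a Gaussian of width \<open>n\<close> replaces
  \<open>f\<close> by its average against a normal density of standard deviation 1 / n. This follows
  from the multiplication formula and the substitution t = z - r / n.\<close>

lemma fourier_gaussian_inverse:
  fixes f :: "real \<Rightarrow> complex"
  assumes f: "integrable lborel f" and "n > 0"
  shows "(LINT s|lborel. exp (\<i> * complex_of_real (s * z)) * complex_of_real (exp (- ((s / n)\<^sup>2) / 2)) * fourier f s)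
     = of_real (2 * pi) * (LINT r|lborel. std_normal_density r *\<^sub>R f (z - r / n))"
proof -
  let ?u = "\<lambda>s. exp (\<i> * complex_of_real (s * z)) * complex_of_real (exp (- ((s / n)\<^sup>2) / 2))"
  have u: "integrable lborel ?u"
    by (rule Bochner_Integration.integrable_bound[OF gaussian_fourier(2)[OF \<open>n > 0\<close>]]) (auto simp: norm_mult)
  have "(LINT s|lborel. ?u s * fourier f s) = (LINT t|lborel. f t * (LINT s|lborel. ?u s * exp (- \<i> * complex_of_real (s * t))))"
    using fourier_duality[OF u f, of 1] by simp
  also have "\<dots> = (LINT t|lborel. f t * complex_of_real (n * sqrt (2 * pi) * exp (- ((n * (z - t))\<^sup>2) / 2)))"
  proof (intro Bochner_Integration.integral_cong refl arg_cong2[where f="(*)"])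
    fix t
    have "?u s * exp (- \<i> * complex_of_real (s * t)) = exp (\<i> * complex_of_real (s * (z - t))) * complex_of_real (exp (- ((s / n)\<^sup>2) / 2))" for s
      by (simp add: right_diff_distrib exp_diff exp_minus field_simps)
    then show "(LINT s|lborel. ?u s * exp (- \<i> * complex_of_real (s * t))) = complex_of_real (n * sqrt (2 * pi) * exp (- ((n * (z - t))\<^sup>2) / 2))"
      by (simp only: gaussian_fourier(1)[OF \<open>n > 0\<close>])
  qed
  also have "\<dots> = (LINT r|lborel. complex_of_real (2 * pi) * (std_normal_density r *\<^sub>R f (z - r / n)))"
  proof -
    let ?q = "\<lambda>t. f t * complex_of_real (n * sqrt (2 * pi) * exp (- ((n * (z - t))\<^sup>2) / 2))"
    have "(LINT t|lborel. ?q t) = \<bar>- 1 / n\<bar> *\<^sub>R (LINT r|lborel. ?q (z + (- 1 / n) * r))"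
      using \<open>n > 0\<close> by (intro lborel_integral_real_affine) simp
    also have "\<dots> = (LINT r|lborel. (1 / n) *\<^sub>R ?q (z + (- 1 / n) * r))"
      using \<open>n > 0\<close> by simp
    also have "\<dots> = (LINT r|lborel. complex_of_real (2 * pi) * (std_normal_density r *\<^sub>R f (z - r / n)))"
    proof (intro Bochner_Integration.integral_cong refl)
      fix r
      have 1: "z + (- 1 / n) * r = z - r / n" "n * (z - (z - r / n)) = r"
        using \<open>n > 0\<close> by (auto simp: field_simps)
      \<comment> \<open>This splits the constant of the Gaussian transform into the factor
        \<open>2 * pi\<close> of Fourier inversion and the normalisation of the density.\<close>
      have "sqrt (2 * pi) = 2 * pi * (1 / sqrt (2 * pi))"
        using real_div_sqrt[of "2 * pi"] by simp
      from arg_cong[where f="\<lambda>y. y * exp (- (r\<^sup>2) / 2)", OF this]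
      have 2: "1 / n * (n * sqrt (2 * pi) * exp (- (r\<^sup>2) / 2)) = 2 * pi * std_normal_density r"
        using \<open>n > 0\<close> unfolding std_normal_density_def by simp
      have "(1 / n) *\<^sub>R ?q (z + (- 1 / n) * r) = complex_of_real (1 / n * (n * sqrt (2 * pi) * exp (- (r\<^sup>2) / 2))) * f (z - r / n)"
        unfolding 1 scaleR_conv_of_real of_real_mult by (simp only: mult_ac)
      also have "\<dots> = complex_of_real (2 * pi) * (std_normal_density r *\<^sub>R f (z - r / n))"
        unfolding 2 by (simp add: scaleR_conv_of_real)
      finally show "(1 / n) *\<^sub>R ?q (z + (- 1 / n) * r) = complex_of_real (2 * pi) * (std_normal_density r *\<^sub>R f (z - r / n))" .
    qed
    finally show ?thesis .
  qed
  finally show ?thesis by (simp only: integral_mult_right_zero)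
qed

text \<open>Integrability is available for \<open>fourier \<psi>\<close> but not for
  \<open>fourier f\<close>, so the Gaussian is attached to \<open>fourier f\<close>, where it makes
  the multiplication formula applicable. The damped integral \<open>L n\<close> is then evaluated in
  two ways, and both sides converge by domination: by a multiple of |fourier \<psi>| on the
  frequency side, and by a multiple of |\<psi>| on the other, where bounded continuous
  \<open>f\<close> makes the averages \<open>S n\<close> converge pointwise.\<close>

lemma fourier_convolution_inversion:
  fixes f \<psi> :: "real \<Rightarrow> complex"
  assumes f: "integrable lborel f" "continuous_on UNIV f" "\<And>t. norm (f t) \<le> C"
    and \<psi>: "integrable lborel \<psi>" and \<psi>h: "integrable lborel (fourier \<psi>)"
  shows "(LINT s|lborel. fourier f s * (exp (\<i> * complex_of_real (x * s)) * fourier \<psi> s))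
     = of_real (2 * pi) * (LINT t|lborel. f (x - t) * \<psi> t)"
proof -
  have [measurable]: "f \<in> borel_measurable borel" "\<psi> \<in> borel_measurable borel"
    using f \<psi> by auto
  have [measurable]: "fourier f \<in> borel_measurable borel" "fourier \<psi> \<in> borel_measurable borel"
    using continuous_on_fourier f \<psi> by (auto intro: borel_measurable_continuous_onI)
  have C: "C \<ge> 0" using f(3)[of 0] norm_ge_zero order.trans by blast
  define Cf where "Cf = (LINT t|lborel. norm (f t))"
  have Cf: "norm (fourier f s) \<le> Cf" for s unfolding Cf_def by (rule norm_fourier_le[OF f(1)])
  let ?G = "\<lambda>n s. complex_of_real (exp (- ((s / real (Suc n))\<^sup>2) / 2))"
  define L where "L n = (LINT s|lborel. (exp (\<i> * complex_of_real (x * s)) * ?G n s * fourier f s) * fourier \<psi> s)" for n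
  define S where "S n z = (LINT r|lborel. std_normal_density r *\<^sub>R f (z - r / real (Suc n)))" for n z
  have Nf: "norm (std_normal_density r *\<^sub>R f z) \<le> C * std_normal_density r" for r z
    using mult_left_mono[OF f(3) normal_density_nonneg] by (simp add: mult.commute)
  have Sn: "norm (S n z) \<le> C" for n z
  proof -
    have "norm (S n z) \<le> (LINT r|lborel. norm (std_normal_density r *\<^sub>R f (z - r / real (Suc n))))"
      unfolding S_def by (rule integral_norm_bound)
    also have "\<dots> \<le> (LINT r|lborel. C * std_normal_density r)"
    proof (rule integral_mono_AE')
      show "AE r in lborel. norm (std_normal_density r *\<^sub>R f (z - r / real (Suc n))) \<le> C * std_normal_density r"
        by (intro AE_I2 Nf)
    qed (auto simp: C)
    finally show ?thesis by simp
  qed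
  have [measurable]: "S n \<in> borel_measurable borel" for n
    unfolding S_def by measurable
  have L_eq: "L n = of_real (2 * pi) * (LINT t|lborel. \<psi> t * S n (x - t))" for n
  proof -
    let ?u = "\<lambda>s. exp (\<i> * complex_of_real (x * s)) * ?G n s * fourier f s"
    have u: "integrable lborel ?u"
    proof (rule Bochner_Integration.integrable_bound)
      show "integrable lborel (\<lambda>s. Cf * exp (- ((s / real (Suc n))\<^sup>2) / 2))"
        using gaussian_fourier(2)[of "real (Suc n)"] by (intro integrable_mult_right) auto
      have "exp (- ((s / real (Suc n))\<^sup>2) / 2) * norm (fourier f s) \<le> exp (- ((s / real (Suc n))\<^sup>2) / 2) * Cf" for s
        by (intro mult_left_mono Cf) auto
      then show "AE s in lborel. norm (?u s) \<le> norm (Cf * exp (- ((s / real (Suc n))\<^sup>2) / 2))"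
        by (intro AE_I2) (simp add: norm_mult abs_mult mult.commute order.trans[OF _ abs_ge_self])
    qed measurable
    have "L n = (LINT t|lborel. \<psi> t * (LINT s|lborel. ?u s * exp (- \<i> * complex_of_real (s * t))))"
      unfolding L_def using fourier_duality[OF u \<psi>, of 1] by simp
    also have "\<dots> = (LINT t|lborel. \<psi> t * (of_real (2 * pi) * S n (x - t)))"
    proof (intro Bochner_Integration.integral_cong refl arg_cong2[where f="(*)"])
      fix t
      have "?u s * exp (- \<i> * complex_of_real (s * t)) = exp (\<i> * complex_of_real (s * (x - t))) * ?G n s * fourier f s" for s
        by (simp add: right_diff_distrib exp_diff exp_minus field_simps)
      then show "(LINT s|lborel. ?u s * exp (- \<i> * complex_of_real (s * t))) = of_real (2 * pi) * S n (x - t)"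
        unfolding S_def by (simp only: fourier_gaussian_inverse[OF f(1)] of_nat_0_less_iff zero_less_Suc)
    qed
    also have "\<dots> = of_real (2 * pi) * (LINT t|lborel. \<psi> t * S n (x - t))"
      by (simp only: mult.left_commute[where a="of_real (2 * pi)"] integral_mult_right_zero)
    finally show ?thesis .
  qed
  have n0: "(\<lambda>n. s / real (Suc n)) \<longlonglongrightarrow> 0" for s :: real
    using tendsto_mult[OF tendsto_const[of s] LIMSEQ_inverse_real_of_nat] by (simp add: divide_inverse)
  have "L \<longlonglongrightarrow> (LINT s|lborel. (exp (\<i> * complex_of_real (x * s)) * 1 * fourier f s) * fourier \<psi> s)"
    unfolding L_def
  proof (rule integral_dominated_convergence[where w="\<lambda>s. Cf * norm (fourier \<psi> s)"])
    show "integrable lborel (\<lambda>s. Cf * norm (fourier \<psi> s))" using \<psi>h by auto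
    have "(\<lambda>n. ?G n s) \<longlonglongrightarrow> of_real (exp (- (0\<^sup>2) / 2))" for s
      by (intro tendsto_of_real tendsto_intros n0) auto
    then show "AE s in lborel. (\<lambda>n. exp (\<i> * complex_of_real (x * s)) * ?G n s * fourier f s * fourier \<psi> s)
       \<longlonglongrightarrow> exp (\<i> * complex_of_real (x * s)) * 1 * fourier f s * fourier \<psi> s"
      by (intro AE_I2 tendsto_intros) simp
    have "exp (- ((s / real (Suc n))\<^sup>2) / 2) * norm (fourier f s) * norm (fourier \<psi> s) \<le> 1 * Cf * norm (fourier \<psi> s)" for n s
      by (intro mult_right_mono mult_mono Cf) auto
    then show "AE s in lborel. norm (exp (\<i> * complex_of_real (x * s)) * ?G n s * fourier f s * fourier \<psi> s) \<le> Cf * norm (fourier \<psi> s)" for n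
      by (intro AE_I2) (simp add: norm_mult)
  qed measurable
  moreover have "L \<longlonglongrightarrow> of_real (2 * pi) * (LINT t|lborel. \<psi> t * f (x - t))"
    unfolding L_eq
  proof (intro tendsto_mult tendsto_const integral_dominated_convergence[where w="\<lambda>t. norm (\<psi> t) * C"])
    show "integrable lborel (\<lambda>t. norm (\<psi> t) * C)" using \<psi> by auto
    have "(\<lambda>n. S n z) \<longlonglongrightarrow> f z" for z
    proof -
      have "(\<lambda>n. S n z) \<longlonglongrightarrow> (LINT r|lborel. std_normal_density r *\<^sub>R f z)"
        unfolding S_def
      proof (rule integral_dominated_convergence[where w="\<lambda>r. C * std_normal_density r"])
        have "(\<lambda>n. f (z - r / real (Suc n))) \<longlonglongrightarrow> f z" for r
        proof -
          have "isCont f z" using f(2) by (simp add: continuous_on_eq_continuous_at)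
          moreover have "(\<lambda>n. z - r / real (Suc n)) \<longlonglongrightarrow> z"
            using tendsto_diff[OF tendsto_const[of z] n0[of r]] by simp
          ultimately show ?thesis by (rule isCont_tendsto_compose)
        qed
        then show "AE r in lborel. (\<lambda>n. std_normal_density r *\<^sub>R f (z - r / real (Suc n))) \<longlonglongrightarrow> std_normal_density r *\<^sub>R f z"
          by (intro AE_I2 tendsto_intros)
        show "AE r in lborel. norm (std_normal_density r *\<^sub>R f (z - r / real (Suc n))) \<le> C * std_normal_density r" for n
          by (intro AE_I2 Nf)
      qed auto
      then show ?thesis by simp
    qed
    then show "AE t in lborel. (\<lambda>n. \<psi> t * S n (x - t)) \<longlonglongrightarrow> \<psi> t * f (x - t)"
      by (intro AE_I2 tendsto_intros)
    show "AE t in lborel. norm (\<psi> t * S n (x - t)) \<le> norm (\<psi> t) * C" for n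
      by (intro AE_I2) (auto simp: norm_mult intro!: mult_left_mono Sn)
  qed measurable
  ultimately have "(LINT s|lborel. (exp (\<i> * complex_of_real (x * s)) * 1 * fourier f s) * fourier \<psi> s)
     = of_real (2 * pi) * (LINT t|lborel. \<psi> t * f (x - t))"
    by (rule LIMSEQ_unique)
  then show ?thesis by (simp add: mult_ac)
qed

subsection \<open>The function Omega\<close>

text \<open>The derivative of \<open>vfun 1\<close>, taken under the integral sign in the Taylor
  remainder: the integral of (1 - \<theta>) e^(-i \<theta> u) over {0..1}. This form needs no case
  distinction at 0.\<close>

definition dvfun1 :: "real \<Rightarrow> complex" where
  "dvfun1 u = integral {0..1} (\<lambda>\<theta>. complex_of_real (1 - \<theta>) * (- \<i> * complex_of_real \<theta> * exp (- \<i> * complex_of_real (\<theta> * u))))"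

definition dvfun :: "real \<Rightarrow> real \<Rightarrow> complex" where
  "dvfun s t = complex_of_real (s ^ 3) * dvfun1 (s * t)"

lemma exp_linear_has_vector_derivative:
  "((\<lambda>x. exp (- \<i> * complex_of_real (\<theta> * x))) has_vector_derivative - \<i> * complex_of_real \<theta> * exp (- \<i> * complex_of_real (\<theta> * x))) (at x within S)"
proof -
  have "((\<lambda>x. exp ((- \<i> * of_real \<theta>) * x)) has_field_derivative (- \<i> * of_real \<theta>) * exp ((- \<i> * of_real \<theta>) * of_real x)) (at (of_real x))"
    by (auto intro!: derivative_eq_intros)
  from has_vector_derivative_real_field[OF this] show ?thesis
    by (simp add: mult.assoc has_vector_derivative_at_within)
qed

text \<open>Taylor's formula for e^(-iu) to first order with integral remainder. It removes the
  apparent singularity of \<open>vfun\<close> at 0.\<close>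

lemma vfun_has_integral:
  "((\<lambda>\<theta>. complex_of_real (1 - \<theta>) * exp (- \<i> * complex_of_real (\<theta> * u))) has_integral vfun 1 u) {0..1}"
proof (cases "u = 0")
  case True
  have "((\<lambda>\<theta>. complex_of_real (1 - \<theta>)) has_integral (complex_of_real (1 - 1\<^sup>2 / 2) - complex_of_real (0 - 0\<^sup>2 / 2))) {0..1}"
  proof (rule fundamental_theorem_of_calculus)
    fix \<theta> :: real
    have "((\<lambda>\<theta>. \<theta> - \<theta>\<^sup>2 / 2) has_real_derivative 1 - \<theta>) (at \<theta> within {0..1})"
      by (auto intro!: derivative_eq_intros)
    then show "((\<lambda>\<theta>. complex_of_real (\<theta> - \<theta>\<^sup>2 / 2)) has_vector_derivative complex_of_real (1 - \<theta>)) (at \<theta> within {0..1})"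
      by (rule has_vector_derivative_of_real)
  qed simp
  then show ?thesis using True by (simp add: vfun_def)
next
  case False
  define E where "E \<theta> = exp (- \<i> * complex_of_real (u * \<theta>))" for \<theta>
  \<comment> \<open>This antiderivative comes from integrating by parts once: i / u times the
    exponential is an antiderivative of the exponential, and (i / u)^2 = -1 / u^2.\<close>
  define A where "A \<theta> = complex_of_real (1 - \<theta>) * (E \<theta> * (\<i> / of_real u)) - E \<theta> / of_real (u\<^sup>2)" for \<theta>
  have E': "(E has_vector_derivative - \<i> * of_real u * E \<theta>) (at \<theta> within S)" for \<theta> S
    unfolding E_def by (rule exp_linear_has_vector_derivative)
  have L: "((\<lambda>\<theta>. complex_of_real (1 - \<theta>)) has_vector_derivative of_real (- 1)) (at \<theta> within S)" for \<theta> S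
    by (rule has_vector_derivative_of_real) (auto intro!: derivative_eq_intros)
  have "(A has_vector_derivative complex_of_real (1 - \<theta>) * E \<theta>) (at \<theta> within S)" for \<theta> S
  proof -
    have "(A has_vector_derivative (complex_of_real (1 - \<theta>) * ((- \<i> * of_real u * E \<theta>) * (\<i> / of_real u)) + of_real (- 1) * (E \<theta> * (\<i> / of_real u)))
       - (- \<i> * of_real u * E \<theta>) / of_real (u\<^sup>2)) (at \<theta> within S)"
      unfolding A_def
      by (intro has_vector_derivative_diff has_vector_derivative_mult L has_vector_derivative_mult_left has_vector_derivative_divide E')
    moreover have "(complex_of_real (1 - \<theta>) * ((- \<i> * of_real u * E \<theta>) * (\<i> / of_real u)) + of_real (- 1) * (E \<theta> * (\<i> / of_real u)))
       - (- \<i> * of_real u * E \<theta>) / of_real (u\<^sup>2) = complex_of_real (1 - \<theta>) * E \<theta>"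
      using False by (simp add: field_simps power2_eq_square)
    ultimately show ?thesis by simp
  qed
  then have "((\<lambda>\<theta>. complex_of_real (1 - \<theta>) * E \<theta>) has_integral (A 1 - A 0)) {0..1}"
    by (intro fundamental_theorem_of_calculus) auto
  moreover have "A 1 - A 0 = vfun 1 u"
    using False by (simp add: A_def E_def vfun_def field_simps power2_eq_square)
  ultimately show ?thesis by (simp add: E_def mult.commute)
qed

lemma vfun_1_has_vector_derivative: "(vfun 1 has_vector_derivative dvfun1 u) (at u)"
proof -
  have eq: "vfun 1 = (\<lambda>u. integral (cbox 0 1) (\<lambda>\<theta>. complex_of_real (1 - \<theta>) * exp (- \<i> * complex_of_real (\<theta> * u))))"
    using integral_unique[OF vfun_has_integral] by (auto simp: fun_eq_iff)
  show ?thesis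
    unfolding eq dvfun1_def interval_cbox
  proof (rule leibniz_rule_vector_derivative)
    show "((\<lambda>u. complex_of_real (1 - \<theta>) * exp (- \<i> * complex_of_real (\<theta> * u))) has_vector_derivative
        complex_of_real (1 - \<theta>) * (- \<i> * complex_of_real \<theta> * exp (- \<i> * complex_of_real (\<theta> * u)))) (at u within UNIV)" for u \<theta>
      by (intro has_vector_derivative_mult_right exp_linear_has_vector_derivative)
    show "(\<lambda>\<theta>. complex_of_real (1 - \<theta>) * exp (- \<i> * complex_of_real (\<theta> * u))) integrable_on cbox 0 1" for u
      using vfun_has_integral by auto
    show "continuous_on (UNIV \<times> cbox 0 1) (\<lambda>(u,\<theta>). complex_of_real (1 - \<theta>) * (- \<i> * complex_of_real \<theta> * exp (- \<i> * complex_of_real (\<theta> * u))))"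
      unfolding split_beta by (intro continuous_intros)
  qed auto
qed

lemma continuous_on_dvfun1: "continuous_on UNIV dvfun1"
  unfolding dvfun1_def interval_cbox
  by (rule integral_continuous_on_param) (unfold split_beta, intro continuous_intros)

text \<open>For |u| at most 1 the integral form gives the bound 1. For larger |u| the quotient rule
  gives a numerator of size at most 2 u^2 + 2 |u| (2 + |u|), hence at most 8 u^2, over u^4. Passing
  from 8 / u^2 to a bound valid near 0 as well doubles the constant to 16.\<close>

lemma norm_dvfun1_le: "norm (dvfun1 u) \<le> 16 / (1 + u\<^sup>2)"
proof (cases "\<bar>u\<bar> \<le> 1")
  case True
  let ?f = "\<lambda>\<theta>. complex_of_real (1 - \<theta>) * (- \<i> * complex_of_real \<theta> * exp (- \<i> * complex_of_real (\<theta> * u)))"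
  have "?f integrable_on {0..1}"
    by (intro integrable_continuous_real continuous_intros)
  then have "(?f has_integral dvfun1 u) {0..1}"
    unfolding dvfun1_def by (rule integrable_integral)
  then have "norm (dvfun1 u) \<le> 1 * measure lborel {0..1::real}"
  proof (rule has_integral_bound_real[where S="{}" and B=1, rotated 2])
    fix \<theta> :: real assume \<theta>: "\<theta> \<in> {0..1} - {}"
    then have "\<bar>1 - \<theta>\<bar> * \<bar>\<theta>\<bar> \<le> 1 * 1" by (intro mult_mono) auto
    then show "norm (?f \<theta>) \<le> 1" by (simp add: norm_mult flip: of_real_diff)
  qed auto
  moreover have "u\<^sup>2 \<le> 1" using True by (simp add: abs_square_le_1)
  then have "1 \<le> 16 / (1 + u\<^sup>2)" by (simp add: pos_le_divide_eq add_pos_nonneg)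
  ultimately show ?thesis by simp
next
  case False
  define D where "D = ((- \<i> + \<i> * exp (- \<i> * complex_of_real u)) * of_real (u\<^sup>2)
      - (1 - \<i> * complex_of_real u - exp (- \<i> * complex_of_real u)) * of_real (2 * u)) / of_real (u ^ 4)"
  have u: "u \<noteq> 0" using False by auto
  have "((\<lambda>z. (1 - \<i> * z - exp (- \<i> * z)) / z\<^sup>2) has_field_derivative D) (at (complex_of_real u))"
    using u by (auto intro!: derivative_eq_intros simp: D_def field_simps power2_eq_square power4_eq_xxxx)
  from has_vector_derivative_real_field[OF this]
  have "((\<lambda>x. (1 - \<i> * complex_of_real x - exp (- \<i> * complex_of_real x)) / (complex_of_real x)\<^sup>2) has_vector_derivative D) (at u)" .
  then have "(vfun 1 has_vector_derivative D) (at u)"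
    by (rule has_vector_derivative_transform_within_open[of _ _ _ "- {0}"]) (use u in \<open>auto simp: vfun_def\<close>)
  then have "dvfun1 u = D" using vector_derivative_unique_at vfun_1_has_vector_derivative by blast
  have "norm D \<le> 8 / u\<^sup>2"
  proof -
    have a: "norm (- \<i> + \<i> * exp (- \<i> * complex_of_real u)) \<le> 2"
      by (rule order.trans[OF norm_triangle_ineq]) (simp add: norm_mult)
    have b: "norm (1 - \<i> * complex_of_real u - exp (- \<i> * complex_of_real u)) \<le> 2 + \<bar>u\<bar>"
      using norm_triangle_ineq4[of "1 - \<i> * complex_of_real u" "exp (- \<i> * complex_of_real u)"] norm_triangle_ineq4[of 1 "\<i> * complex_of_real u"]
      by (simp add: norm_mult)
    have num: "norm (X * of_real (u\<^sup>2) - Y * of_real (2 * u)) \<le> 2 * u\<^sup>2 + (2 + \<bar>u\<bar>) * (2 * \<bar>u\<bar>)"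
      if "norm X \<le> 2" "norm Y \<le> 2 + \<bar>u\<bar>" for X Y :: complex
    proof -
      have "norm (X * of_real (u\<^sup>2) - Y * of_real (2 * u)) \<le> norm X * u\<^sup>2 + norm Y * (2 * \<bar>u\<bar>)"
        using norm_triangle_ineq4[of "X * of_real (u\<^sup>2)" "Y * of_real (2 * u)"] by (simp add: norm_mult norm_power)
      also have "\<dots> \<le> 2 * u\<^sup>2 + (2 + \<bar>u\<bar>) * (2 * \<bar>u\<bar>)"
        using that by (intro add_mono mult_right_mono) auto
      finally show ?thesis .
    qed
    have "norm D \<le> (2 * u\<^sup>2 + (2 + \<bar>u\<bar>) * (2 * \<bar>u\<bar>)) / u ^ 4"
      unfolding D_def norm_divide using divide_right_mono[OF num[OF a b], of "u ^ 4"] by (simp add: norm_power)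
    also have "\<dots> \<le> (8 * u\<^sup>2) / u ^ 4"
    proof (rule divide_right_mono)
      have "\<bar>u\<bar> * 1 \<le> \<bar>u\<bar> * \<bar>u\<bar>" using False by (intro mult_left_mono) auto
      then show "2 * u\<^sup>2 + (2 + \<bar>u\<bar>) * (2 * \<bar>u\<bar>) \<le> 8 * u\<^sup>2"
        by (simp add: algebra_simps power2_eq_square)
    qed simp
    also have "\<dots> = 8 / u\<^sup>2" using u by (simp add: field_simps power2_eq_square power4_eq_xxxx)
    finally show ?thesis .
  qed
  also have "8 / u\<^sup>2 \<le> 16 / (1 + u\<^sup>2)"
  proof -
    have "1 \<le> u\<^sup>2" using False abs_le_square_iff[of 1 u] by simp
    then show ?thesis by (simp add: divide_simps add_pos_nonneg)
  qed
  finally show ?thesis using \<open>dvfun1 u = D\<close> by simp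
qed

lemma integrable_inverse_1_plus_sq:
  "integrable lborel (\<lambda>x::real. 1 / (1 + x\<^sup>2))" "(LINT x|lborel. 1 / (1 + x\<^sup>2)) = pi"
  using integrable_inverse_1_plus_square LBINT_inverse_1_plus_square
  by (simp_all add: set_integrable_def interval_lebesgue_integral_def set_lebesgue_integral_def inverse_eq_divide)

lemma vfun_scale: "vfun s t = complex_of_real (s\<^sup>2) * vfun 1 (s * t)"
  by (cases "s = 0") (auto simp: vfun_def field_simps)

lemma vfun_has_vector_derivative: "(vfun s has_vector_derivative dvfun s t) (at t)"
proof -
  have "((\<lambda>t. s * t) has_vector_derivative s) (at t)"
    by (auto intro!: derivative_eq_intros simp: has_real_derivative_iff_has_vector_derivative[symmetric])
  from vector_diff_chain_at[OF this vfun_1_has_vector_derivative]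
  have "((\<lambda>t. vfun 1 (s * t)) has_vector_derivative s *\<^sub>R dvfun1 (s * t)) (at t)"
    by (simp add: o_def)
  from has_vector_derivative_mult_right[OF this, of "complex_of_real (s\<^sup>2)"]
  show ?thesis
    unfolding vfun_scale[of s, abs_def, symmetric]
    by (simp add: dvfun_def scaleR_conv_of_real power2_eq_square power3_eq_cube mult_ac vfun_scale[of s, abs_def])
qed

lemma continuous_on_dvfun: "continuous_on UNIV (dvfun s)"
  unfolding dvfun_def by (intro continuous_intros continuous_on_compose2[OF continuous_on_dvfun1]) auto

text \<open>The chain rule contributes |s|^3 and the substitution u = s t takes back one factor |s|.
  The integral \<pi> of 1 / (1 + u^2) leaves 16 \<pi> s^2, the source of the second-order vanishing
  of \<open>Omega\<close> at 0.\<close>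

lemma dvfun_integrable_bound:
  obtains q where "integrable lborel q" "\<And>t. norm (dvfun s t) \<le> q t" "(LINT t|lborel. q t) = 16 * pi * s\<^sup>2"
proof (cases "s = 0")
  case True
  then show thesis by (intro that[of "\<lambda>_. 0"]) (auto simp: dvfun_def)
next
  case False
  define q where "q t = \<bar>s\<bar> ^ 3 * 16 * (1 / (1 + (s * t)\<^sup>2))" for t
  have i: "integrable lborel (\<lambda>t. 1 / (1 + (s * t)\<^sup>2))"
    using lborel_integrable_real_affine[OF integrable_inverse_1_plus_sq(1) False, of 0] by simp
  have "pi = \<bar>s\<bar> * (LINT t|lborel. 1 / (1 + (s * t)\<^sup>2))"
    using lborel_integral_real_affine[OF False, of "\<lambda>x. 1 / (1 + x\<^sup>2)" 0] integrable_inverse_1_plus_sq(2) by simp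
  then have "(LINT t|lborel. q t) = 16 * pi * s\<^sup>2"
    unfolding q_def integral_mult_right_zero by (simp add: power3_eq_cube power2_eq_square)
  moreover have "integrable lborel q" unfolding q_def using i by (intro integrable_mult_right)
  moreover have "norm (dvfun s t) \<le> q t" for t
    using mult_left_mono[OF norm_dvfun1_le[of "s * t"], of "\<bar>s\<bar> ^ 3"]
    by (simp add: dvfun_def q_def norm_mult power_abs norm_power)
  ultimately show thesis using that by blast
qed

lemma vfun_tendsto_0: "(vfun s \<longlongrightarrow> 0) at_top" "(vfun s \<longlongrightarrow> 0) at_bot"
proof -
  have bd: "norm (vfun s t) \<le> 2 * inverse t ^ 2 + \<bar>s\<bar> * \<bar>inverse t\<bar>" if "t \<noteq> 0" for t
  proof -
    have "norm (1 - \<i> * complex_of_real (s * t) - exp (- \<i> * complex_of_real (s * t))) \<le> 2 + \<bar>s * t\<bar>"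
      using norm_triangle_ineq4[of "1 - \<i> * complex_of_real (s * t)" "exp (- \<i> * complex_of_real (s * t))"] norm_triangle_ineq4[of 1 "\<i> * complex_of_real (s * t)"]
      by (simp add: norm_mult)
    then have "norm (vfun s t) \<le> (2 + \<bar>s * t\<bar>) / t\<^sup>2"
      using that by (simp add: vfun_def norm_divide norm_power divide_right_mono)
    also have "\<dots> = 2 * inverse t ^ 2 + \<bar>s\<bar> * \<bar>inverse t\<bar>"
    proof -
      have "\<bar>t\<bar> / t\<^sup>2 = \<bar>inverse t\<bar>"
        using that by (simp add: power2_eq_square field_simps abs_if)
      then show ?thesis by (simp add: abs_mult distrib_right power_inverse divide_inverse mult.assoc)
    qed
    finally show ?thesis .
  qed
  have i: "((inverse :: real \<Rightarrow> real) \<longlongrightarrow> 0) at_top" "((inverse :: real \<Rightarrow> real) \<longlongrightarrow> 0) at_bot"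
    by (rule tendsto_mono[OF at_top_le_at_infinity tendsto_inverse_0] tendsto_mono[OF at_bot_le_at_infinity tendsto_inverse_0])+
  show "(vfun s \<longlongrightarrow> 0) at_top"
  proof (rule Lim_null_comparison)
    show "((\<lambda>t. 2 * inverse t ^ 2 + \<bar>s\<bar> * \<bar>inverse t\<bar>) \<longlongrightarrow> 0) at_top"
      by (rule tendsto_eq_intros i refl | simp)+
    show "\<forall>\<^sub>F t in at_top. norm (vfun s t) \<le> 2 * inverse t ^ 2 + \<bar>s\<bar> * \<bar>inverse t\<bar>"
      using eventually_gt_at_top[of 0] by eventually_elim (rule bd, simp)
  qed
  show "(vfun s \<longlongrightarrow> 0) at_bot"
  proof (rule Lim_null_comparison)
    show "((\<lambda>t. 2 * inverse t ^ 2 + \<bar>s\<bar> * \<bar>inverse t\<bar>) \<longlongrightarrow> 0) at_bot"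
      by (rule tendsto_eq_intros i refl | simp)+
    show "\<forall>\<^sub>F t in at_bot. norm (vfun s t) \<le> 2 * inverse t ^ 2 + \<bar>s\<bar> * \<bar>inverse t\<bar>"
      using eventually_gt_at_bot[of 0] by eventually_elim (rule bd, simp)
  qed
qed

lemma at_infty_vfun: "at_infty (vfun s) = 0"
  unfolding at_infty_def by (rule tendsto_Lim) (auto intro: vfun_tendsto_0)

section \<open>Omega as an absolutely convergent integral\<close>

lemma integral_tendsto_lborel:
  fixes q :: "real \<Rightarrow> complex"
  assumes "integrable lborel q"
  shows "((\<lambda>(a,b). integral {a..b} q) \<longlongrightarrow> (LINT t|lborel. q t)) (at_bot \<times>\<^sub>F at_top)"
proof (rule tendstoI)
  fix e :: real assume "e > 0"
  have "(q has_integral (LINT t|lborel. q t)) UNIV" by (rule has_integral_integral_lborel[OF assms])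
  then have "\<exists>B>0. \<forall>a b. ball 0 B \<subseteq> cbox a b \<longrightarrow> norm (integral (cbox a b) q - (LINT t|lborel. q t)) < e"
    using \<open>e > 0\<close> unfolding has_integral_alt' by simp
  then obtain B where B: "\<And>a b. ball 0 B \<subseteq> cbox a b \<Longrightarrow> norm (integral (cbox a b) q - (LINT t|lborel. q t)) < e"
    by blast
  have "\<forall>\<^sub>F p in at_bot \<times>\<^sub>F at_top. fst p \<le> - B \<and> B \<le> snd p"
    by (intro eventually_prodI eventually_le_at_bot eventually_ge_at_top)
  then show "\<forall>\<^sub>F p in at_bot \<times>\<^sub>F at_top. dist (case p of (a,b) \<Rightarrow> integral {a..b} q) (LINT t|lborel. q t) < e"
  proof eventually_elim
    case (elim p)
    obtain a b where p: "p = (a,b)" by (cases p)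
    have "ball 0 B \<subseteq> cbox a b" using elim by (auto simp: p dist_real_def)
    from B[OF this] show ?case by (simp add: p dist_norm)
  qed
qed

lemma Bc_bounded:
  assumes "Bc F"
  obtains C where "C \<ge> 0" "\<And>t. norm (F t) \<le> C"
proof -
  obtain l where l: "(F \<longlongrightarrow> l) at_top" and F: "continuous_on UNIV F" "(F \<longlongrightarrow> 0) at_bot"
    using assms unfolding Bc_def by blast
  obtain b where b: "\<And>t. t \<ge> b \<Longrightarrow> dist (F t) l < 1"
    using tendstoD[OF l zero_less_one] unfolding eventually_at_top_linorder by auto
  obtain a where a: "\<And>t. t \<le> a \<Longrightarrow> dist (F t) 0 < 1"
    using tendstoD[OF F(2) zero_less_one] unfolding eventually_at_bot_linorder by auto
  have "compact (F ` {a..b})"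
    using F(1) by (intro compact_continuous_image continuous_on_subset[OF F(1)]) auto
  from compact_imp_bounded[OF this] obtain M where "\<forall>y\<in>F ` {a..b}. norm y \<le> M"
    unfolding bounded_iff ..
  then have M: "norm (F t) \<le> M" if "t \<in> {a..b}" for t
    using that by simp
  have "norm (F t) \<le> \<bar>M\<bar> + norm l + 1" for t
  proof -
    consider "t \<le> a" | "t \<ge> b" | "t \<in> {a..b}" by fastforce
    then show ?thesis
    proof cases
      case 1
      then show ?thesis using a[of t] norm_ge_zero[of l] abs_ge_zero[of M] unfolding dist_0_norm dist_norm diff_zero by linarith
    next
      case 2
      then show ?thesis using b[of t] norm_triangle_ineq2[of "F t" l] abs_ge_zero[of M] unfolding dist_norm by linarith
    next
      case 3
      then show ?thesis using M[of t] norm_ge_zero[of l] by linarith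
    qed
  qed
  moreover have "0 \<le> \<bar>M\<bar> + norm l + 1" by simp
  ultimately show thesis using that by blast
qed

lemma Bc_meas: "Bc F \<Longrightarrow> F \<in> borel_measurable borel"
  by (auto simp: Bc_def intro: borel_measurable_continuous_onI)

lemma Bc_dvfun_integrable:
  assumes "Bc F"
  shows "integrable lborel (\<lambda>t. F t * dvfun s t)"
proof -
  obtain C where C: "\<And>t. norm (F t) \<le> C" by (rule Bc_bounded[OF assms]) blast
  obtain q where q: "integrable lborel q" "\<And>t. norm (dvfun s t) \<le> q t" by (rule dvfun_integrable_bound) blast
  have [measurable]: "F \<in> borel_measurable borel" "dvfun s \<in> borel_measurable borel"
    using assms continuous_on_dvfun by (auto simp: Bc_def intro: borel_measurable_continuous_onI)
  show ?thesis
  proof (rule Bochner_Integration.integrable_bound)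
    show "integrable lborel (\<lambda>t. C * q t)" using q by auto
    have "norm (F t) * norm (dvfun s t) \<le> C * q t" for t
      using C[of t] q(2)[of t] by (intro mult_mono) (auto intro: order.trans[OF norm_ge_zero])
    then show "AE t in lborel. norm (F t * dvfun s t) \<le> norm (C * q t)"
      by (intro AE_I2) (simp add: norm_mult order.trans[OF _ abs_ge_self])
  qed measurable
qed

text \<open>The boundary term in \<open>alex_int\<close> vanishes because \<open>vfun s\<close>
  tends to 0 at infinity, and differentiability of \<open>vfun s\<close> turns the Stieltjes
  integral into an integral against its derivative.\<close>

lemma Omega_eq:
  assumes "Bc F"
  shows "Omega F s = - (LINT t|lborel. F t * dvfun s t)"
proof -
  note int = Bc_dvfun_integrable[OF assms, of s]
  have rs: "rs_has_integral F (vfun s) (integral {a..b} (\<lambda>t. F t * dvfun s t)) a b" if "a \<le> b" for a b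
  proof (rule rs_has_integral_C1[OF that vfun_has_vector_derivative])
    show "((\<lambda>t. F t * dvfun s t) has_integral integral {a..b} (\<lambda>t. F t * dvfun s t)) {a..b}"
      by (intro integrable_integral integrable_on_subinterval[OF integrable_on_lborel[OF int]]) auto
  qed
  have "\<forall>\<^sub>F p in at_bot \<times>\<^sub>F at_top. fst p \<le> (0::real) \<and> (0::real) \<le> snd p"
    by (intro eventually_prodI eventually_le_at_bot eventually_ge_at_top)
  then have ev: "\<forall>\<^sub>F p in at_bot \<times>\<^sub>F at_top. (case p of (a,b) \<Rightarrow> integral {a..b} (\<lambda>t. F t * dvfun s t)) = (case p of (a,b) \<Rightarrow> rs_integral F (vfun s) a b)"
  proof eventually_elim
    case (elim p)
    then show ?case using rs_integral_eq[OF rs[of "fst p" "snd p"]] by (auto simp: split_beta)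
  qed
  have "rs_improper_has_integral F (vfun s) (LINT t|lborel. F t * dvfun s t)"
    unfolding rs_improper_has_integral_def
    using rs Lim_transform_eventually[OF integral_tendsto_lborel[OF int] ev] by blast
  then show ?thesis
    unfolding Omega_def alex_int_def at_infty_vfun using rs_improper_integral_eq by simp
qed

text \<open>By linearity the difference is at most the supremum distance \<open>c\<close> times the
  L1-norm of \<open>dvfun s\<close>. This is the only way in which approximation of primitives
  enters the Stieltjes estimates.\<close>

lemma Omega_diff_le:
  assumes F: "Bc F" and G: "Bc G" and c: "\<And>t. norm (F t - G t) \<le> c"
  shows "norm (Omega F s - Omega G s) \<le> c * (16 * pi) * s\<^sup>2"
proof -
  obtain q where q: "integrable lborel q" "\<And>t. norm (dvfun s t) \<le> q t" "(LINT t|lborel. q t) = 16 * pi * s\<^sup>2"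
    by (rule dvfun_integrable_bound) blast
  have c0: "0 \<le> c" using c[of 0] norm_ge_zero order.trans by blast
  have "Omega F s - Omega G s = - ((LINT t|lborel. F t * dvfun s t) - (LINT t|lborel. G t * dvfun s t))"
    by (simp add: Omega_eq F G)
  also have "\<dots> = - (LINT t|lborel. (F t - G t) * dvfun s t)"
    using Bc_dvfun_integrable[OF F, of s] Bc_dvfun_integrable[OF G, of s] by (simp add: left_diff_distrib)
  finally have "norm (Omega F s - Omega G s) = norm (LINT t|lborel. (F t - G t) * dvfun s t)" by simp
  also have "\<dots> \<le> (LINT t|lborel. norm ((F t - G t) * dvfun s t))" by (rule integral_norm_bound)
  also have "\<dots> \<le> (LINT t|lborel. c * q t)"
  proof (rule integral_mono)
    have "integrable lborel (\<lambda>t. (F t - G t) * dvfun s t)"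
      using Bc_dvfun_integrable[OF F, of s] Bc_dvfun_integrable[OF G, of s] by (simp add: left_diff_distrib)
    then show "integrable lborel (\<lambda>t. norm ((F t - G t) * dvfun s t))" by simp
    show "integrable lborel (\<lambda>t. c * q t)" using q by simp
    show "norm ((F t - G t) * dvfun s t) \<le> c * q t" for t
      unfolding norm_mult using c q(2) c0 by (intro mult_mono) auto
  qed
  also have "\<dots> = c * (16 * pi) * s\<^sup>2" by (simp add: q(3))
  finally show ?thesis .
qed

subsection \<open>Smooth approximation of primitives\<close>

text \<open>Vanishing far to the left fixes the constant of integration. On the right
  \<open>F\<close> may settle at a nonzero constant, as elements of \<open>Bc\<close> may have a
  nonzero limit there.\<close>

definition test_primitive :: "(real \<Rightarrow> complex) \<Rightarrow> (real \<Rightarrow> complex) \<Rightarrow> bool" where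
  "test_primitive F f \<longleftrightarrow> continuous_on UNIV f \<and> (\<forall>t. (F has_vector_derivative f t) (at t)) \<and>
     (\<exists>R. (\<forall>t. \<bar>t\<bar> \<ge> R \<longrightarrow> f t = 0) \<and> (\<forall>t\<le>-R. F t = 0))"

lemma test_primitiveE:
  assumes "test_primitive F f"
  obtains R where "R \<ge> 0" "\<And>t. \<bar>t\<bar> \<ge> R \<Longrightarrow> f t = 0" "\<And>t. t \<le> - R \<Longrightarrow> F t = 0"
    "continuous_on UNIV f" "\<And>t. (F has_vector_derivative f t) (at t)"
proof -
  obtain R where R: "\<forall>t. \<bar>t\<bar> \<ge> R \<longrightarrow> f t = 0" "\<forall>t\<le>-R. F t = 0"
    using assms unfolding test_primitive_def by blast
  then show thesis
    using assms unfolding test_primitive_def by (intro that[of "max R 0"]) auto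
qed

lemma test_primitive_Bc:
  assumes "test_primitive F f"
  shows "Bc F"
proof -
  obtain R where R: "R \<ge> 0" "\<And>t. \<bar>t\<bar> \<ge> R \<Longrightarrow> f t = 0" "\<And>t. t \<le> - R \<Longrightarrow> F t = 0"
    "continuous_on UNIV f" "\<And>t. (F has_vector_derivative f t) (at t)"
    by (rule test_primitiveE[OF assms]) blast
  have "continuous_on UNIV F"
    by (intro continuous_at_imp_continuous_on ballI has_vector_derivative_continuous[OF R(5)])
  moreover have "(F \<longlongrightarrow> 0) at_bot"
  proof (rule tendsto_eventually)
    show "\<forall>\<^sub>F t in at_bot. F t = 0"
      using eventually_le_at_bot[of "- R"] by eventually_elim (rule R(3))
  qed
  moreover have "(F \<longlongrightarrow> F R) at_top"
  proof (rule tendsto_eventually)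
    show "\<forall>\<^sub>F t in at_top. F t = F R"
      using eventually_ge_at_top[of R]
    proof eventually_elim
      case (elim t)
      have "(f has_integral (F t - F R)) {R..t}"
        using elim by (intro fundamental_theorem_of_calculus has_vector_derivative_at_within[OF R(5)])
      moreover have "(f has_integral 0) {R..t}"
        using R(1,2) by (intro has_integral_is_0) auto
      ultimately have "F t - F R = 0" by (rule has_integral_unique)
      then show ?case by simp
    qed
  qed
  ultimately show ?thesis unfolding Bc_def by blast
qed

lemma test_primitive_integrable:
  assumes "test_primitive F f"
  shows "integrable lborel f" and "\<exists>C. \<forall>t. norm (f t) \<le> C"
proof -
  obtain R where R: "R \<ge> 0" "\<And>t. \<bar>t\<bar> \<ge> R \<Longrightarrow> f t = 0" "continuous_on UNIV f"
    by (rule test_primitiveE[OF assms]) blast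
  have "set_integrable lborel {- R..R} f"
    by (intro borel_integrable_atLeastAtMost' continuous_on_subset[OF R(3)]) auto
  moreover have "(\<lambda>t. indicator {- R..R} t *\<^sub>R f t) = f"
    using R(2) by (auto simp: fun_eq_iff indicator_def)
  ultimately show "integrable lborel f" unfolding set_integrable_def by simp
  have "compact (f ` {- R..R})"
    by (intro compact_continuous_image continuous_on_subset[OF R(3)]) auto
  from compact_imp_bounded[OF this] obtain M where M: "\<forall>y\<in>f ` {- R..R}. norm y \<le> M"
    unfolding bounded_iff ..
  have "norm (f t) \<le> M" for t
  proof (cases "\<bar>t\<bar> \<ge> R")
    case True
    have "norm (f R) \<le> M" using M R(1) by simp
    then show ?thesis using R(2)[OF True] order.trans[OF norm_ge_zero] by simp
  next
    case False
    then have "t \<in> {- R..R}" by auto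
    then show ?thesis using M by blast
  qed
  then show "\<exists>C. \<forall>t. norm (f t) \<le> C" by blast
qed

lemma continuous_antiderivative:
  fixes f :: "real \<Rightarrow> 'a::euclidean_space"
  assumes "continuous_on UNIV f"
  obtains A where "A 0 = 0" "\<And>t. (A has_vector_derivative f t) (at t)"
proof -
  have "\<exists>A. \<forall>t. - \<infinity> < ereal t \<longrightarrow> ereal t < \<infinity> \<longrightarrow> (A has_vector_derivative f t) (at t)"
    using assms by (intro einterval_antiderivative) (auto simp: continuous_on_eq_continuous_at)
  then obtain A where A: "\<And>t. (A has_vector_derivative f t) (at t)" by auto
  have "((\<lambda>t. A t - A 0) has_vector_derivative f t) (at t)" for t
    using has_vector_derivative_diff[OF A[of t] has_vector_derivative_const[of "A 0"]] by simp
  then show thesis by (intro that[of "\<lambda>t. A t - A 0"]) auto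
qed

text \<open>The product of \<open>F\<close> and \<open>vfun s\<close> tends to 0 at both ends, so
  its derivative integrates to 0 over the line.\<close>

lemma Omega_test_primitive:
  assumes "test_primitive F f"
  shows "Omega F s = (LINT t|lborel. f t * vfun s t)"
proof -
  obtain R where R: "R \<ge> 0" "\<And>t. \<bar>t\<bar> \<ge> R \<Longrightarrow> f t = 0" "\<And>t. t \<le> - R \<Longrightarrow> F t = 0"
    "continuous_on UNIV f" "\<And>t. (F has_vector_derivative f t) (at t)"
    by (rule test_primitiveE[OF assms]) blast
  note F = test_primitive_Bc[OF assms]
  have cv: "continuous_on UNIV (vfun s)"
    by (intro continuous_at_imp_continuous_on ballI has_vector_derivative_continuous[OF vfun_has_vector_derivative])
  have fv: "integrable lborel (\<lambda>t. f t * vfun s t)"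
  proof -
    have "set_integrable lborel {- R..R} (\<lambda>t. f t * vfun s t)"
      by (intro borel_integrable_atLeastAtMost' continuous_intros continuous_on_subset[OF R(4)] continuous_on_subset[OF cv]) auto
    moreover have "(\<lambda>t. indicator {- R..R} t *\<^sub>R (f t * vfun s t)) = (\<lambda>t. f t * vfun s t)"
      using R(2) by (auto simp: fun_eq_iff indicator_def)
    ultimately show ?thesis unfolding set_integrable_def by simp
  qed
  note Fd = Bc_dvfun_integrable[OF F, of s]
  let ?q = "\<lambda>t. F t * dvfun s t + f t * vfun s t"
  have q: "integrable lborel ?q" using fv Fd by auto
  have "((\<lambda>p. F (snd p) * vfun s (snd p) - F (fst p) * vfun s (fst p)) \<longlongrightarrow> (LINT t|lborel. ?q t)) (at_bot \<times>\<^sub>F at_top)"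
  proof (rule Lim_transform_eventually[OF integral_tendsto_lborel[OF q]])
    have "\<forall>\<^sub>F p in at_bot \<times>\<^sub>F at_top. fst p \<le> (0::real) \<and> (0::real) \<le> snd p"
      by (intro eventually_prodI eventually_le_at_bot eventually_ge_at_top)
    then show "\<forall>\<^sub>F p in at_bot \<times>\<^sub>F at_top. (case p of (a,b) \<Rightarrow> integral {a..b} ?q) = F (snd p) * vfun s (snd p) - F (fst p) * vfun s (fst p)"
    proof eventually_elim
      case (elim p)
      have "(?q has_integral (F (snd p) * vfun s (snd p) - F (fst p) * vfun s (fst p))) {fst p..snd p}"
        using elim by (intro fundamental_theorem_of_calculus has_vector_derivative_mult has_vector_derivative_at_within[OF R(5)] has_vector_derivative_at_within[OF vfun_has_vector_derivative]) auto
      then show ?case by (simp add: split_beta integral_unique)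
    qed
  qed
  moreover have "((\<lambda>p. F (snd p) * vfun s (snd p) - F (fst p) * vfun s (fst p)) \<longlongrightarrow> 0) (at_bot \<times>\<^sub>F at_top)"
  proof -
    obtain l where l: "(F \<longlongrightarrow> l) at_top" and F0: "(F \<longlongrightarrow> 0) at_bot"
      using F unfolding Bc_def by blast
    have 1: "((\<lambda>t. F t * vfun s t) \<longlongrightarrow> 0) at_top" "((\<lambda>t. F t * vfun s t) \<longlongrightarrow> 0) at_bot"
      using tendsto_mult[OF l vfun_tendsto_0(1)[of s]] tendsto_mult[OF F0 vfun_tendsto_0(2)[of s]] by simp_all
    have "((\<lambda>p::real \<times> real. F (snd p) * vfun s (snd p)) \<longlongrightarrow> 0) (at_bot \<times>\<^sub>F at_top)"
      by (rule filterlim_compose[OF 1(1) filterlim_snd])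
    moreover have "((\<lambda>p::real \<times> real. F (fst p) * vfun s (fst p)) \<longlongrightarrow> 0) (at_bot \<times>\<^sub>F at_top)"
      by (rule filterlim_compose[OF 1(2) filterlim_fst])
    ultimately show ?thesis using tendsto_diff by fastforce
  qed
  ultimately have "(LINT t|lborel. ?q t) = 0"
    by (rule tendsto_unique[OF at_bot_times_at_top_neq_bot])
  then have "(LINT t|lborel. F t * dvfun s t) + (LINT t|lborel. f t * vfun s t) = 0"
    using Bochner_Integration.integral_add[OF Fd fv] by simp
  then show ?thesis unfolding Omega_eq[OF F] by (simp add: add_eq_0_iff)
qed

text \<open>This realises \<open>fourier f\<close> as a second derivative of \<open>Omega F\<close>
  in the classical sense. The values 0 of \<open>Omega F\<close> and of its derivative at 0 are the
  conditions under which \<open>rs_has_integral_by_parts\<close> tolerates the singularity of the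
  integrator.\<close>

lemma Omega_test_primitive_derivative:
  assumes "test_primitive F f"
  obtains A where "A 0 = 0" "\<And>s. (A has_vector_derivative fourier f s) (at s)"
    "Omega F 0 = 0" "\<And>s. (Omega F has_vector_derivative A s) (at s)"
proof -
  note f = test_primitive_integrable(1)[OF assms]
  obtain A where A: "A 0 = 0" "\<And>s. (A has_vector_derivative fourier f s) (at s)"
    by (rule continuous_antiderivative[OF continuous_on_fourier[OF f]]) blast
  have "continuous_on UNIV A"
    by (intro continuous_at_imp_continuous_on ballI has_vector_derivative_continuous[OF A(2)])
  then obtain B where B: "B 0 = 0" "\<And>s. (B has_vector_derivative A s) (at s)"
    by (rule continuous_antiderivative) blast
  \<comment> \<open>Taylor expansion with integral remainder, since \<open>vfun s t = s\<^sup>2 \<integral> (1 - \<theta>) exp (- \<i> \<theta> s t)\<close> over \<open>{0..1}\<close>.\<close>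
  have "Omega F s = B s" for s
  proof -
    let ?u = "\<lambda>\<theta>. indicator {0..1} \<theta> *\<^sub>R complex_of_real (1 - \<theta>)"
    have setint: "(LINT \<theta>|lborel. ?u \<theta> * h \<theta>) = integral {0..1} (\<lambda>\<theta>. complex_of_real (1 - \<theta>) * h \<theta>)"
      if h: "continuous_on UNIV h" for h :: "real \<Rightarrow> complex"
    proof -
      have "set_integrable lborel {0..1} (\<lambda>\<theta>. complex_of_real (1 - \<theta>) * h \<theta>)"
        by (intro borel_integrable_atLeastAtMost' continuous_intros continuous_on_subset[OF h]) auto
      from set_borel_integral_eq_integral(2)[OF this] show ?thesis
        by (simp add: set_lebesgue_integral_def)
    qed
    have u: "integrable lborel ?u"
      using borel_integrable_atLeastAtMost'[of 0 1 "\<lambda>\<theta>. complex_of_real (1 - \<theta>)"]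
      by (simp add: set_integrable_def continuous_intros)
    have vf: "vfun 1 y = (LINT \<theta>|lborel. ?u \<theta> * exp (- \<i> * complex_of_real (\<theta> * y)))" for y
      using setint[of "\<lambda>\<theta>. exp (- \<i> * complex_of_real (\<theta> * y))"] integral_unique[OF vfun_has_integral[of y]]
      by (simp add: continuous_intros)
    have cf: "continuous_on UNIV (\<lambda>\<theta>. fourier f (s * \<theta>))"
      by (intro continuous_on_compose2[OF continuous_on_fourier[OF f]] continuous_intros) auto
    have "Omega F s = (LINT t|lborel. complex_of_real (s\<^sup>2) * (f t * vfun 1 (s * t)))"
      unfolding Omega_test_primitive[OF assms] vfun_scale[of s] by (simp add: mult.left_commute)
    also have "\<dots> = complex_of_real (s\<^sup>2) * (LINT t|lborel. f t * vfun 1 (s * t))"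
      by (rule integral_mult_right_zero)
    also have "(LINT t|lborel. f t * vfun 1 (s * t)) = (LINT \<theta>|lborel. ?u \<theta> * fourier f (s * \<theta>))"
      unfolding fourier_duality[OF u f] vf by (simp add: mult_ac)
    also have "\<dots> = integral {0..1} (\<lambda>\<theta>. complex_of_real (1 - \<theta>) * fourier f (s * \<theta>))"
      by (rule setint[OF cf])
    also have "complex_of_real (s\<^sup>2) * \<dots> = integral {0..1} (\<lambda>\<theta>. complex_of_real (s\<^sup>2) * (complex_of_real (1 - \<theta>) * fourier f (s * \<theta>)))"
      by simp
    also have "\<dots> = B s"
    proof -
      have lin: "((\<lambda>\<theta>. s * \<theta>) has_vector_derivative s) (at \<theta>)" for \<theta>
        by (auto intro!: derivative_eq_intros simp: has_real_derivative_iff_has_vector_derivative[symmetric])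
      have dA: "((\<lambda>\<theta>. A (s * \<theta>)) has_vector_derivative s *\<^sub>R fourier f (s * \<theta>)) (at \<theta>)" for \<theta>
        using vector_diff_chain_at[OF lin A(2)] by (simp add: o_def)
      have dB: "((\<lambda>\<theta>. B (s * \<theta>)) has_vector_derivative s *\<^sub>R A (s * \<theta>)) (at \<theta>)" for \<theta>
        using vector_diff_chain_at[OF lin B(2)] by (simp add: o_def)
      have L: "((\<lambda>\<theta>. complex_of_real (s * (1 - \<theta>))) has_vector_derivative of_real (- s)) (at \<theta>)" for \<theta>
        by (rule has_vector_derivative_of_real) (auto intro!: derivative_eq_intros)
      \<comment> \<open>Differentiating the linear factor produces minus the derivative of the
        \<open>B\<close> term, so the two cancel and only the Taylor integrand remains. The
        normalisations at 0 remove the lower boundary value.\<close>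
      let ?P = "\<lambda>\<theta>. complex_of_real (s * (1 - \<theta>)) * A (s * \<theta>) + B (s * \<theta>)"
      have "(?P has_vector_derivative complex_of_real (s\<^sup>2) * (complex_of_real (1 - \<theta>) * fourier f (s * \<theta>))) (at \<theta>)" for \<theta>
        using has_vector_derivative_add[OF has_vector_derivative_mult[OF L dA] dB]
        by (simp add: scaleR_conv_of_real power2_eq_square algebra_simps)
      from has_vector_derivative_at_within[OF this]
      have "((\<lambda>\<theta>. complex_of_real (s\<^sup>2) * (complex_of_real (1 - \<theta>) * fourier f (s * \<theta>))) has_integral (?P 1 - ?P 0)) {0..1}"
        by (intro fundamental_theorem_of_calculus) auto
      from integral_unique[OF this] show ?thesis by (simp add: A B)
    qed
    finally show ?thesis .
  qed
  then have "Omega F = B" by (simp add: fun_eq_iff)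
  with A B show thesis by (intro that[of A]) auto
qed

section \<open>Density of test primitives in the supremum norm\<close>

definition clamp_primitive :: "(real \<Rightarrow> complex) \<Rightarrow> real \<Rightarrow> real \<Rightarrow> complex" where
  "clamp_primitive F R t = F (max (- R) (min R t)) - F (- R)"

lemma Bc_clamp_approx:
  assumes F: "Bc F" and "e > 0"
  obtains R where "R > 0" "\<And>t. norm (F t - clamp_primitive F R t) \<le> e"
proof -
  obtain l where l: "(F \<longlongrightarrow> l) at_top" and F0: "(F \<longlongrightarrow> 0) at_bot"
    using F unfolding Bc_def by blast
  have e: "e / 4 > 0" using \<open>e > 0\<close> by simp
  obtain b where b: "\<And>t. t \<ge> b \<Longrightarrow> dist (F t) l < e / 4"
    using tendstoD[OF l e] unfolding eventually_at_top_linorder by auto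
  obtain a where a: "\<And>t. t \<le> a \<Longrightarrow> dist (F t) 0 < e / 4"
    using tendstoD[OF F0 e] unfolding eventually_at_bot_linorder by auto
  define R where "R = \<bar>a\<bar> + \<bar>b\<bar> + 1"
  have R: "R > 0" "- R \<le> a" "b \<le> R" by (auto simp: R_def)
  have m: "norm (F (- R)) < e / 4" using a[OF R(2)] by simp
  have "norm (F t - clamp_primitive F R t) \<le> e" for t
  proof -
    consider "t \<le> - R" | "t \<ge> R" | "- R \<le> t" "t \<le> R" by linarith
    then show ?thesis
    proof cases
      case 1
      then have "max (- R) (min R t) = - R" by auto
      moreover have "norm (F t) < e / 4" using a[of t] 1 R by simp
      ultimately show ?thesis using e by (simp add: clamp_primitive_def)
    next
      case 2
      then have mm: "max (- R) (min R t) = R" using R by auto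
      have "norm (F t - l) < e / 4" "norm (F R - l) < e / 4"
        using b[of t] b[of R] 2 R by (auto simp: dist_norm)
      then have "norm ((F t - l) - (F R - l)) < e / 2"
        using norm_triangle_ineq4[of "F t - l" "F R - l"] by linarith
      then have "norm ((F t - F R) + F (- R)) < e"
        using norm_triangle_ineq[of "F t - F R" "F (- R)"] m e by simp
      then show ?thesis unfolding clamp_primitive_def mm by (simp add: algebra_simps)
    next
      case 3
      then have "max (- R) (min R t) = t" by auto
      then show ?thesis using m e by (simp add: clamp_primitive_def)
    qed
  qed
  with R show thesis using that by blast
qed

text \<open>Clamping the argument to \<open>{- R..R}\<close> does not increase distances, so uniform
  continuity on a compact interval carries over to the clamped function, which is uniformly close to
  \<open>F\<close>.\<close>

lemma Bc_uniformly_continuous: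
  assumes F: "Bc F" and "e > 0"
  obtains \<delta> where "\<delta> > 0" "\<And>x y. \<bar>x - y\<bar> < \<delta> \<Longrightarrow> norm (F x - F y) < e"
proof -
  have e: "e / 3 > 0" using \<open>e > 0\<close> by simp
  obtain R where R: "R > 0" "\<And>t. norm (F t - clamp_primitive F R t) \<le> e / 3"
    by (rule Bc_clamp_approx[OF F e]) blast
  have "uniformly_continuous_on {- R..R} F"
    using F by (intro compact_uniformly_continuous) (auto simp: Bc_def intro: continuous_on_subset)
  from this[unfolded uniformly_continuous_on_def, rule_format, OF e]
  obtain \<delta> where \<delta>: "\<delta> > 0" "\<forall>x\<in>{- R..R}. \<forall>x'\<in>{- R..R}. dist x' x < \<delta> \<longrightarrow> dist (F x') (F x) < e / 3"
    by blast
  have "norm (F x - F y) < e" if xy: "\<bar>x - y\<bar> < \<delta>" for x y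
  proof -
    let ?c = "\<lambda>t. max (- R) (min R t)"
    have "?c x \<in> {- R..R}" "?c y \<in> {- R..R}" using R(1) by auto
    moreover have "dist (?c x) (?c y) < \<delta>" using xy by (auto simp: dist_real_def max_def min_def)
    ultimately have "dist (F (?c x)) (F (?c y)) < e / 3" using \<delta>(2) by blast
    then have 1: "norm (clamp_primitive F R x - clamp_primitive F R y) < e / 3"
      by (simp add: clamp_primitive_def dist_norm)
    have "norm (F x - F y) \<le> norm (clamp_primitive F R x - clamp_primitive F R y) + norm (clamp_primitive F R x - F x) + norm (clamp_primitive F R y - F y)"
      by (rule norm_diff_le_via)
    also have "\<dots> < e / 3 + e / 3 + e / 3"
      using 1 R(2)[of x] R(2)[of y] by (intro add_less_le_mono) (simp_all add: norm_minus_commute)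
    finally show ?thesis by simp
  qed
  with \<delta>(1) show thesis using that by blast
qed

text \<open>Averaging the clamped primitive over windows of length \<open>\<eta>\<close> makes it
  continuously differentiable. The derivative is a difference quotient of \<open>F1\<close> and
  vanishes where \<open>F1\<close> is constant across the window, so its support is bounded. Uniform
  continuity at scale \<open>\<delta>\<close> bounds the change caused by averaging.\<close>

lemma Bc_test_primitive_approx:
  assumes F: "Bc F" and "e > 0"
  obtains G g where "test_primitive G g" "\<And>t. norm (F t - G t) \<le> e"
proof -
  have e: "e / 2 > 0" using \<open>e > 0\<close> by simp
  obtain R where R: "R > 0" "\<And>t. norm (F t - clamp_primitive F R t) \<le> e / 2"
    by (rule Bc_clamp_approx[OF F e]) blast
  obtain \<delta> where \<delta>: "\<delta> > 0" "\<And>x y. \<bar>x - y\<bar> < \<delta> \<Longrightarrow> norm (F x - F y) < e / 2"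
    by (rule Bc_uniformly_continuous[OF F e]) blast
  define F1 where "F1 = clamp_primitive F R"
  have F1c: "continuous_on UNIV F1"
  proof -
    have cF: "continuous_on UNIV F" using F by (simp add: Bc_def)
    have cm: "continuous_on UNIV (\<lambda>t. max (- R) (min R t))" by (intro continuous_intros)
    show ?thesis
      unfolding F1_def clamp_primitive_def
      by (rule continuous_on_diff[OF continuous_on_compose2[OF cF cm subset_UNIV] continuous_on_const])
  qed
  have F1l: "F1 t = 0" if "t \<le> - R" for t
    using that R by (simp add: F1_def clamp_primitive_def min_def max_def)
  have F1r: "F1 t = F1 R" if "R \<le> t" for t
    using that R by (simp add: F1_def clamp_primitive_def)
  have F1u: "norm (F1 x - F1 y) < e / 2" if "\<bar>x - y\<bar> < \<delta>" for x y
  proof -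
    have "\<bar>max (- R) (min R x) - max (- R) (min R y)\<bar> < \<delta>" using that by (auto simp: max_def min_def)
    from \<delta>(2)[OF this] show ?thesis by (simp add: F1_def clamp_primitive_def)
  qed
  obtain H where H: "\<And>t. (H has_vector_derivative F1 t) (at t)"
    by (rule continuous_antiderivative[OF F1c]) blast
  define \<eta> where "\<eta> = \<delta> / 2"
  have \<eta>: "\<eta> > 0" "\<eta> < \<delta>" using \<delta>(1) by (auto simp: \<eta>_def)
  \<comment> \<open>the moving average of \<open>F1\<close>\<close>
  define G where "G t = (H (t + \<eta>) - H t) / of_real \<eta>" for t
  define g where "g t = (F1 (t + \<eta>) - F1 t) / of_real \<eta>" for t
  have Hi: "(F1 has_integral (H (t + \<eta>) - H t)) {t..t + \<eta>}" for t
    using \<eta> by (intro fundamental_theorem_of_calculus has_vector_derivative_at_within[OF H]) auto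
  have "test_primitive G g"
    unfolding test_primitive_def
  proof (intro conjI allI exI[of _ "R + \<eta>"] impI)
    show "continuous_on UNIV g"
      unfolding g_def using \<eta>
      by (intro continuous_intros F1c continuous_on_compose2[OF F1c]) auto
    fix t
    have "((\<lambda>t. t + \<eta>) has_vector_derivative 1) (at t)"
      by (auto intro!: derivative_eq_intros simp: has_real_derivative_iff_has_vector_derivative[symmetric])
    from vector_diff_chain_at[OF this H]
    have "((\<lambda>t. H (t + \<eta>)) has_vector_derivative F1 (t + \<eta>)) (at t)" by (simp add: o_def)
    then show "(G has_vector_derivative g t) (at t)"
      unfolding G_def g_def by (intro has_vector_derivative_divide has_vector_derivative_diff H)
    show "g t = 0" if "R + \<eta> \<le> \<bar>t\<bar>"
    proof (cases "t \<ge> 0")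
      case True
      then show ?thesis using F1r[of t] F1r[of "t + \<eta>"] that \<eta> by (simp add: g_def)
    next
      case False
      then show ?thesis using F1l[of t] F1l[of "t + \<eta>"] that \<eta> by (simp add: g_def)
    qed
    show "G t = 0" if "t \<le> - (R + \<eta>)"
    proof -
      have "(F1 has_integral 0) {t..t + \<eta>}"
        using that F1l by (intro has_integral_is_0) auto
      with Hi[of t] have "H (t + \<eta>) - H t = 0" by (rule has_integral_unique)
      then show ?thesis by (simp add: G_def)
    qed
  qed
  moreover have "norm (F t - G t) \<le> e" for t
  proof -
    have "((\<lambda>y. F1 y - F1 t) has_integral (H (t + \<eta>) - H t - measure lborel {t..t + \<eta>} *\<^sub>R F1 t)) {t..t + \<eta>}"
      by (intro has_integral_diff Hi has_integral_const_real)
    then have "norm (H (t + \<eta>) - H t - measure lborel {t..t + \<eta>} *\<^sub>R F1 t) \<le> (e / 2) * measure lborel {t..t + \<eta>}"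
    proof (rule has_integral_bound_real[where S="{}", rotated 2])
      show "norm (F1 y - F1 t) \<le> e / 2" if "y \<in> {t..t + \<eta>} - {}" for y
        using F1u[of y t] that \<eta> by auto
    qed (use e in auto)
    then have 1: "norm (H (t + \<eta>) - H t - of_real \<eta> * F1 t) \<le> (e / 2) * \<eta>"
      using \<eta> by (simp add: scaleR_conv_of_real)
    have "G t - F1 t = (H (t + \<eta>) - H t - of_real \<eta> * F1 t) / of_real \<eta>"
      using \<eta> by (simp add: G_def field_simps)
    then have "norm (G t - F1 t) \<le> e / 2"
      using 1 \<eta> by (simp add: norm_divide divide_le_eq)
    then show ?thesis
      using R(2)[of t] norm_triangle_ineq4[of "F t - F1 t" "G t - F1 t"] by (simp add: F1_def)
  qed
  ultimately show thesis using that by blast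
qed

subsection \<open>Absolutely continuous functions and improper Stieltjes limits\<close>

text \<open>On the compact interval \<open>p\<close> is bounded by \<open>P\<close> and Lipschitz
  with constant \<open>L\<close>. Each increment of the product costs \<open>P\<close> times an
  increment of \<open>k\<close> plus \<open>L * K\<close> times a length, and \<open>d\<close> gives
  each part half of \<open>e\<close>.\<close>

lemma abs_cont_on_mult_C1:
  fixes p k :: "real \<Rightarrow> complex"
  assumes ac: "abs_cont_on {a..b} k" and k: "\<And>t. norm (k t) \<le> K"
    and p: "\<And>t. (p has_vector_derivative p' t) (at t)" "continuous_on UNIV p'"
  shows "abs_cont_on {a..b} (\<lambda>t. p t * k t)"
proof -
  have cp: "continuous_on UNIV p"
    by (intro continuous_at_imp_continuous_on ballI has_vector_derivative_continuous[OF p(1)])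
  have "compact (p ` {a..b})" "compact (p' ` {a..b})"
    by (intro compact_continuous_image continuous_on_subset[OF cp] continuous_on_subset[OF p(2)]; simp)+
  then have bd: "bounded (p ` {a..b})" "bounded (p' ` {a..b})" by (auto intro: compact_imp_bounded)
  obtain P where P: "P > 0" "\<forall>y\<in>p ` {a..b}. norm y \<le> P"
    using bd(1) unfolding bounded_pos by blast
  obtain L where L: "L > 0" "\<forall>y\<in>p' ` {a..b}. norm y \<le> L"
    using bd(2) unfolding bounded_pos by blast
  have K: "K \<ge> 0" using k[of 0] norm_ge_zero order.trans by blast
  have lip: "norm (p y - p x) \<le> L * (y - x)" if "{x..y} \<subseteq> {a..b}" "x \<le> y" for x y
  proof -
    have "(p' has_integral (p y - p x)) {x..y}"
      using that by (intro fundamental_theorem_of_calculus has_vector_derivative_at_within[OF p(1)])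
    then have "norm (p y - p x) \<le> L * measure lborel {x..y}"
      by (rule has_integral_bound_real[where S="{}", rotated 2]) (use L that in auto)
    then show ?thesis using that by simp
  qed
  show ?thesis
    unfolding abs_cont_on_def
  proof (intro allI impI)
    fix e :: real assume "e > 0"
    then have "e / (2 * P) > 0" using P by simp
    then obtain \<delta> where \<delta>: "\<delta> > 0" "\<forall>(n::nat) (x::nat \<Rightarrow> real) y.
        (\<forall>i<n. x i \<le> y i \<and> {x i..y i} \<subseteq> {a..b}) \<and>
        (\<forall>i<n. \<forall>j<n. i \<noteq> j \<longrightarrow> y i \<le> x j \<or> y j \<le> x i) \<and>
        (\<Sum>i<n. y i - x i) < \<delta> \<longrightarrow> (\<Sum>i<n. norm (k (y i) - k (x i))) < e / (2 * P)"
      using ac unfolding abs_cont_on_def by blast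
    have LK: "L * K + 1 > 0" using L K by (simp add: add_nonneg_pos)
    define d where "d = min \<delta> (e / (2 * (L * K + 1)))"
    show "\<exists>d>0. \<forall>(n::nat) (x::nat \<Rightarrow> real) y.
        (\<forall>i<n. x i \<le> y i \<and> {x i..y i} \<subseteq> {a..b}) \<and>
        (\<forall>i<n. \<forall>j<n. i \<noteq> j \<longrightarrow> y i \<le> x j \<or> y j \<le> x i) \<and>
        (\<Sum>i<n. y i - x i) < d \<longrightarrow> (\<Sum>i<n. norm (p (y i) * k (y i) - p (x i) * k (x i))) < e"
    proof (intro exI[of _ d] conjI allI impI)
      show "d > 0" using \<delta>(1) \<open>e > 0\<close> LK by (simp add: d_def)
      fix n :: nat and x y :: "nat \<Rightarrow> real"
      assume A: "(\<forall>i<n. x i \<le> y i \<and> {x i..y i} \<subseteq> {a..b}) \<and>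
        (\<forall>i<n. \<forall>j<n. i \<noteq> j \<longrightarrow> y i \<le> x j \<or> y j \<le> x i) \<and> (\<Sum>i<n. y i - x i) < d"
      then have 1: "(\<Sum>i<n. norm (k (y i) - k (x i))) < e / (2 * P)"
        using \<delta>(2)[rule_format, of n x y] by (simp add: d_def)
      have "(\<Sum>i<n. norm (p (y i) * k (y i) - p (x i) * k (x i))) \<le> (\<Sum>i<n. P * norm (k (y i) - k (x i)) + L * K * (y i - x i))"
      proof (rule sum_mono)
        fix i assume "i \<in> {..<n}"
        then have i: "x i \<le> y i" "{x i..y i} \<subseteq> {a..b}" using A by auto
        then have yi: "y i \<in> {a..b}" by auto
        have "p (y i) * k (y i) - p (x i) * k (x i) = p (y i) * (k (y i) - k (x i)) + (p (y i) - p (x i)) * k (x i)"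
          by (simp add: algebra_simps)
        also have "norm \<dots> \<le> norm (p (y i)) * norm (k (y i) - k (x i)) + norm (p (y i) - p (x i)) * norm (k (x i))"
          by (rule order.trans[OF norm_triangle_ineq]) (simp add: norm_mult)
        also have "\<dots> \<le> P * norm (k (y i) - k (x i)) + (L * (y i - x i)) * K"
          using P L i yi k by (intro add_mono mult_mono lip) auto
        finally show "norm (p (y i) * k (y i) - p (x i) * k (x i)) \<le> P * norm (k (y i) - k (x i)) + L * K * (y i - x i)"
          by (simp add: mult_ac)
      qed
      also have "\<dots> = P * (\<Sum>i<n. norm (k (y i) - k (x i))) + L * K * (\<Sum>i<n. y i - x i)"
        by (simp add: sum.distrib sum_distrib_left)
      also have "\<dots> < e"
      proof -
        have "P * (\<Sum>i<n. norm (k (y i) - k (x i))) < P * (e / (2 * P))"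
          using 1 P by (intro mult_strict_left_mono) auto
        also have "\<dots> = e / 2" using P by simp
        finally have a: "P * (\<Sum>i<n. norm (k (y i) - k (x i))) < e / 2" .
        have s0: "0 \<le> (\<Sum>i<n. y i - x i)" using A by (intro sum_nonneg) auto
        have "L * K * (\<Sum>i<n. y i - x i) \<le> (L * K + 1) * (\<Sum>i<n. y i - x i)"
          using s0 by (intro mult_right_mono) auto
        also have "\<dots> \<le> (L * K + 1) * (e / (2 * (L * K + 1)))"
          using A LK by (intro mult_left_mono) (auto simp: d_def)
        also have "\<dots> = e / 2"
        proof -
          have "c * (e / (2 * c)) = e / 2" if "c > 0" for c :: real using that by simp
          from this[OF LK] show ?thesis .
        qed
        finally show ?thesis using a by linarith
      qed
      finally show "(\<Sum>i<n. norm (p (y i) * k (y i) - p (x i) * k (x i))) < e" .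
    qed
  qed
qed

text \<open>On an interval shorter than the \<open>\<delta>\<close> belonging to tolerance 1, the
  increments of \<open>k\<close> over any division sum to less than 1. The indefinite integral of
  \<open>k'\<close> thus has bounded variation, which makes a gauge integrable function absolutely
  integrable. This is used near 0, where the weight s^2 gives no information about the
  derivative.\<close>

lemma abs_cont_locally_absolutely_integrable:
  assumes ac: "abs_cont_on {-1..1} k"
    and k': "\<And>a b. a \<le> b \<Longrightarrow> (k' has_integral (k b - k a)) {a..b}"
  obtains r where "r > 0" "r \<le> 1" "k' absolutely_integrable_on {-r..r::real}"
proof -
  obtain \<delta> where \<delta>: "\<delta> > 0" "\<forall>(n::nat) (x::nat \<Rightarrow> real) y.
      (\<forall>i<n. x i \<le> y i \<and> {x i..y i} \<subseteq> {-1..1}) \<and>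
      (\<forall>i<n. \<forall>j<n. i \<noteq> j \<longrightarrow> y i \<le> x j \<or> y j \<le> x i) \<and>
      (\<Sum>i<n. y i - x i) < \<delta> \<longrightarrow> (\<Sum>i<n. norm (k (y i) - k (x i))) < 1"
    using ac zero_less_one unfolding abs_cont_on_def by blast
  \<comment> \<open>The interval has length \<open>2 * r\<close>, hence \<open>\<delta> / 3\<close>;
    the bound 1 keeps it inside the interval on which \<open>k\<close> is known to be absolutely
    continuous.\<close>
  define r where "r = min 1 (\<delta> / 3)"
  have r: "r > 0" "r \<le> 1" "2 * r < \<delta>" using \<delta>(1) by (auto simp: r_def)
  have "k' absolutely_integrable_on cbox (- r) r"
  proof (rule bounded_variation_absolutely_integrable_interval[where B=1])
    show "k' integrable_on cbox (- r) r" using k'[of "- r" r] r by auto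
    fix d assume d: "d division_of cbox (- r) r"
    define E where "E = {K \<in> d. Inf K < Sup K}"
    have finE: "finite E" using d by (auto simp: E_def)
    have form: "\<exists>u v. K = {u..v} \<and> u \<le> v \<and> - r \<le> u \<and> v \<le> r" if K: "K \<in> d" for K
    proof -
      obtain u v where uv: "K = cbox u v" using division_ofD(4)[OF d K] by blast
      have "K \<noteq> {}" "K \<subseteq> cbox (- r) r" using division_ofD(2,3)[OF d K] by auto
      then show ?thesis using uv by auto
    qed
    obtain q where q: "bij_betw q {..<card E} E"
      using ex_bij_betw_nat_finite[OF finE] by (auto simp: atLeast0LessThan)
    have qE: "q i \<in> E" if "i < card E" for i
      using q that by (auto simp: bij_betw_def)
    have "(\<Sum>K\<in>d. norm (integral K k')) = (\<Sum>K\<in>d. norm (k (Sup K) - k (Inf K)))"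
    proof (rule sum.cong[OF refl])
      fix K assume "K \<in> d"
      then obtain u v where "K = {u..v}" "u \<le> v" using form by blast
      then show "norm (integral K k') = norm (k (Sup K) - k (Inf K))"
        using integral_unique[OF k'[of u v]] by simp
    qed
    also have "\<dots> = (\<Sum>K\<in>E. norm (k (Sup K) - k (Inf K)))"
    proof (rule sum.mono_neutral_right)
      show "finite d" using d by auto
      show "\<forall>K\<in>d - E. norm (k (Sup K) - k (Inf K)) = 0"
        using form by (fastforce simp: E_def)
    qed (auto simp: E_def)
    also have "\<dots> = (\<Sum>i<card E. norm (k (Sup (q i)) - k (Inf (q i))))"
      by (rule sum.reindex_bij_betw[OF q, symmetric])
    also have "\<dots> < 1"
    proof (rule \<delta>(2)[rule_format], intro conjI allI impI)
      fix i assume "i < card E"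
      then obtain u v where "q i = {u..v}" "u \<le> v" "- r \<le> u" "v \<le> r" using form[of "q i"] qE[of i] by (auto simp: E_def)
      then show "Inf (q i) \<le> Sup (q i)" "{Inf (q i)..Sup (q i)} \<subseteq> {-1..1}" using r by auto
    next
      fix i j assume ij: "i < card E" "j < card E" "i \<noteq> j"
      obtain u v where 1: "q i = {u..v}" "u < v" using form[of "q i"] qE[OF ij(1)] by (auto simp: E_def)
      obtain u' v' where 2: "q j = {u'..v'}" "u' < v'" using form[of "q j"] qE[OF ij(2)] by (auto simp: E_def)
      have "q i \<noteq> q j" using ij q unfolding bij_betw_def inj_on_def by auto
      then have "interior {u..v} \<inter> interior {u'..v'} = {}"
        using division_ofD(5)[OF d, of "q i" "q j"] qE[OF ij(1)] qE[OF ij(2)] 1 2 by (auto simp: E_def)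
      then have "{max u u'<..<min v v'} = {}" by (auto simp: set_eq_iff)
      then have "v \<le> u' \<or> v' \<le> u" using 1(2) 2(2) by (auto simp: greaterThanLessThan_empty_iff)
      then show "Sup (q i) \<le> Inf (q j) \<or> Sup (q j) \<le> Inf (q i)" using 1 2 by auto
    next
      have "(\<Sum>i<card E. Sup (q i) - Inf (q i)) = (\<Sum>K\<in>E. Sup K - Inf K)"
        by (rule sum.reindex_bij_betw[OF q])
      also have "\<dots> \<le> (\<Sum>K\<in>d. measure lborel K)"
      proof -
        have "(\<Sum>K\<in>E. Sup K - Inf K) = (\<Sum>K\<in>E. measure lborel K)"
          using form by (intro sum.cong) (fastforce simp: E_def)+
        also have "\<dots> \<le> (\<Sum>K\<in>d. measure lborel K)"
          using d by (intro sum_mono2) (auto simp: E_def)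
        finally show ?thesis .
      qed
      also have "\<dots> = measure lborel (cbox (- r) r)" by (rule additive_content_division[OF d])
      also have "\<dots> < \<delta>" using r by simp
      finally show "(\<Sum>i<card E. Sup (q i) - Inf (q i)) < \<delta>" .
    qed
    finally show "(\<Sum>K\<in>d. norm (integral K k')) \<le> 1" by simp
  qed
  then show thesis using r by (intro that[of r]) auto
qed

text \<open>The majorant is the integral of |w| over the half-line up to the given point.\<close>

lemma integrable_majorant:
  fixes w :: "real \<Rightarrow> complex"
  assumes w: "integrable lborel w" and W: "\<And>x y. x \<le> y \<Longrightarrow> (w has_integral (P y - P x)) {x..y}"
  obtains V M where "\<And>x y. x \<le> y \<Longrightarrow> norm (P y - P x) \<le> V y - V x" "\<And>x. \<bar>V x\<bar> \<le> (M::real)"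
proof -
  define q where "q s = norm (w s)" for s
  have q: "integrable lborel q" using w unfolding q_def by simp
  have qU: "q integrable_on UNIV" by (rule integrable_on_lborel[OF q])
  have qb: "q integrable_on {x..y}" for x y
    using integrable_on_subinterval[OF qU, of x y] by simp
  have qt: "q integrable_on {..t}" for t
  proof (rule set_borel_integral_eq_integral(1))
    show "set_integrable lborel {..t} q"
      unfolding set_integrable_def using q by (intro integrable_mult_indicator) auto
  qed
  define V where "V t = integral {..t} q" for t
  have "norm (P y - P x) \<le> V y - V x" if xy: "x \<le> y" for x y
  proof -
    have "(q has_integral (integral {..x} q + integral {x..y} q)) ({..x} \<union> {x..y})"
    proof (rule has_integral_Un[OF integrable_integral[OF qt] integrable_integral[OF qb]])
      have "{..x} \<inter> {x..y} \<subseteq> {x}" by auto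
      then show "negligible ({..x} \<inter> {x..y})" using negligible_subset negligible_sing by blast
    qed
    moreover have "{..x} \<union> {x..y} = {..y}" using xy by auto
    ultimately have "V y = V x + integral {x..y} q" unfolding V_def by (simp add: integral_unique)
    moreover have "norm (P y - P x) \<le> integral {x..y} q"
      using integral_norm_bound_integral[of w "{x..y}" q] W[OF xy] qb[of x y] integral_unique[OF W[OF xy]]
      by (auto simp: q_def has_integral_integrable)
    ultimately show ?thesis by simp
  qed
  moreover have "\<bar>V t\<bar> \<le> integral UNIV q" for t
  proof -
    have "0 \<le> V t" unfolding V_def using qt by (intro integral_nonneg) (auto simp: q_def)
    moreover have "V t \<le> integral UNIV q" unfolding V_def using qt qU by (intro integral_subset_le) (auto simp: q_def)
    ultimately show ?thesis by simp
  qed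
  ultimately show thesis using that by blast
qed

section \<open>Limits of improper Stieltjes integrals\<close>

text \<open>The constant \<open>M\<close> serves all intervals at once, so the error
  \<open>c n * M\<close> is uniform in the endpoints and the limit in \<open>n\<close> may be
  interchanged with the limit at both infinities.\<close>

lemma rs_improper_has_integral_limit:
  assumes I: "\<And>n::nat. rs_improper_has_integral (Q n) g (I n)"
    and W: "\<And>a b. a \<le> b \<Longrightarrow> weighted_var_le g a b M"
    and c: "\<And>n s. norm (P s - Q n s) \<le> c n * s\<^sup>2" "\<And>n. 0 \<le> c n" "c \<longlonglongrightarrow> 0"
  obtains T where "rs_improper_has_integral P g T" "\<And>n. norm (T - I n) \<le> c n * M"
proof -
  define J where "J n p = rs_integral (Q n) g (fst p) (snd p)" for n p
  have rsQ: "rs_has_integral (Q n) g (J n (a,b)) a b" if "a \<le> b" for n a b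
    using I[of n] that rs_integral_eq unfolding rs_improper_has_integral_def J_def by fastforce
  have JI: "(J n \<longlongrightarrow> I n) (at_bot \<times>\<^sub>F at_top)" for n
    using I[of n] unfolding rs_improper_has_integral_def J_def by (simp add: split_beta')
  have exL: "\<exists>L. rs_has_integral P g L a b \<and> (\<forall>n. norm (L - J n (a,b)) \<le> c n * M)" if "a \<le> b" for a b
    by (rule rs_has_integral_limit[OF rsQ[OF that] W[OF that] c]) blast
  have rsP: "rs_has_integral P g (rs_integral P g a b) a b" "norm (rs_integral P g a b - J n (a,b)) \<le> c n * M" if "a \<le> b" for n a b
    using exL[OF that] rs_integral_eq by auto
  have ev: "\<forall>\<^sub>F p in at_bot \<times>\<^sub>F at_top. fst p \<le> (snd p :: real)"
  proof -
    have "\<forall>\<^sub>F p in at_bot \<times>\<^sub>F at_top. fst p \<le> (0::real) \<and> (0::real) \<le> snd p"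
      by (intro eventually_prodI eventually_le_at_bot eventually_ge_at_top)
    then show ?thesis by eventually_elim auto
  qed
  have diff: "norm (I m - I n) \<le> c m * M + c n * M" for m n
  proof (rule tendsto_upperbound[OF tendsto_norm[OF tendsto_diff[OF JI[of m] JI[of n]]] _ at_bot_times_at_top_neq_bot])
    show "\<forall>\<^sub>F p in at_bot \<times>\<^sub>F at_top. norm (J m p - J n p) \<le> c m * M + c n * M"
      using ev
    proof eventually_elim
      case (elim p)
      then show ?case
        using rsP(2)[OF elim, of m] rsP(2)[OF elim, of n]
          norm_triangle_ineq4[of "rs_integral P g (fst p) (snd p) - J n p" "rs_integral P g (fst p) (snd p) - J m p"]
        by simp
    qed
  qed
  have cM: "(\<lambda>n. c n * M) \<longlonglongrightarrow> 0" using tendsto_mult_left_zero[OF c(3)] .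
  obtain T where TI: "\<And>n. norm (T - I n) \<le> c n * M"
    by (rule Cauchy_rate_limit[OF diff cM]) blast
  have "rs_improper_has_integral P g T"
    unfolding rs_improper_has_integral_def
  proof (intro conjI allI impI)
    show "\<exists>J. rs_has_integral P g J a b" if "a \<le> b" for a b using rsP(1)[OF that] by blast
    show "((\<lambda>(a,b). rs_integral P g a b) \<longlongrightarrow> T) (at_bot \<times>\<^sub>F at_top)"
    proof (rule tendstoI)
      fix e :: real assume "e > 0"
      then obtain n where n: "norm (c n * M) < e / 3"
        using LIMSEQ_D[OF cM, of "e/3"] by auto
      have "\<forall>\<^sub>F p in at_bot \<times>\<^sub>F at_top. dist (J n p) (I n) < e / 3"
        using \<open>e > 0\<close> by (intro tendstoD[OF JI]) simp
      with ev show "\<forall>\<^sub>F p in at_bot \<times>\<^sub>F at_top. dist (case p of (a,b) \<Rightarrow> rs_integral P g a b) T < e"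
      proof eventually_elim
        case (elim p)
        have 1: "norm (rs_integral P g (fst p) (snd p) - J n p) \<le> c n * M" using rsP(2)[OF elim(1), of n] by simp
        have 2: "norm (J n p - I n) < e / 3" using elim(2) by (simp add: dist_norm)
        have "norm (rs_integral P g (fst p) (snd p) - T) \<le> norm (J n p - I n) + norm (J n p - rs_integral P g (fst p) (snd p)) + norm (I n - T)"
          by (rule norm_diff_le_via)
        also have "\<dots> < e"
          using 1 2 TI[of n] n[unfolded real_norm_def] abs_ge_self[of "c n * M"]
            norm_minus_commute[of "J n p" "rs_integral P g (fst p) (snd p)"] norm_minus_commute[of "I n" T] by linarith
        finally show ?case by (simp add: split_beta dist_norm)
      qed
    qed
  qed
  with TI show thesis using that by blast
qed

subsection \<open>Summability kernels\<close>

lemma abs_le_1_plus_sq: "\<bar>s\<bar> \<le> 1 + s\<^sup>2" for s :: real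
  using zero_le_power2[of "\<bar>s\<bar> - 1"] by (simp add: power2_diff)

text \<open>The weight |s| lies below 1 + s^2. Such products arise when s^2 k is differentiated and
  when s^2 meets the density 10 / |s|.\<close>

lemma integrable_times_ident:
  fixes h :: "real \<Rightarrow> complex"
  assumes "integrable lborel h" "integrable lborel (\<lambda>s. complex_of_real (s^2) * h s)"
  shows "integrable lborel (\<lambda>s. complex_of_real s * h s)"
proof (rule Bochner_Integration.integrable_bound)
  have [measurable]: "h \<in> borel_measurable borel" using assms(1) by auto
  show "integrable lborel (\<lambda>s. norm (h s) + norm (complex_of_real (s^2) * h s))"
    using assms by (intro Bochner_Integration.integrable_add integrable_norm)
  have "\<bar>s\<bar> * norm (h s) \<le> norm (h s) + s\<^sup>2 * norm (h s)" for s
    using mult_right_mono[OF abs_le_1_plus_sq[of s] norm_ge_zero[of "h s"]] by (simp add: distrib_right)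
  then show "AE s in lborel. norm (complex_of_real s * h s) \<le> norm (norm (h s) + norm (complex_of_real (s^2) * h s))"
    by (intro AE_I2) (simp add: norm_mult norm_power)
  show "(\<lambda>s. complex_of_real s * h s) \<in> borel_measurable lborel" by measurable
qed

text \<open>These hypotheses are stable under the dilation from \<open>\<psi>\<close> to
  \<open>psi_a \<psi> a\<close>, so that everything can be proved at a = 1 and transferred by
  interpretation.\<close>

locale summability_kernel =
  fixes \<psi> dpsi :: "real \<Rightarrow> complex"
  assumes psi_L1: "integrable lborel \<psi>"
    and psihat_ac: "\<And>a b. abs_cont_on {a..b} (fourier \<psi>)"
    and dpsi: "AE s in lborel. (fourier \<psi> has_vector_derivative dpsi s) (at s)"
    and p2_psihat: "integrable lborel (\<lambda>s. complex_of_real (s^2) * fourier \<psi> s)"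
    and p2_dpsi_L1: "integrable lborel (\<lambda>s. complex_of_real (s^2) * dpsi s)"
    and p2_dpsi_BV: "bv_on_R (\<lambda>s. complex_of_real (s^2) * dpsi s)"
begin

abbreviation "k \<equiv> fourier \<psi>"

definition "K0 = (LINT t|lborel. norm (\<psi> t))"

lemma k_le: "norm (k s) \<le> K0"
  unfolding K0_def by (rule norm_fourier_le[OF psi_L1])

lemma k_cont: "continuous_on UNIV k"
  by (rule continuous_on_fourier[OF psi_L1])

lemma k_meas[measurable]: "k \<in> borel_measurable borel"
  by (rule borel_measurable_continuous_onI[OF k_cont])

lemma dpsi_meas[measurable]: "dpsi \<in> borel_measurable borel"
proof -
  let ?h = "\<lambda>s. complex_of_real (s^2) * dpsi s"
  have [measurable]: "?h \<in> borel_measurable borel" using p2_dpsi_L1 by auto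
  \<comment> \<open>Division by s^2 recovers \<open>dpsi\<close> everywhere except at 0; the value
    there is inserted by hand.\<close>
  have "(\<lambda>s. if s = 0 then dpsi 0 else ?h s / complex_of_real (s^2)) \<in> borel_measurable borel"
    by measurable
  moreover have "(\<lambda>s. if s = 0 then dpsi 0 else ?h s / complex_of_real (s^2)) = dpsi"
    by (auto simp: fun_eq_iff)
  ultimately show ?thesis by simp
qed

text \<open>The product is absolutely continuous on compact intervals and has the product-rule
  derivative almost everywhere. The formula is applied to 1, to s^2 and to the product of an
  antiderivative of \<open>fourier f\<close> with the exponential.\<close>

lemma C1_mult_FTC:
  assumes p: "\<And>t. (p has_vector_derivative p' t) (at t)" "continuous_on UNIV p'" and "a \<le> b"
  shows "((\<lambda>s. p s * dpsi s + p' s * k s) has_integral (p b * k b - p a * k a)) {a..b}"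
proof -
  obtain N where N: "N \<in> null_sets lborel" "{s. \<not> (k has_vector_derivative dpsi s) (at s)} \<subseteq> N"
    using dpsi by (auto elim: AE_E simp: null_sets_def)
  have "negligible N"
    using N(1) by (simp add: negligible_iff_null_sets null_sets_completionI)
  then show ?thesis
  proof (rule abs_cont_FTC[OF abs_cont_on_mult_C1[OF psihat_ac k_le p] \<open>a \<le> b\<close>])
    fix t assume "t \<in> {a..b} - N"
    then have "(k has_vector_derivative dpsi t) (at t)" using N(2) by auto
    from has_vector_derivative_mult[OF p(1) this]
    show "((\<lambda>t. p t * k t) has_vector_derivative p t * dpsi t + p' t * k t) (at t)" .
  qed
qed

lemma k_FTC: "a \<le> b \<Longrightarrow> (dpsi has_integral (k b - k a)) {a..b}"
  using C1_mult_FTC[of "\<lambda>_. 1" "\<lambda>_. 0" a b] by (simp add: has_vector_derivative_const)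

lemma k_integrable: "integrable lborel k"
proof (rule Bochner_Integration.integrable_bound)
  show "integrable lborel (\<lambda>s. K0 * indicator {-1..1} s + norm (complex_of_real (s^2) * k s))"
    using p2_psihat by (intro Bochner_Integration.integrable_add integrable_norm integrable_mult_right) auto
  have "norm (k s) \<le> K0 * indicator {-1..1} s + s\<^sup>2 * norm (k s)" for s
  proof (cases "s \<in> {-1..1}")
    case True
    then show ?thesis using k_le[of s] by (simp add: add_increasing2)
  next
    case False
    then have "1 \<le> s\<^sup>2" using abs_le_square_iff[of 1 s] by auto
    then have "1 * norm (k s) \<le> s\<^sup>2 * norm (k s)" by (intro mult_right_mono) auto
    then show ?thesis using False by simp
  qed
  then show "AE s in lborel. norm (k s) \<le> norm (K0 * indicator {-1..1} s + norm (complex_of_real (s^2) * k s))"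
    by (intro AE_I2) (simp add: norm_mult norm_power order.trans[OF _ abs_ge_self])
qed measurable

text \<open>Outside a neighbourhood of 0 the weight s^2 is bounded below by \<open>r\<^sup>2\<close>
  and can be divided out; inside, local absolute integrability of the derivative takes over.\<close>

lemma dpsi_integrable: "integrable lborel dpsi"
proof -
  obtain r where r: "r > 0" "r \<le> 1" "dpsi absolutely_integrable_on {-r..r}"
    by (rule abs_cont_locally_absolutely_integrable[OF psihat_ac k_FTC]) blast
  have near: "integrable lborel (\<lambda>s. indicator {-r..r} s *\<^sub>R dpsi s)"
    using r(3) unfolding set_integrable_def by (subst (asm) integrable_completion) auto
  show ?thesis
  proof (rule Bochner_Integration.integrable_bound)
    show "integrable lborel (\<lambda>s. norm (indicator {-r..r} s *\<^sub>R dpsi s) + norm (complex_of_real (s^2) * dpsi s) / r\<^sup>2)"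
      using near p2_dpsi_L1 by (intro Bochner_Integration.integrable_add integrable_norm integrable_divide)
    have "norm (dpsi s) \<le> indicator {-r..r} s * norm (dpsi s) + s\<^sup>2 * norm (dpsi s) / r\<^sup>2" for s
    proof (cases "s \<in> {-r..r}")
      case True
      then show ?thesis by simp
    next
      case False
      then have "\<bar>r\<bar> \<le> \<bar>s\<bar>" using r by auto
      then have "r\<^sup>2 \<le> s\<^sup>2" by (simp only: abs_le_square_iff)
      then have "r\<^sup>2 * norm (dpsi s) \<le> s\<^sup>2 * norm (dpsi s)" by (intro mult_right_mono) auto
      then show ?thesis using False r(1) by (simp add: pos_le_divide_eq mult.commute)
    qed
    then show "AE s in lborel. norm (dpsi s) \<le> norm (norm (indicator {-r..r} s *\<^sub>R dpsi s) + norm (complex_of_real (s^2) * dpsi s) / r\<^sup>2)"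
      by (intro AE_I2) (simp add: norm_mult norm_power order.trans[OF _ abs_ge_self])
  qed measurable
qed

text \<open>\<open>ker\<close> is \<open>dphi_ker\<close> at \<open>a = 1\<close>; \<open>wker\<close> is \<open>s\<^sup>2 ker\<close> without the oscillating factor,
  which is not of bounded variation on the line.\<close>

definition "ker x s = exp (\<i> * complex_of_real (x * s)) * (\<i> * complex_of_real x * k s + dpsi s)"

definition "wker x s = complex_of_real (s\<^sup>2) * (\<i> * complex_of_real x * k s + dpsi s)"

definition "wbound X s = X * norm (complex_of_real (s\<^sup>2) * k s) + norm (complex_of_real (s\<^sup>2) * dpsi s)"

lemma ker_eq: "s \<noteq> 0 \<Longrightarrow> ker x s = exp (\<i> * complex_of_real (x * s)) * wker x s / complex_of_real (s\<^sup>2)"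
  by (simp add: ker_def wker_def)

lemma wker_le: "\<bar>x\<bar> \<le> X \<Longrightarrow> norm (wker x s) \<le> wbound X s"
proof -
  assume "\<bar>x\<bar> \<le> X"
  have "wker x s = \<i> * complex_of_real x * (complex_of_real (s\<^sup>2) * k s) + complex_of_real (s\<^sup>2) * dpsi s"
    by (simp add: wker_def algebra_simps)
  also have "norm \<dots> \<le> \<bar>x\<bar> * norm (complex_of_real (s\<^sup>2) * k s) + norm (complex_of_real (s\<^sup>2) * dpsi s)"
    by (rule order.trans[OF norm_triangle_ineq]) (simp add: norm_mult)
  also have "\<dots> \<le> wbound X s"
    unfolding wbound_def using \<open>\<bar>x\<bar> \<le> X\<close> by (intro add_right_mono mult_right_mono) auto
  finally show ?thesis .
qed

lemma sq_k_FTC: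
  "a \<le> b \<Longrightarrow> ((\<lambda>s. complex_of_real (s\<^sup>2) * dpsi s + complex_of_real (2 * s) * k s) has_integral
     (complex_of_real (b\<^sup>2) * k b - complex_of_real (a\<^sup>2) * k a)) {a..b}"
proof (rule C1_mult_FTC)
  show "((\<lambda>s. complex_of_real (s\<^sup>2)) has_vector_derivative complex_of_real (2 * t)) (at t)" for t
    by (rule has_vector_derivative_of_real) (auto intro!: derivative_eq_intros)
qed (intro continuous_intros)

text \<open>For s^2 \<open>dpsi\<close> bounded variation is a hypothesis. For s^2 \<open>k\<close>
  it follows from integrability of its derivative, in which the middle term 2 s \<open>k\<close> is
  controlled by interpolation between \<open>k\<close> and s^2 \<open>k\<close>.\<close>

lemma majorants:
  obtains V1 V2 M where "\<And>x y. x \<le> y \<Longrightarrow> norm (complex_of_real (y\<^sup>2) * dpsi y - complex_of_real (x\<^sup>2) * dpsi x) \<le> V1 y - V1 x"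
    "\<And>x y. x \<le> y \<Longrightarrow> norm (complex_of_real (y\<^sup>2) * k y - complex_of_real (x\<^sup>2) * k x) \<le> V2 y - V2 x"
    "\<And>x. \<bar>V1 x\<bar> \<le> M" "\<And>x. \<bar>V2 x\<bar> \<le> (M::real)"
proof -
  obtain V1 M1 where 1: "\<And>x y. x \<le> y \<Longrightarrow> norm (complex_of_real (y\<^sup>2) * dpsi y - complex_of_real (x\<^sup>2) * dpsi x) \<le> V1 y - V1 x" "\<And>x. \<bar>V1 x\<bar> \<le> (M1::real)"
    by (rule bv_on_R_majorant[OF p2_dpsi_BV]) blast
  have w: "integrable lborel (\<lambda>s. complex_of_real (s\<^sup>2) * dpsi s + complex_of_real (2 * s) * k s)"
  proof (rule Bochner_Integration.integrable_add[OF p2_dpsi_L1])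
    have "integrable lborel (\<lambda>s. 2 * (complex_of_real s * k s))"
      by (intro integrable_mult_right integrable_times_ident[OF k_integrable p2_psihat])
    then show "integrable lborel (\<lambda>s. complex_of_real (2 * s) * k s)" by (simp add: mult.assoc)
  qed
  obtain V2 M2 where 2: "\<And>x y. x \<le> y \<Longrightarrow> norm (complex_of_real (y\<^sup>2) * k y - complex_of_real (x\<^sup>2) * k x) \<le> V2 y - V2 x" "\<And>x. \<bar>V2 x\<bar> \<le> (M2::real)"
    by (rule integrable_majorant[OF w sq_k_FTC], assumption) (rule that)
  show thesis
  proof (rule that[OF 1(1) 2(1)])
    show "\<bar>V1 x\<bar> \<le> max M1 M2" for x using 1(2)[of x] by simp
    show "\<bar>V2 x\<bar> \<le> max M1 M2" for x using 2(2)[of x] by simp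
  qed
qed

text \<open>The dependence of \<open>wker x\<close> on \<open>x\<close> is affine, so one majorant
  serves the whole range |x| at most \<open>X\<close>.\<close>

lemma wker_majorant:
  assumes "X \<ge> 0"
  obtains V M where "\<And>x u v. \<bar>x\<bar> \<le> X \<Longrightarrow> u \<le> v \<Longrightarrow> norm (wker x v - wker x u) \<le> V v - V u" "\<And>u. \<bar>V u\<bar> \<le> (M::real)"
proof -
  obtain V1 V2 M where V: "\<And>x y. x \<le> y \<Longrightarrow> norm (complex_of_real (y\<^sup>2) * dpsi y - complex_of_real (x\<^sup>2) * dpsi x) \<le> V1 y - V1 x"
    "\<And>x y. x \<le> y \<Longrightarrow> norm (complex_of_real (y\<^sup>2) * k y - complex_of_real (x\<^sup>2) * k x) \<le> V2 y - V2 x"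
    "\<And>x. \<bar>V1 x\<bar> \<le> M" "\<And>x. \<bar>V2 x\<bar> \<le> (M::real)"
    by (rule majorants) blast
  show thesis
  proof (rule that[of "\<lambda>u. X * V2 u + V1 u" "X * M + M"])
    fix x u v :: real assume x: "\<bar>x\<bar> \<le> X" and uv: "u \<le> v"
    have "wker x v - wker x u = \<i> * complex_of_real x * (complex_of_real (v\<^sup>2) * k v - complex_of_real (u\<^sup>2) * k u)
      + (complex_of_real (v\<^sup>2) * dpsi v - complex_of_real (u\<^sup>2) * dpsi u)"
      by (simp add: wker_def algebra_simps)
    also have "norm \<dots> \<le> \<bar>x\<bar> * norm (complex_of_real (v\<^sup>2) * k v - complex_of_real (u\<^sup>2) * k u) + norm (complex_of_real (v\<^sup>2) * dpsi v - complex_of_real (u\<^sup>2) * dpsi u)"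
      by (rule order.trans[OF norm_triangle_ineq]) (simp add: norm_mult)
    also have "\<dots> \<le> X * (V2 v - V2 u) + (V1 v - V1 u)"
      using x V(1,2)[OF uv] assms by (intro add_mono mult_mono) auto
    finally show "norm (wker x v - wker x u) \<le> X * V2 v + V1 v - (X * V2 u + V1 u)"
      by (simp add: algebra_simps)
  next
    fix u
    have "\<bar>X * V2 u\<bar> \<le> X * M" using V(4)[of u] assms by (simp add: abs_mult mult_left_mono)
    then show "\<bar>X * V2 u + V1 u\<bar> \<le> X * M + M" using V(3)[of u] by linarith
  qed
qed

text \<open>The factor s^2 in \<open>wbound\<close> cancels the singularity of 10 / |s| and leaves
  |s| times \<open>k\<close> and \<open>dpsi\<close>, both integrable. Uniformity in
  \<open>x\<close> is what later permits a uniform limit on compact intervals.\<close>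

lemma ker_weighted_var_le:
  assumes "X \<ge> 0"
  obtains M where "M \<ge> 0" "\<And>x a b. \<bar>x\<bar> \<le> X \<Longrightarrow> a \<le> b \<Longrightarrow> weighted_var_le (ker x) a b M"
proof -
  obtain V M where V: "\<And>x u v. \<bar>x\<bar> \<le> X \<Longrightarrow> u \<le> v \<Longrightarrow> norm (wker x v - wker x u) \<le> V v - V u" "\<And>u. \<bar>V u\<bar> \<le> (M::real)"
    by (rule wker_majorant[OF assms]) blast
  have B: "integrable lborel (\<lambda>s. wbound X s * (10 / \<bar>s\<bar> + X))"
  proof -
    have "integrable lborel (\<lambda>s. 10 * (X * norm (complex_of_real s * k s) + norm (complex_of_real s * dpsi s))
       + X * (X * norm (complex_of_real (s\<^sup>2) * k s) + norm (complex_of_real (s\<^sup>2) * dpsi s)))"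
      by (intro Bochner_Integration.integrable_add integrable_mult_right integrable_norm integrable_times_ident
           k_integrable dpsi_integrable p2_psihat p2_dpsi_L1)
    moreover have "10 * (X * norm (complex_of_real s * k s) + norm (complex_of_real s * dpsi s))
       + X * (X * norm (complex_of_real (s\<^sup>2) * k s) + norm (complex_of_real (s\<^sup>2) * dpsi s)) = wbound X s * (10 / \<bar>s\<bar> + X)" for s
    proof (cases "s = 0")
      case False
      then have "s\<^sup>2 / \<bar>s\<bar> = \<bar>s\<bar>" by (simp add: power2_eq_square abs_if)
      moreover have "wbound X s * (10 / \<bar>s\<bar>) = 10 * (X * ((s\<^sup>2 / \<bar>s\<bar>) * norm (k s)) + (s\<^sup>2 / \<bar>s\<bar>) * norm (dpsi s))"
        unfolding wbound_def by (simp add: norm_mult norm_power divide_inverse algebra_simps)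
      ultimately have "wbound X s * (10 / \<bar>s\<bar>) = 10 * (X * norm (complex_of_real s * k s) + norm (complex_of_real s * dpsi s))"
        by (simp add: norm_mult)
      then show ?thesis unfolding distrib_left[of "wbound X s"] by (simp add: wbound_def mult.commute)
    qed (simp add: wbound_def)
    ultimately show ?thesis by simp
  qed
  define M' where "M' = 8 * M + (LINT s|lborel. wbound X s * (10 / \<bar>s\<bar> + X)) + 1"
  have "weighted_var_le (ker x) a b M'" if "\<bar>x\<bar> \<le> X" "a \<le> b" for x a b
    unfolding M'_def
    by (rule weighted_var_le_kernel[OF that(2) V(1)[OF that(1)] V(2) ker_eq wker_le[OF that(1)] B that(1)])
  moreover have "M' \<ge> 0"
  proof -
    have "0 \<le> M" using V(2)[of 0] by linarith
    moreover have "0 \<le> (LINT s|lborel. wbound X s * (10 / \<bar>s\<bar> + X))"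
      using assms by (intro integral_nonneg_AE AE_I2 mult_nonneg_nonneg add_nonneg_nonneg) (auto simp: wbound_def)
    ultimately show ?thesis unfolding M'_def by linarith
  qed
  ultimately show thesis using that by blast
qed

lemma sq_k_tendsto:
  "((\<lambda>s. complex_of_real (s\<^sup>2) * k s) \<longlongrightarrow> 0) at_top" "((\<lambda>s. complex_of_real (s\<^sup>2) * k s) \<longlongrightarrow> 0) at_bot"
proof -
  obtain V1 V2 M where V: "\<And>x y. x \<le> y \<Longrightarrow> norm (complex_of_real (y\<^sup>2) * k y - complex_of_real (x\<^sup>2) * k x) \<le> V2 y - V2 x" "\<And>x. \<bar>V2 x\<bar> \<le> (M::real)"
    by (rule majorants) blast
  show "((\<lambda>s. complex_of_real (s\<^sup>2) * k s) \<longlongrightarrow> 0) at_top"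
    by (rule bv_integrable_tendsto_0_at_top[OF V integrable_norm[OF p2_psihat]])
  show "((\<lambda>s. complex_of_real (s\<^sup>2) * k s) \<longlongrightarrow> 0) at_bot"
    by (rule bv_integrable_tendsto_0_at_bot[OF V integrable_norm[OF p2_psihat]])
qed

text \<open>The limit at 0 concerns s^2 \<open>dpsi\<close> although \<open>dpsi\<close> itself may
  be unbounded there: \<open>norm (wker x s) / s\<^sup>2\<close> is integrable while 1 / s^2 is not.
  These limits remove the boundary terms of the integration by parts at both infinities and at the
  singular point.\<close>

lemma wker_tendsto:
  "(wker x \<longlongrightarrow> 0) at_top" "(wker x \<longlongrightarrow> 0) at_bot" "(wker x \<longlongrightarrow> 0) (at 0)"
proof -
  have "0 \<le> \<bar>x\<bar>" by simp
  then obtain V M where V': "\<And>y u v. \<bar>y\<bar> \<le> \<bar>x\<bar> \<Longrightarrow> u \<le> v \<Longrightarrow> norm (wker y v - wker y u) \<le> V v - V u" "\<And>u. \<bar>V u\<bar> \<le> (M::real)"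
    by (rule wker_majorant) blast
  note V = V'(1)[OF order.refl] V'(2)
  have i0: "integrable lborel (\<lambda>s. \<i> * complex_of_real x * k s + dpsi s)"
    by (intro Bochner_Integration.integrable_add integrable_mult_right k_integrable dpsi_integrable)
  have "integrable lborel (\<lambda>s. \<i> * complex_of_real x * (complex_of_real (s\<^sup>2) * k s) + complex_of_real (s\<^sup>2) * dpsi s)"
    by (intro Bochner_Integration.integrable_add integrable_mult_right p2_psihat p2_dpsi_L1)
  then have i: "integrable lborel (\<lambda>s. norm (wker x s))"
    unfolding wker_def by (intro integrable_norm) (simp add: algebra_simps)
  have i2: "integrable lborel (\<lambda>s. norm (wker x s) / s\<^sup>2)"
  proof (rule Bochner_Integration.integrable_bound[OF i0])
    show "(\<lambda>s. norm (wker x s) / s\<^sup>2) \<in> borel_measurable lborel"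
      unfolding wker_def by measurable
    show "AE s in lborel. norm (norm (wker x s) / s\<^sup>2) \<le> norm (\<i> * complex_of_real x * k s + dpsi s)"
      by (intro AE_I2) (simp add: wker_def norm_mult norm_power)
  qed
  show "(wker x \<longlongrightarrow> 0) at_top" by (rule bv_integrable_tendsto_0_at_top[OF V i])
  show "(wker x \<longlongrightarrow> 0) at_bot" by (rule bv_integrable_tendsto_0_at_bot[OF V i])
  show "(wker x \<longlongrightarrow> 0) (at 0)" by (rule bv_integrable_tendsto_0_at_0[OF V(1) i2])
qed

text \<open>The first integration by parts is a Stieltjes one, with boundary values bounded by a
  multiple of \<open>wker x\<close>. The second differentiates the product of \<open>A\<close>, the
  exponential and \<open>k\<close>; \<open>A\<close> grows at most linearly, so for |s| at least 1
  its boundary values are bounded by a multiple of s^2 \<open>k\<close>. All of these vanish in the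
  limit, and the inversion formula evaluates the remaining integral.\<close>

lemma test_primitive_improper_integral:
  assumes T: "test_primitive F f"
  shows "rs_improper_has_integral (Omega F) (ker x) (of_real (2 * pi) * (LINT t|lborel. f (x - t) * \<psi> t))"
proof -
  note f = test_primitive_integrable(1)[OF T]
  have fc: "continuous_on UNIV f" using T unfolding test_primitive_def by blast
  obtain C where C: "\<And>t. norm (f t) \<le> C" using test_primitive_integrable(2)[OF T] by blast
  note F = test_primitive_Bc[OF T]
  obtain A where A: "A 0 = 0" "\<And>s. (A has_vector_derivative fourier f s) (at s)"
    "Omega F 0 = 0" "\<And>s. (Omega F has_vector_derivative A s) (at s)"
    by (rule Omega_test_primitive_derivative[OF T]) blast
  define e where "e s = exp (\<i> * complex_of_real (x * s))" for s
  have e1: "norm (e s) = 1" for s by (simp add: e_def)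
  have kere: "ker x s = e s * (\<i> * complex_of_real x * k s + dpsi s)" for s by (simp add: ker_def e_def)
  have de: "(e has_vector_derivative \<i> * of_real x * e s) (at s)" for s
    using exp_linear_has_vector_derivative[of "- x" s UNIV] by (simp add: e_def[abs_def])
  have ce: "continuous_on UNIV e" unfolding e_def by (intro continuous_intros)
  have cA: "continuous_on UNIV A"
    by (intro continuous_at_imp_continuous_on ballI has_vector_derivative_continuous[OF A(2)])
  \<comment> \<open>Comparison with the zero primitive turns the difference estimate for
    \<open>Omega\<close> into a bound for \<open>Omega F\<close> itself.\<close>
  have Bc0: "Bc (\<lambda>_. 0)" by (simp add: Bc_def) (intro exI[of _ 0] tendsto_const)
  obtain CF where CF: "\<And>t. norm (F t) \<le> CF" by (rule Bc_bounded[OF F]) blast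
  define C' where "C' = CF * (16 * pi)"
  have Om: "norm (Omega F s) \<le> C' * s\<^sup>2" for s
    using Omega_diff_le[OF F Bc0, of CF s] CF Omega_eq[OF Bc0, of s] by (simp add: C'_def)
  have Og: "norm (Omega F s * ker x s) \<le> C' * norm (wker x s)" for s
  proof -
    have "norm (Omega F s * ker x s) = norm (Omega F s) * norm (\<i> * complex_of_real x * k s + dpsi s)"
      by (simp add: norm_mult ker_def)
    also have "\<dots> \<le> C' * s\<^sup>2 * norm (\<i> * complex_of_real x * k s + dpsi s)"
      by (intro mult_right_mono Om) auto
    also have "\<dots> = C' * norm (wker x s)"
      by (simp add: wker_def norm_mult norm_power)
    finally show ?thesis .
  qed
  have Ogt: "((\<lambda>s. Omega F s * ker x s) \<longlongrightarrow> 0) net" if "(wker x \<longlongrightarrow> 0) net" for net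
  proof (rule Lim_null_comparison)
    show "\<forall>\<^sub>F s in net. norm (Omega F s * ker x s) \<le> C' * norm (wker x s)" using Og by simp
    show "((\<lambda>s. C' * norm (wker x s)) \<longlongrightarrow> 0) net"
      using tendsto_mult_right_zero[OF tendsto_norm_zero[OF that], of C'] .
  qed
  define Cf where "Cf = (LINT t|lborel. norm (f t))"
  have Cf: "norm (fourier f s) \<le> Cf" for s unfolding Cf_def by (rule norm_fourier_le[OF f])
  have Al: "norm (A s) \<le> Cf * \<bar>s\<bar>" for s
  proof (cases "s \<ge> 0")
    case True
    have "(fourier f has_integral (A s - A 0)) {0..s}"
      using True by (intro fundamental_theorem_of_calculus has_vector_derivative_at_within[OF A(2)])
    then have "norm (A s - A 0) \<le> Cf * measure lborel {0..s}"
      by (rule has_integral_bound_real[where S="{}", rotated 2]) (use Cf in \<open>auto simp: Cf_def\<close>)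
    then show ?thesis using True A(1) by simp
  next
    case False
    have "(fourier f has_integral (A 0 - A s)) {s..0}"
      using False by (intro fundamental_theorem_of_calculus has_vector_derivative_at_within[OF A(2)]) auto
    then have "norm (A 0 - A s) \<le> Cf * measure lborel {s..0}"
      by (rule has_integral_bound_real[where S="{}", rotated 2]) (use Cf in \<open>auto simp: Cf_def\<close>)
    then show ?thesis using False A(1) by simp
  qed
  have Aek: "((\<lambda>s. A s * e s * k s) \<longlongrightarrow> 0) net"
    if "((\<lambda>s. complex_of_real (s\<^sup>2) * k s) \<longlongrightarrow> 0) net" "\<forall>\<^sub>F s in net. \<bar>s\<bar> \<ge> 1" for net
  proof (rule Lim_null_comparison)
    show "\<forall>\<^sub>F s in net. norm (A s * e s * k s) \<le> Cf * norm (complex_of_real (s\<^sup>2) * k s)"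
      using that(2)
    proof eventually_elim
      case (elim s)
      have "norm (A s * e s * k s) = norm (A s) * norm (k s)" by (simp add: norm_mult e1)
      also have "\<dots> \<le> (Cf * \<bar>s\<bar>) * norm (k s)" by (intro mult_right_mono Al) auto
      also have "\<dots> \<le> (Cf * s\<^sup>2) * norm (k s)"
      proof (intro mult_right_mono mult_left_mono)
        have "\<bar>s\<bar> * 1 \<le> \<bar>s\<bar> * \<bar>s\<bar>" using elim by (intro mult_left_mono) auto
        then show "\<bar>s\<bar> \<le> s\<^sup>2" by (simp add: power2_eq_square)
        show "0 \<le> Cf" using Cf[of 0] order.trans[OF norm_ge_zero] by blast
      qed auto
      finally show ?case by (simp add: norm_mult norm_power mult.assoc)
    qed
    show "((\<lambda>s. Cf * norm (complex_of_real (s\<^sup>2) * k s)) \<longlongrightarrow> 0) net"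
      using tendsto_mult_right_zero[OF tendsto_norm_zero[OF that(1)], of Cf] .
  qed
  obtain M where M: "M \<ge> 0" "\<And>y a b. \<bar>y\<bar> \<le> \<bar>x\<bar> \<Longrightarrow> a \<le> b \<Longrightarrow> weighted_var_le (ker y) a b M"
    by (rule ker_weighted_var_le[of "\<bar>x\<bar>"]) auto
  let ?q = "\<lambda>s. fourier f s * (e s * k s)"
  have q: "integrable lborel ?q"
  proof (rule Bochner_Integration.integrable_bound)
    show "integrable lborel (\<lambda>s. Cf * norm (k s))" using k_integrable by simp
    have [measurable]: "fourier f \<in> borel_measurable borel" "e \<in> borel_measurable borel"
      using continuous_on_fourier[OF f] ce by (auto intro: borel_measurable_continuous_onI)
    show "?q \<in> borel_measurable lborel" by measurable
    have "norm (fourier f s) * norm (k s) \<le> Cf * norm (k s)" for s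
      by (intro mult_right_mono Cf) auto
    then show "AE s in lborel. norm (?q s) \<le> norm (Cf * norm (k s))"
      by (intro AE_I2) (simp add: norm_mult e1 abs_mult order.trans[OF _ mult_right_mono[OF abs_ge_self]])
  qed
  have qi: "?q integrable_on {a..b}" for a b
    using integrable_on_subinterval[OF integrable_on_lborel[OF q], of a b] by simp
  \<comment> \<open>The integral over a finite interval after both integrations by parts, with all
    boundary terms kept.\<close>
  define val where "val p = (Omega F (snd p) * ker x (snd p) - Omega F (fst p) * ker x (fst p))
      - (A (snd p) * e (snd p) * k (snd p) - A (fst p) * e (fst p) * k (fst p)) + integral {fst p..snd p} ?q" for p
  have rs: "rs_has_integral (Omega F) (ker x) (val (a,b)) a b" if ab: "a \<le> b" for a b
  proof -
    have dAe: "((\<lambda>s. A s * e s) has_vector_derivative A s * (\<i> * of_real x * e s) + fourier f s * e s) (at s)" for s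
      by (rule has_vector_derivative_mult[OF A(2) de])
    have "continuous_on UNIV (\<lambda>s. A s * (\<i> * of_real x * e s) + fourier f s * e s)"
      by (intro continuous_intros cA ce continuous_on_fourier[OF f])
    from C1_mult_FTC[OF dAe this ab]
    have "((\<lambda>s. A s * e s * dpsi s + (A s * (\<i> * of_real x * e s) + fourier f s * e s) * k s) has_integral
        (A b * e b * k b - A a * e a * k a)) {a..b}" .
    \<comment> \<open>The derivative of the product contains \<open>A s * ker x s\<close> and the
      integrand \<open>?q\<close>; removing the latter leaves the integral needed for the Stieltjes
      formula.\<close>
    from has_integral_diff[OF this integrable_integral[OF qi[of a b]]]
    have "((\<lambda>s. A s * ker x s) has_integral ((A b * e b * k b - A a * e a * k a) - integral {a..b} ?q)) {a..b}"
      by (rule has_integral_eq_rhs[OF has_integral_eq[rotated]]) (auto simp: kere algebra_simps)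
    from rs_has_integral_by_parts[OF ab M(2)[OF order.refl ab] M(1) A(4,3,1) Ogt[OF wker_tendsto(3)] this]
    show ?thesis by (simp add: val_def algebra_simps)
  qed
  have "(val \<longlongrightarrow> (0 - 0) - (0 - 0) + (LINT s|lborel. ?q s)) (at_bot \<times>\<^sub>F at_top)"
    unfolding val_def
  proof (intro tendsto_add tendsto_diff)
    show "((\<lambda>p::real\<times>real. Omega F (snd p) * ker x (snd p)) \<longlongrightarrow> 0) (at_bot \<times>\<^sub>F at_top)"
      by (rule filterlim_compose[OF Ogt[OF wker_tendsto(1)] filterlim_snd])
    show "((\<lambda>p::real\<times>real. Omega F (fst p) * ker x (fst p)) \<longlongrightarrow> 0) (at_bot \<times>\<^sub>F at_top)"
      by (rule filterlim_compose[OF Ogt[OF wker_tendsto(2)] filterlim_fst])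
    have "\<forall>\<^sub>F s in at_top. \<bar>s::real\<bar> \<ge> 1" using eventually_ge_at_top[of 1] by eventually_elim auto
    from Aek[OF sq_k_tendsto(1) this]
    show "((\<lambda>p::real\<times>real. A (snd p) * e (snd p) * k (snd p)) \<longlongrightarrow> 0) (at_bot \<times>\<^sub>F at_top)"
      by (rule filterlim_compose[OF _ filterlim_snd])
    have "\<forall>\<^sub>F s in at_bot. \<bar>s::real\<bar> \<ge> 1" using eventually_le_at_bot[of "-1"] by eventually_elim auto
    from Aek[OF sq_k_tendsto(2) this]
    show "((\<lambda>p::real\<times>real. A (fst p) * e (fst p) * k (fst p)) \<longlongrightarrow> 0) (at_bot \<times>\<^sub>F at_top)"
      by (rule filterlim_compose[OF _ filterlim_fst])
    show "((\<lambda>p. integral {fst p..snd p} ?q) \<longlongrightarrow> (LINT s|lborel. ?q s)) (at_bot \<times>\<^sub>F at_top)"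
      using integral_tendsto_lborel[OF q] by (simp add: split_beta')
  qed
  moreover have "(LINT s|lborel. ?q s) = of_real (2 * pi) * (LINT t|lborel. f (x - t) * \<psi> t)"
    unfolding e_def by (rule fourier_convolution_inversion[OF f fc C psi_L1 k_integrable])
  ultimately have lim: "(val \<longlongrightarrow> of_real (2 * pi) * (LINT t|lborel. f (x - t) * \<psi> t)) (at_bot \<times>\<^sub>F at_top)"
    by simp
  show ?thesis
    unfolding rs_improper_has_integral_def
  proof (intro conjI allI impI)
    show "\<exists>J. rs_has_integral (Omega F) (ker x) J a b" if "a \<le> b" for a b using rs[OF that] by blast
    show "((\<lambda>(a,b). rs_integral (Omega F) (ker x) a b) \<longlongrightarrow> of_real (2 * pi) * (LINT t|lborel. f (x - t) * \<psi> t)) (at_bot \<times>\<^sub>F at_top)"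
    proof (rule Lim_transform_eventually[OF lim])
      have "\<forall>\<^sub>F p in at_bot \<times>\<^sub>F at_top. fst p \<le> (0::real) \<and> (0::real) \<le> snd p"
        by (intro eventually_prodI eventually_le_at_bot eventually_ge_at_top)
      then show "\<forall>\<^sub>F p in at_bot \<times>\<^sub>F at_top. val p = (case p of (a,b) \<Rightarrow> rs_integral (Omega F) (ker x) a b)"
      proof eventually_elim
        case (elim p)
        then have "fst p \<le> snd p" by linarith
        from rs_integral_eq[OF rs[OF this]] show ?case by (simp add: split_beta)
      qed
    qed
  qed
qed

end

subsection \<open>Convolution with the kernel\<close>

lemma has_integral_uniform_limit_real:
  fixes h :: "real \<Rightarrow> complex"
  assumes ab: "a \<le> b" and f: "\<And>n::nat. (f n has_integral I n) {a..b}"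
    and c: "\<And>n y. y \<in> {a..b} \<Longrightarrow> norm (h y - f n y) \<le> c n" "c \<longlonglongrightarrow> 0" and I: "I \<longlonglongrightarrow> L"
  shows "(h has_integral L) {a..b}"
proof -
  have c0: "0 \<le> c n" for n using c(1)[of a n] ab order.trans[OF norm_ge_zero] by auto
  have "h integrable_on cbox a b"
  proof (rule integrable_uniform_limit)
    fix e :: real assume "e > 0"
    then obtain n where n: "norm (c n) < e" using LIMSEQ_D[OF c(2), of e] by auto
    show "\<exists>g. (\<forall>x\<in>cbox a b. norm (h x - g x) \<le> e) \<and> g integrable_on cbox a b"
    proof (intro exI[of _ "f n"] conjI ballI)
      show "norm (h y - f n y) \<le> e" if "y \<in> cbox a b" for y
        using c(1)[of y n] n that by auto
      show "f n integrable_on cbox a b" using f[of n] by auto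
    qed
  qed
  then have h: "(h has_integral integral {a..b} h) {a..b}" by (auto simp: integrable_integral)
  have le: "norm (integral {a..b} h - I n) \<le> c n * (b - a)" for n
  proof -
    have "norm (integral {a..b} h - I n) \<le> c n * measure lborel {a..b}"
      by (rule has_integral_bound_real[where S="{}", OF c0 _ has_integral_diff[OF h f]]) (use c(1) in auto)
    then show ?thesis using ab by simp
  qed
  have "(\<lambda>n. integral {a..b} h - I n) \<longlonglongrightarrow> 0"
    by (rule Lim_null_comparison[OF always_eventually tendsto_mult_left_zero[OF c(2), of "b - a"]]) (intro allI le)
  from tendsto_diff[OF tendsto_const[of "integral {a..b} h"] this]
  have "I \<longlonglongrightarrow> integral {a..b} h" by simp
  with I have "L = integral {a..b} h" by (rule LIMSEQ_unique)
  with h show ?thesis by simp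
qed

text \<open>Hake's theorem on a half-line: convergence of the integrals over compact intervals
  suffices for the gauge integral, with no absolute integrability.\<close>

lemma has_integral_atMostI:
  fixes h :: "real \<Rightarrow> complex"
  assumes h: "\<And>c. c \<le> x \<Longrightarrow> (h has_integral (P x - P c)) {c..x}" and P: "(P \<longlongrightarrow> 0) at_bot"
  shows "(h has_integral P x) {..x}"
  unfolding has_integral_alt'
proof (intro conjI allI impI)
  show "(\<lambda>y. if y \<in> {..x} then h y else 0) integrable_on cbox a b" for a b
  proof -
    have "h integrable_on {a..min x b}"
    proof (cases "a \<le> x")
      case True
      then have "h integrable_on {a..x}" using h by blast
      then show ?thesis using integrable_on_subinterval[of h "{a..x}" a "min x b"] by simp
    qed (auto simp: integrable_on_empty)
    moreover have "{..x} \<inter> cbox a b = {a..min x b}" by auto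
    ultimately show ?thesis unfolding integrable_restrict_Int by simp
  qed
  fix e :: real assume "e > 0"
  then have "\<forall>\<^sub>F c in at_bot. dist (P c) 0 < e" by (rule tendstoD[OF P])
  then obtain c0 where c0: "\<And>c. c \<le> c0 \<Longrightarrow> norm (P c) < e"
    unfolding eventually_at_bot_linorder by auto
  show "\<exists>B>0. \<forall>a b. ball 0 B \<subseteq> cbox a b \<longrightarrow> norm (integral (cbox a b) (\<lambda>y. if y \<in> {..x} then h y else 0) - P x) < e"
  \<comment> \<open>A box containing this ball reaches to the left of both \<open>c0\<close> and
    \<open>x\<close> and to the right of \<open>x\<close>, so the truncated integral is exactly the
    one over \<open>{a..x}\<close>.\<close>
  proof (intro exI[of _ "\<bar>c0\<bar> + \<bar>x\<bar> + 1"] conjI allI impI)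
    fix a b :: real assume sub: "ball 0 (\<bar>c0\<bar> + \<bar>x\<bar> + 1) \<subseteq> cbox a b"
    have "- (\<bar>c0\<bar> + \<bar>x\<bar>) \<in> ball 0 (\<bar>c0\<bar> + \<bar>x\<bar> + 1)" "\<bar>c0\<bar> + \<bar>x\<bar> \<in> ball 0 (\<bar>c0\<bar> + \<bar>x\<bar> + 1)" by auto
    with sub have "- (\<bar>c0\<bar> + \<bar>x\<bar>) \<in> cbox a b" "\<bar>c0\<bar> + \<bar>x\<bar> \<in> cbox a b" by blast+
    then have a: "a \<le> c0" "a \<le> x" and b: "x \<le> b" by auto
    have "integral (cbox a b) (\<lambda>y. if y \<in> {..x} then h y else 0) = integral ({..x} \<inter> cbox a b) h"
      by (rule integral_restrict_Int)
    also have "{..x} \<inter> cbox a b = {a..x}" using b by auto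
    also have "integral {a..x} h = P x - P a" by (rule integral_unique[OF h[OF a(2)]])
    finally show "norm (integral (cbox a b) (\<lambda>y. if y \<in> {..x} then h y else 0) - P x) < e"
      using c0[OF a(1)] by simp
  qed simp
qed

text \<open>The substitution t to a t leaves the kernel fixed and moves the dilation into the
  argument of \<open>F\<close>, and total mass 1 puts \<open>F x\<close> under the same integral.
  For |t| at most \<open>n\<close> uniform continuity applies simultaneously for all
  \<open>x\<close>; beyond that the tail of |\<psi>| is small.\<close>

lemma approximate_identity:
  fixes F \<psi> :: "real \<Rightarrow> complex"
  assumes F: "Bc F" and psi: "integrable lborel \<psi>" and psi1: "(LINT t|lborel. \<psi> t) = 1" and "\<epsilon> > 0"
  shows "\<forall>\<^sub>F a in at_right 0. \<forall>x. norm (F x - (LINT t|lborel. F (x - t) * psi_a \<psi> a t)) \<le> \<epsilon>"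
proof -
  obtain C where C: "C \<ge> 0" "\<And>t. norm (F t) \<le> C" by (rule Bc_bounded[OF F]) blast
  have [measurable]: "F \<in> borel_measurable borel" "\<psi> \<in> borel_measurable borel"
    using F psi by (auto simp: Bc_def intro: borel_measurable_continuous_onI)
  define K where "K = (LINT t|lborel. norm (\<psi> t))"
  have K: "K \<ge> 0" by (simp add: K_def)
  \<comment> \<open>Half of \<open>\<epsilon>\<close> is spent on the central part, where |\<psi>|
    has mass at most \<open>K\<close>, and half on the tail, where two values of \<open>F\<close>
    differ by at most \<open>2 * C\<close>. The summands 1 here and in \<open>4 * (C + 1)\<close>
    keep denominators positive without case distinctions.\<close>
  have e1: "\<epsilon> / (2 * (K + 1)) > 0" using K \<open>\<epsilon> > 0\<close> by simp
  obtain \<delta> where \<delta>: "\<delta> > 0" "\<And>x y. \<bar>x - y\<bar> < \<delta> \<Longrightarrow> norm (F x - F y) < \<epsilon> / (2 * (K + 1))"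
    by (rule Bc_uniformly_continuous[OF F e1]) blast
  have "(\<lambda>n::nat. LINT t|lborel. indicator (- {- real n..real n}) t * norm (\<psi> t)) \<longlonglongrightarrow> (LINT t::real|lborel. 0)"
  proof (rule integral_dominated_convergence[where w="\<lambda>t. norm (\<psi> t)"])
    show "integrable lborel (\<lambda>t. norm (\<psi> t))" using psi by simp
    have "(\<lambda>n::nat. indicator (- {- real n..real n}) t * norm (\<psi> t)) \<longlonglongrightarrow> 0" for t
    proof (rule tendsto_eventually)
      obtain N :: nat where "\<bar>t\<bar> \<le> real N" using real_arch_simple by blast
      then show "\<forall>\<^sub>F n in sequentially. indicator (- {- real n..real n}) t * norm (\<psi> t) = 0"
        unfolding eventually_sequentially by (intro exI[of _ N]) (auto simp: indicator_def)
    qed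
    then show "AE t in lborel. (\<lambda>n::nat. indicator (- {- real n..real n}) t * norm (\<psi> t)) \<longlonglongrightarrow> 0" by simp
    show "AE t in lborel. norm (indicator (- {- real n..real n}) t * norm (\<psi> t)) \<le> norm (\<psi> t)" for n :: nat
      by (intro AE_I2) (simp add: indicator_def)
  qed measurable
  then have tail: "(\<lambda>n::nat. LINT t|lborel. indicator (- {- real n..real n}) t * norm (\<psi> t)) \<longlonglongrightarrow> 0" by simp
  have e2: "\<epsilon> / (4 * (C + 1)) > 0" using C \<open>\<epsilon> > 0\<close> by simp
  obtain n :: nat where n: "norm (LINT t|lborel. indicator (- {- real n..real n}) t * norm (\<psi> t)) < \<epsilon> / (4 * (C + 1))"
    using LIMSEQ_D[OF tail e2] by auto
  define \<tau> where "\<tau> = (LINT t|lborel. indicator (- {- real n..real n}) t * norm (\<psi> t))"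
  have bound: "norm (F x - (LINT t|lborel. F (x - t) * psi_a \<psi> a t)) \<le> \<epsilon>" if a: "0 < a" "a < \<delta> / (real n + 1)" for a x
  proof -
    have eq: "(LINT t|lborel. F (x - t) * psi_a \<psi> a t) = (LINT t|lborel. F (x - a * t) * \<psi> t)"
    proof -
      have "(LINT t|lborel. F (x - t) * psi_a \<psi> a t) = \<bar>a\<bar> *\<^sub>R (LINT t|lborel. F (x - (0 + a * t)) * psi_a \<psi> a (0 + a * t))"
        using a by (intro lborel_integral_real_affine) simp
      also have "\<dots> = (LINT t|lborel. \<bar>a\<bar> *\<^sub>R (F (x - (0 + a * t)) * psi_a \<psi> a (0 + a * t)))" by simp
      also have "\<dots> = (LINT t|lborel. F (x - a * t) * \<psi> t)"
        using a by (intro Bochner_Integration.integral_cong refl) (simp add: psi_a_def scaleR_conv_of_real)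
      finally show ?thesis .
    qed
    have i1: "integrable lborel (\<lambda>t. F x * \<psi> t)" using psi by simp
    have i2: "integrable lborel (\<lambda>t. F (x - a * t) * \<psi> t)"
    proof (rule Bochner_Integration.integrable_bound)
      show "integrable lborel (\<lambda>t. C * norm (\<psi> t))" using psi by simp
      have "norm (F (x - a * t)) * norm (\<psi> t) \<le> C * norm (\<psi> t)" for t by (intro mult_right_mono C) auto
      then show "AE t in lborel. norm (F (x - a * t) * \<psi> t) \<le> norm (C * norm (\<psi> t))"
        using C(1) by (intro AE_I2) (simp add: norm_mult)
    qed measurable
    have "F x = (LINT t|lborel. F x * \<psi> t)" using psi1 by simp
    then have "F x - (LINT t|lborel. F (x - t) * psi_a \<psi> a t) = (LINT t|lborel. F x * \<psi> t - F (x - a * t) * \<psi> t)"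
      unfolding eq using Bochner_Integration.integral_diff[OF i1 i2] by simp
    then have "norm (F x - (LINT t|lborel. F (x - t) * psi_a \<psi> a t)) \<le> (LINT t|lborel. norm (F x * \<psi> t - F (x - a * t) * \<psi> t))"
      by (simp add: integral_norm_bound)
    also have "\<dots> \<le> (LINT t|lborel. \<epsilon> / (2 * (K + 1)) * norm (\<psi> t) + 2 * C * (indicator (- {- real n..real n}) t * norm (\<psi> t)))"
    proof (rule integral_mono)
      show "integrable lborel (\<lambda>t. norm (F x * \<psi> t - F (x - a * t) * \<psi> t))"
        using i1 i2 by (intro integrable_norm Bochner_Integration.integrable_diff)
      have "integrable lborel (\<lambda>t. indicator (- {- real n..real n}) t *\<^sub>R norm (\<psi> t))"
        using psi by (intro integrable_mult_indicator) auto
      then show "integrable lborel (\<lambda>t. \<epsilon> / (2 * (K + 1)) * norm (\<psi> t) + 2 * C * (indicator (- {- real n..real n}) t * norm (\<psi> t)))"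
        using psi by (intro Bochner_Integration.integrable_add integrable_mult_right) auto
      fix t
      have nm: "norm (F x * \<psi> t - F (x - a * t) * \<psi> t) = norm (F x - F (x - a * t)) * norm (\<psi> t)"
        by (simp only: norm_mult[symmetric] left_diff_distrib)
      show "norm (F x * \<psi> t - F (x - a * t) * \<psi> t) \<le> \<epsilon> / (2 * (K + 1)) * norm (\<psi> t) + 2 * C * (indicator (- {- real n..real n}) t * norm (\<psi> t))"
      proof (cases "t \<in> {- real n..real n}")
        case True
        then have "a * \<bar>t\<bar> \<le> a * (real n + 1)" using a by (intro mult_left_mono) auto
        also have "\<dots> < \<delta>" using a(2) by (simp add: pos_less_divide_eq)
        finally have "\<bar>x - (x - a * t)\<bar> < \<delta>" using a by (simp add: abs_mult)
        from \<delta>(2)[OF this] have "norm (F x - F (x - a * t)) * norm (\<psi> t) \<le> \<epsilon> / (2 * (K + 1)) * norm (\<psi> t)"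
          by (intro mult_right_mono) auto
        then show ?thesis unfolding nm using True by simp
      next
        case False
        have "norm (F x - F (x - a * t)) \<le> 2 * C"
          using norm_triangle_ineq4[of "F x" "F (x - a * t)"] C(2)[of x] C(2)[of "x - a * t"] by linarith
        then have "norm (F x - F (x - a * t)) * norm (\<psi> t) \<le> 2 * C * norm (\<psi> t)" by (intro mult_right_mono) auto
        moreover have "0 \<le> \<epsilon> / (2 * (K + 1)) * norm (\<psi> t)" using e1 by (intro mult_nonneg_nonneg) auto
        ultimately show ?thesis unfolding nm using False by simp
      qed
    qed
    also have "\<dots> = \<epsilon> / (2 * (K + 1)) * K + 2 * C * \<tau>"
    proof -
      have "integrable lborel (\<lambda>t. indicator (- {- real n..real n}) t *\<^sub>R norm (\<psi> t))"
        using psi by (intro integrable_mult_indicator) auto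
      then show ?thesis unfolding K_def \<tau>_def using psi
        by (subst Bochner_Integration.integral_add) auto
    qed
    also have "\<dots> \<le> \<epsilon> / 2 + \<epsilon> / 2"
    proof (rule add_mono)
      have "\<epsilon> / (2 * (K + 1)) * K \<le> \<epsilon> / (2 * (K + 1)) * (K + 1)" using e1 by (intro mult_left_mono) auto
      also have "\<dots> = \<epsilon> / 2"
      proof -
        have "\<epsilon> / (2 * c) * c = \<epsilon> / 2" if "c > 0" for c :: real using that by simp
        from this[of "K + 1"] K show ?thesis by simp
      qed
      finally show "\<epsilon> / (2 * (K + 1)) * K \<le> \<epsilon> / 2" .
      have \<tau>: "\<tau> \<le> \<epsilon> / (4 * (C + 1))" using n unfolding \<tau>_def by (simp add: abs_less_iff)
      have "2 * C * \<tau> \<le> 2 * C * (\<epsilon> / (4 * (C + 1)))" using C \<tau> by (intro mult_left_mono) auto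
      also have "\<dots> \<le> 2 * (C + 1) * (\<epsilon> / (4 * (C + 1)))" using e2 by (intro mult_right_mono) auto
      also have "\<dots> = \<epsilon> / 2"
      proof -
        have "2 * c * (\<epsilon> / (4 * c)) = \<epsilon> / 2" if "c > 0" for c :: real using that by simp
        from this[of "C + 1"] C show ?thesis by simp
      qed
      finally show "2 * C * \<tau> \<le> \<epsilon> / 2" .
    qed
    finally show ?thesis by simp
  qed
  have "\<delta> / (real n + 1) > 0" using \<delta>(1) by simp
  then show ?thesis
    unfolding eventually_at_right_field using bound by blast
qed

section \<open>Passage from test primitives to all primitives\<close>

context summability_kernel
begin

definition conv :: "(real \<Rightarrow> complex) \<Rightarrow> real \<Rightarrow> complex" where
  "conv F x = (LINT t|lborel. F (x - t) * \<psi> t)"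

lemma psi_meas[measurable]: "\<psi> \<in> borel_measurable borel"
  using psi_L1 by auto

lemma conv_integrable:
  assumes [measurable]: "F \<in> borel_measurable borel" and C: "\<And>t. norm (F t) \<le> C"
  shows "integrable lborel (\<lambda>t. F (x - t) * \<psi> t)"
proof (rule Bochner_Integration.integrable_bound)
  show "integrable lborel (\<lambda>t. C * norm (\<psi> t))" using psi_L1 by simp
  have "norm (F (x - t)) * norm (\<psi> t) \<le> C * norm (\<psi> t)" for t by (intro mult_right_mono C) auto
  then show "AE t in lborel. norm (F (x - t) * \<psi> t) \<le> norm (C * norm (\<psi> t))"
    by (intro AE_I2) (simp add: norm_mult order.trans[OF _ mult_right_mono[OF abs_ge_self]] abs_mult)
qed measurable

lemma norm_conv_le:
  assumes [measurable]: "F \<in> borel_measurable borel" and C: "\<And>t. norm (F t) \<le> C"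
  shows "norm (conv F x) \<le> C * K0"
proof -
  have "norm (conv F x) \<le> (LINT t|lborel. norm (F (x - t) * \<psi> t))"
    unfolding conv_def by (rule integral_norm_bound)
  also have "\<dots> \<le> (LINT t|lborel. C * norm (\<psi> t))"
  proof (rule integral_mono)
    show "integrable lborel (\<lambda>t. norm (F (x - t) * \<psi> t))" by (rule integrable_norm[OF conv_integrable[OF assms]])
    show "integrable lborel (\<lambda>t. C * norm (\<psi> t))" using psi_L1 by simp
    show "norm (F (x - t) * \<psi> t) \<le> C * norm (\<psi> t)" for t
      unfolding norm_mult by (intro mult_right_mono C) auto
  qed
  finally show ?thesis by (simp add: K0_def)
qed

text \<open>The derivative of G * \<psi> is g * \<psi>, in integrated form: Fubini moves the
  integration over \<open>{c..x}\<close> inside, where it acts on a translate of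
  \<open>g\<close>.\<close>

lemma conv_has_integral:
  assumes T: "test_primitive G g" and cx: "c \<le> x"
  shows "(conv g has_integral (conv G x - conv G c)) {c..x}"
proof -
  obtain C where C: "\<And>t. norm (g t) \<le> C" using test_primitive_integrable(2)[OF T] by blast
  have gc: "continuous_on UNIV g" using T unfolding test_primitive_def by blast
  have dG: "(G has_vector_derivative g t) (at t)" for t using T unfolding test_primitive_def by blast
  have [measurable]: "g \<in> borel_measurable borel" using gc by (rule borel_measurable_continuous_onI)
  have BG: "Bc G" by (rule test_primitive_Bc[OF T])
  have [measurable]: "G \<in> borel_measurable borel" using BG by (auto simp: Bc_def intro: borel_measurable_continuous_onI)
  obtain D where D: "\<And>t. norm (G t) \<le> D" by (rule Bc_bounded[OF BG]) blast
  have [measurable]: "conv g \<in> borel_measurable borel" unfolding conv_def by measurable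
  let ?u = "\<lambda>y. indicator {c..x} y *\<^sub>R (1::complex)"
  have u: "integrable lborel ?u"
    using borel_integrable_atLeastAtMost'[of c x "\<lambda>_. 1::complex"] by (simp add: set_integrable_def)
  have si: "set_integrable lborel {c..x} (conv g)"
    unfolding set_integrable_def
  proof (rule Bochner_Integration.integrable_bound)
    show "integrable lborel (\<lambda>y. (C * K0) *\<^sub>R ?u y)" by (intro integrable_scaleR_right u)
    have "norm (conv g y) \<le> \<bar>C * K0\<bar>" for y using norm_conv_le[where F=g, OF _ C, of y] by simp
    then show "AE y in lborel. norm (indicator {c..x} y *\<^sub>R conv g y) \<le> norm ((C * K0) *\<^sub>R ?u y)"
      by (intro AE_I2) (simp add: indicator_def)
  qed measurable
  have "integral {c..x} (conv g) = (LINT y|lborel. ?u y * (LINT t|lborel. \<psi> t * g (y - t)))"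
    using set_borel_integral_eq_integral(2)[OF si] by (simp add: set_lebesgue_integral_def conv_def mult.commute)
  also have "\<dots> = (LINT t|lborel. \<psi> t * (LINT y|lborel. ?u y * g (y - t)))"
  proof (rule bounded_kernel_Fubini[OF u psi_L1])
    show "(\<lambda>(y,t). g (y - t)) \<in> borel_measurable (borel \<Otimes>\<^sub>M borel)" by measurable
    show "norm (g (y - t)) \<le> C" for y t by (rule C)
  qed
  also have "\<dots> = (LINT t|lborel. \<psi> t * (G (x - t) - G (c - t)))"
  proof (intro Bochner_Integration.integral_cong refl arg_cong2[where f="(*)"])
    fix t
    have "continuous_on UNIV (\<lambda>y. g (y - t))"
      by (intro continuous_on_compose2[OF gc] continuous_intros) auto
    from continuous_on_subset[OF this subset_UNIV] have s: "set_integrable lborel {c..x} (\<lambda>y. g (y - t))"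
      by (rule borel_integrable_atLeastAtMost')
    have d: "((\<lambda>y. G (y - t)) has_vector_derivative g (y - t)) (at y)" for y
    proof -
      have "((\<lambda>y. y - t) has_vector_derivative 1) (at y)"
        by (auto intro!: derivative_eq_intros simp: has_real_derivative_iff_has_vector_derivative[symmetric])
      from vector_diff_chain_at[OF this dG] show ?thesis by (simp add: o_def)
    qed
    have "((\<lambda>y. g (y - t)) has_integral (G (x - t) - G (c - t))) {c..x}"
      using cx by (intro fundamental_theorem_of_calculus has_vector_derivative_at_within[OF d])
    with set_borel_integral_eq_integral(2)[OF s]
    show "(LINT y|lborel. ?u y * g (y - t)) = G (x - t) - G (c - t)"
      by (simp add: set_lebesgue_integral_def integral_unique)
  qed
  also have "\<dots> = (LINT t|lborel. G (x - t) * \<psi> t - G (c - t) * \<psi> t)"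
    by (simp add: algebra_simps)
  also have "\<dots> = conv G x - conv G c"
    unfolding conv_def by (intro Bochner_Integration.integral_diff conv_integrable[where F=G, OF _ D]) auto
  finally show ?thesis
    using integrable_integral[OF set_borel_integral_eq_integral(1)[OF si]] by simp
qed

lemma conv_diff_le:
  assumes F: "Bc F" and G: "Bc G" and e: "\<And>t. norm (F t - G t) \<le> e"
  shows "norm (conv F x - conv G x) \<le> e * K0"
proof -
  note [measurable] = Bc_meas[OF F] Bc_meas[OF G]
  obtain C where C: "\<And>t. norm (F t) \<le> C" by (rule Bc_bounded[OF F]) blast
  obtain D where D: "\<And>t. norm (G t) \<le> D" by (rule Bc_bounded[OF G]) blast
  have "conv F x - conv G x = conv (\<lambda>t. F t - G t) x"
    unfolding conv_def left_diff_distrib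
    by (intro Bochner_Integration.integral_diff[symmetric] conv_integrable[where F=F, OF _ C] conv_integrable[where F=G, OF _ D]) auto
  then show ?thesis using norm_conv_le[where F="\<lambda>t. F t - G t", OF _ e, of x] by simp
qed

lemma conv_tendsto_0:
  assumes F: "Bc F"
  shows "(conv F \<longlongrightarrow> 0) at_bot"
proof -
  note [measurable] = Bc_meas[OF F]
  obtain C where C: "\<And>t. norm (F t) \<le> C" by (rule Bc_bounded[OF F]) blast
  have "((\<lambda>c. LINT t|lborel. F (- c - t) * \<psi> t) \<longlongrightarrow> (LINT t::real|lborel. 0)) at_top"
  proof (rule integral_dominated_convergence_at_top[where w="\<lambda>t. C * norm (\<psi> t)"])
    show "integrable lborel (\<lambda>t. C * norm (\<psi> t))" using psi_L1 by simp
    show "\<forall>\<^sub>F c in at_top. AE t in lborel. norm (F (- c - t) * \<psi> t) \<le> C * norm (\<psi> t)"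
      by (intro always_eventually allI AE_I2) (auto simp: norm_mult intro!: mult_right_mono C)
    have "((\<lambda>c. F (- c - t) * \<psi> t) \<longlongrightarrow> 0) at_top" for t
    proof -
      have "filterlim (\<lambda>c. - c - t) at_bot at_top"
        unfolding filterlim_at_bot
      proof
        fix Z :: real
        show "\<forall>\<^sub>F c in at_top. - c - t \<le> Z" using eventually_ge_at_top[of "- t - Z"] by eventually_elim auto
      qed
      moreover have "(F \<longlongrightarrow> 0) at_bot" using F by (simp add: Bc_def)
      ultimately have "((\<lambda>c. F (- c - t)) \<longlongrightarrow> 0) at_top" by (rule filterlim_compose[rotated])
      from tendsto_mult[OF this tendsto_const[of "\<psi> t"]] show ?thesis by simp
    qed
    then show "AE t in lborel. ((\<lambda>c. F (- c - t) * \<psi> t) \<longlongrightarrow> 0) at_top" by simp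
  qed measurable
  then show ?thesis unfolding filterlim_at_bot_mirror conv_def by simp
qed

text \<open>For the approximants the functional is exactly 2 \<pi> times the convolution of
  \<open>g n\<close> with \<psi>, and its error is uniform on compact sets of arguments. No
  convergence of \<open>g n\<close> itself is used: after integration over \<open>{a..x}\<close>
  only the convolutions of \<open>G n\<close> appear, and these converge because \<open>G n\<close>
  converges uniformly. Decay of the convolution at -\<infinity> then extends the identity to the
  half-line.\<close>

theorem Omega_ker_integral:
  assumes F: "Bc F"
  shows "rs_improper_has_integral (Omega F) (ker x) (rs_improper_integral (Omega F) (ker x))"
    and "((\<lambda>y. rs_improper_integral (Omega F) (ker y) / of_real (2 * pi)) has_integral conv F x) {..x}"
proof -
  have "\<exists>G g. test_primitive G g \<and> (\<forall>t. norm (F t - G t) \<le> 1 / real (Suc n))" for n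
    by (rule Bc_test_primitive_approx[OF F, of "1 / real (Suc n)"]) auto
  then obtain G g where G: "\<And>n. test_primitive (G n) (g n)" "\<And>n t. norm (F t - G n t) \<le> 1 / real (Suc n)"
    by metis
  define c where "c n = 1 / real (Suc n) * (16 * pi)" for n
  have r0: "(\<lambda>n. 1 / real (Suc n)) \<longlonglongrightarrow> 0"
    using LIMSEQ_inverse_real_of_nat by (simp add: inverse_eq_divide)
  have c: "\<And>n. 0 \<le> c n" "c \<longlonglongrightarrow> 0"
    using tendsto_mult_left_zero[OF r0, of "16 * pi"] by (auto simp: c_def[abs_def])
  have Oc: "norm (Omega F s - Omega (G n) s) \<le> c n * s\<^sup>2" for n s
    unfolding c_def by (rule Omega_diff_le[OF F test_primitive_Bc[OF G(1)] G(2)])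
  define T where "T y = rs_improper_integral (Omega F) (ker y)" for y
  \<comment> \<open>\<open>M\<close> may depend on \<open>X\<close> but neither on \<open>y\<close>
    nor on \<open>n\<close>, which makes the convergence uniform for |y| at most
    \<open>X\<close>.\<close>
  have main: "\<exists>M\<ge>0. \<forall>y. \<bar>y\<bar> \<le> X \<longrightarrow> rs_improper_has_integral (Omega F) (ker y) (T y) \<and>
      (\<forall>n. norm (T y - of_real (2 * pi) * conv (g n) y) \<le> c n * M)" if X0: "X \<ge> 0" for X
  proof -
    obtain M where M: "M \<ge> 0" "\<And>y a b. \<bar>y\<bar> \<le> X \<Longrightarrow> a \<le> b \<Longrightarrow> weighted_var_le (ker y) a b M"
      by (rule ker_weighted_var_le[OF X0]) blast
    show ?thesis
    proof (intro exI[of _ M] conjI M allI impI)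
      fix y assume y: "\<bar>y\<bar> \<le> X"
      have "\<exists>L. rs_improper_has_integral (Omega F) (ker y) L \<and> (\<forall>n. norm (L - of_real (2 * pi) * conv (g n) y) \<le> c n * M)"
        by (rule rs_improper_has_integral_limit[OF test_primitive_improper_integral[OF G(1)] M(2)[OF y] Oc c])
           (auto simp: conv_def)
      then obtain L where L: "rs_improper_has_integral (Omega F) (ker y) L" "\<And>n. norm (L - of_real (2 * pi) * conv (g n) y) \<le> c n * M"
        by blast
      have "T y = L" unfolding T_def by (rule rs_improper_integral_eq[OF L(1)])
      with L show "rs_improper_has_integral (Omega F) (ker y) (T y)" "norm (T y - of_real (2 * pi) * conv (g n) y) \<le> c n * M" for n
        by auto
    qed
  qed
  show "rs_improper_has_integral (Omega F) (ker x) (rs_improper_integral (Omega F) (ker x))"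
    using main[of "\<bar>x\<bar>"] unfolding T_def by auto
  have "((\<lambda>y. T y / of_real (2 * pi)) has_integral (conv F x - conv F a)) {a..x}" if ax: "a \<le> x" for a
  proof -
    obtain M where M: "M \<ge> 0" "\<And>y n. \<bar>y\<bar> \<le> max \<bar>a\<bar> \<bar>x\<bar> \<Longrightarrow> norm (T y - of_real (2 * pi) * conv (g n) y) \<le> c n * M"
    proof -
      have "0 \<le> max \<bar>a\<bar> \<bar>x\<bar>" by simp
      from main[OF this] show thesis using that by blast
    qed
    show ?thesis
    proof (rule has_integral_uniform_limit_real[OF ax conv_has_integral[OF G(1) ax]])
      fix n y assume "y \<in> {a..x}"
      then have "\<bar>y\<bar> \<le> max \<bar>a\<bar> \<bar>x\<bar>" by auto
      from divide_right_mono[OF M(2)[OF this, of n], of "2 * pi"]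
      have "norm (T y - of_real (2 * pi) * conv (g n) y) / norm (complex_of_real (2 * pi)) \<le> c n * M / (2 * pi)"
        by (simp add: norm_mult)
      moreover have "T y / of_real (2 * pi) - conv (g n) y = (T y - of_real (2 * pi) * conv (g n) y) / of_real (2 * pi)"
        by (simp add: field_simps)
      ultimately show "norm (T y / of_real (2 * pi) - conv (g n) y) \<le> c n * M / (2 * pi)"
        by (simp only: norm_divide)
    next
      show "(\<lambda>n. c n * M / (2 * pi)) \<longlonglongrightarrow> 0"
        using tendsto_divide[OF tendsto_mult_left_zero[OF c(2), of M] tendsto_const[of "2 * pi"]] by simp
      have lim: "(\<lambda>n. conv (G n) y) \<longlonglongrightarrow> conv F y" for y
      proof (rule LIM_zero_cancel, rule Lim_null_comparison)
        show "\<forall>\<^sub>F n in sequentially. norm (conv (G n) y - conv F y) \<le> 1 / real (Suc n) * K0"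
          using conv_diff_le[OF F test_primitive_Bc[OF G(1)] G(2)] by (simp add: norm_minus_commute)
        show "(\<lambda>n. 1 / real (Suc n) * K0) \<longlonglongrightarrow> 0" by (rule tendsto_mult_left_zero[OF r0])
      qed
      show "(\<lambda>n. conv (G n) x - conv (G n) a) \<longlonglongrightarrow> conv F x - conv F a"
        by (intro tendsto_diff lim)
    qed
  qed
  then show "((\<lambda>y. rs_improper_integral (Omega F) (ker y) / of_real (2 * pi)) has_integral conv F x) {..x}"
    unfolding T_def by (rule has_integral_atMostI[OF _ conv_tendsto_0[OF F]])
qed

end

section \<open>Dilation of the kernel and the conclusion\<close>

lemma fourier_psi_a:
  assumes "a > 0"
  shows "fourier (psi_a \<psi> a) s = fourier \<psi> (a * s)"
proof -
  let ?f = "\<lambda>t. exp (- \<i> * complex_of_real (s * t)) * psi_a \<psi> a t"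
  have "fourier (psi_a \<psi> a) s = \<bar>a\<bar> *\<^sub>R (LINT t|lborel. ?f (0 + a * t))"
    unfolding fourier_def using assms by (intro lborel_integral_real_affine) simp
  also have "\<dots> = (LINT t|lborel. \<bar>a\<bar> *\<^sub>R ?f (0 + a * t))" by simp
  also have "\<dots> = fourier \<psi> (a * s)"
    unfolding fourier_def using assms
    by (intro Bochner_Integration.integral_cong refl) (simp add: psi_a_def scaleR_conv_of_real mult_ac)
  finally show ?thesis .
qed

lemma abs_cont_on_scale:
  assumes ac: "abs_cont_on {a * u..a * v} k" and "a > 0"
  shows "abs_cont_on {u..v} (\<lambda>s. k (a * s))"
  unfolding abs_cont_on_def
proof (intro allI impI)
  fix e :: real assume "e > 0"
  then obtain \<delta> where \<delta>: "\<delta> > 0" "\<forall>(n::nat) (x::nat \<Rightarrow> real) y.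
      (\<forall>i<n. x i \<le> y i \<and> {x i..y i} \<subseteq> {a * u..a * v}) \<and>
      (\<forall>i<n. \<forall>j<n. i \<noteq> j \<longrightarrow> y i \<le> x j \<or> y j \<le> x i) \<and>
      (\<Sum>i<n. y i - x i) < \<delta> \<longrightarrow> (\<Sum>i<n. norm (k (y i) - k (x i))) < e"
    using ac unfolding abs_cont_on_def by blast
  show "\<exists>d>0. \<forall>(n::nat) (x::nat \<Rightarrow> real) y.
      (\<forall>i<n. x i \<le> y i \<and> {x i..y i} \<subseteq> {u..v}) \<and>
      (\<forall>i<n. \<forall>j<n. i \<noteq> j \<longrightarrow> y i \<le> x j \<or> y j \<le> x i) \<and>
      (\<Sum>i<n. y i - x i) < d \<longrightarrow> (\<Sum>i<n. norm (k (a * y i) - k (a * x i))) < e"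
  proof (intro exI[of _ "\<delta> / a"] conjI allI impI)
    show "\<delta> / a > 0" using \<delta>(1) \<open>a > 0\<close> by simp
    fix n :: nat and x y :: "nat \<Rightarrow> real"
    assume A: "(\<forall>i<n. x i \<le> y i \<and> {x i..y i} \<subseteq> {u..v}) \<and>
      (\<forall>i<n. \<forall>j<n. i \<noteq> j \<longrightarrow> y i \<le> x j \<or> y j \<le> x i) \<and> (\<Sum>i<n. y i - x i) < \<delta> / a"
    show "(\<Sum>i<n. norm (k (a * y i) - k (a * x i))) < e"
    proof (rule \<delta>(2)[rule_format, of n "\<lambda>i. a * x i" "\<lambda>i. a * y i"], intro conjI allI impI)
      fix i assume "i < n"
      then have i: "x i \<le> y i" "u \<le> x i" "y i \<le> v" using A by auto
      then show "a * x i \<le> a * y i" "{a * x i..a * y i} \<subseteq> {a * u..a * v}" using \<open>a > 0\<close> by auto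
    next
      fix i j assume "i < n" "j < n" "i \<noteq> j"
      then have "y i \<le> x j \<or> y j \<le> x i" using A by blast
      then show "a * y i \<le> a * x j \<or> a * y j \<le> a * x i" using \<open>a > 0\<close> by simp
    next
      have "(\<Sum>i<n. a * y i - a * x i) = a * (\<Sum>i<n. y i - x i)"
        by (simp add: sum_distrib_left right_diff_distrib)
      also have "\<dots> < a * (\<delta> / a)" using A \<open>a > 0\<close> by (intro mult_strict_left_mono) auto
      finally show "(\<Sum>i<n. a * y i - a * x i) < \<delta>" using \<open>a > 0\<close> by simp
    qed
  qed
qed

text \<open>The transform of the dilated kernel is \<open>fourier \<psi>\<close> at
  \<open>a * s\<close>, whose derivative is \<open>a * dpsi (a * s)\<close> by the chain rule.
  Linear substitutions preserve integrability and null sets, and a positive factor keeps chains of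
  points ordered.\<close>

lemma summability_kernel_scale:
  assumes "summability_kernel \<psi> dpsi" and a: "a > 0"
  shows "summability_kernel (psi_a \<psi> a) (\<lambda>s. complex_of_real a * dpsi (a * s))"
proof -
  interpret summability_kernel \<psi> dpsi by fact
  have fa: "fourier (psi_a \<psi> a) = (\<lambda>s. fourier \<psi> (a * s))"
    using fourier_psi_a[OF a] by auto
  have scale: "integrable lborel (\<lambda>s. complex_of_real (s^2) * h (a * s))"
    if "integrable lborel (\<lambda>s. complex_of_real (s^2) * h s)" for h :: "real \<Rightarrow> complex"
  proof -
    have "integrable lborel (\<lambda>s. complex_of_real ((0 + a * s)^2) * h (0 + a * s))"
      using lborel_integrable_real_affine[OF that, of a 0] a by simp
    then have "integrable lborel (\<lambda>s. complex_of_real (1 / a\<^sup>2) * (complex_of_real ((0 + a * s)^2) * h (0 + a * s)))"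
      by (rule integrable_mult_right)
    then show ?thesis using a by (simp add: power_mult_distrib)
  qed
  show ?thesis
  proof
    have "integrable lborel (\<lambda>t. \<psi> (0 + (1 / a) * t))"
      using a by (intro lborel_integrable_real_affine psi_L1) simp
    then show "integrable lborel (psi_a \<psi> a)"
      unfolding psi_a_def by (intro integrable_divide) simp
    show "abs_cont_on {u..v} (fourier (psi_a \<psi> a))" for u v
      unfolding fa by (rule abs_cont_on_scale[OF psihat_ac a])
    show "AE s in lborel. (fourier (psi_a \<psi> a) has_vector_derivative complex_of_real a * dpsi (a * s)) (at s)"
    proof -
      obtain N where N: "N \<in> null_sets lborel" "{s. \<not> (fourier \<psi> has_vector_derivative dpsi s) (at s)} \<subseteq> N"
        using dpsi by (auto elim: AE_E simp: null_sets_def)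
      have Nb: "N \<in> sets borel" using N(1) by auto
      have "AE s in lborel. s \<notin> N" using N(1) by (rule AE_not_in)
      then have "AE s in lborel. 0 + a * s \<notin> N"
        using a Nb by (intro AE_borel_affine) auto
      then show ?thesis
      proof eventually_elim
        case (elim s)
        then have d: "(fourier \<psi> has_vector_derivative dpsi (a * s)) (at (a * s))" using N(2) by auto
        have "((\<lambda>s. a * s) has_vector_derivative a) (at s)"
          by (auto intro!: derivative_eq_intros simp: has_real_derivative_iff_has_vector_derivative[symmetric])
        from vector_diff_chain_at[OF this d] show ?case
          unfolding fa by (simp add: o_def scaleR_conv_of_real)
      qed
    qed
    show "integrable lborel (\<lambda>s. complex_of_real (s^2) * fourier (psi_a \<psi> a) s)"
      unfolding fa by (rule scale[OF p2_psihat])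
    have "integrable lborel (\<lambda>s. complex_of_real a * (complex_of_real (s^2) * dpsi (a * s)))"
      by (intro integrable_mult_right scale p2_dpsi_L1)
    then show "integrable lborel (\<lambda>s. complex_of_real (s^2) * (complex_of_real a * dpsi (a * s)))"
      by (simp add: mult.left_commute)
    show "bv_on_R (\<lambda>s. complex_of_real (s^2) * (complex_of_real a * dpsi (a * s)))"
    proof -
      let ?h = "\<lambda>s. complex_of_real (s^2) * dpsi s"
      obtain M where M: "\<forall>(n::nat) x. (\<forall>i<n. x i \<le> x (Suc i)) \<longrightarrow> (\<Sum>i<n. norm (?h (x (Suc i)) - ?h (x i))) \<le> M"
        using p2_dpsi_BV unfolding bv_on_R_def by blast
      \<comment> \<open>The factor a^2 needed to dilate the weight s^2 is paid partly by the factor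
        \<open>a\<close> of the chain rule, leaving 1 / a in the variation bound.\<close>
      have eq: "complex_of_real (s^2) * (complex_of_real a * dpsi (a * s)) = complex_of_real (1 / a) * ?h (a * s)" for s
        using a by (simp add: power_mult_distrib power2_eq_square)
      show ?thesis
        unfolding bv_on_R_def
      proof (intro exI[of _ "1 / a * M"] allI impI)
        fix n :: nat and x :: "nat \<Rightarrow> real" assume x: "\<forall>i<n. x i \<le> x (Suc i)"
        have "(\<Sum>i<n. norm (?h (a * x (Suc i)) - ?h (a * x i))) \<le> M"
          using M[rule_format, of n "\<lambda>i. a * x i"] x a by simp
        then have "1 / a * (\<Sum>i<n. norm (?h (a * x (Suc i)) - ?h (a * x i))) \<le> 1 / a * M"
          using a by (intro mult_left_mono) auto
        moreover have "norm (complex_of_real (1 / a) * X - complex_of_real (1 / a) * Y) = 1 / a * norm (X - Y)" for X Y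
          using a by (simp only: norm_mult norm_of_real right_diff_distrib[symmetric]) simp
        ultimately show "(\<Sum>i<n. norm (complex_of_real ((x (Suc i))^2) * (complex_of_real a * dpsi (a * x (Suc i))) - complex_of_real ((x i)^2) * (complex_of_real a * dpsi (a * x i)))) \<le> 1 / a * M"
          unfolding eq by (simp only: sum_distrib_left)
      qed
    qed
  qed
qed

text \<open>The Alexiewicz norm is the supremum distance of primitives, so \<open>Ia\<close> enters
  through its integral over \<open>{..x}\<close> and the limit is stated uniformly in
  \<open>x\<close>. The first conjunct ensures that the THE behind \<open>Ia\<close> and the
  operator \<open>integral\<close> denote genuine integrals rather than default values.\<close>

theorem mainTheorem7:
  fixes F :: "real \<Rightarrow> complex" and \<psi> :: "real \<Rightarrow> complex" and dpsi :: "real \<Rightarrow> complex"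
  assumes F: "Bc F"
    and psi_L1: "integrable lborel \<psi>"
    and psi_int: "(LINT t|lborel. \<psi> t) = 1"
    and psihat_ac: "\<forall>a b. abs_cont_on {a..b} (fourier \<psi>)"
    and dpsi: "AE s in lborel. (fourier \<psi> has_vector_derivative dpsi s) (at s)"
    and p2_psihat: "integrable lborel (\<lambda>s. complex_of_real (s^2) * fourier \<psi> s)"
    and p2_dpsi_L1: "integrable lborel (\<lambda>s. complex_of_real (s^2) * dpsi s)"
    and p2_dpsi_BV: "bv_on_R (\<lambda>s. complex_of_real (s^2) * dpsi s)"
  shows "(\<forall>a>0. \<forall>x. ft_pair_exists F (dphi_ker \<psi> dpsi a x)
                  \<and> Ia F \<psi> dpsi a integrable_on {..x})
       \<and> (\<forall>\<epsilon>>0. \<forall>\<^sub>F a in at_right 0.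
            \<forall>x. norm (F x - integral {..x} (Ia F \<psi> dpsi a)) \<le> \<epsilon>)"
proof -
  have kernel: "summability_kernel \<psi> dpsi"
    using assms by unfold_locales auto
  have exists: "ft_pair_exists F (dphi_ker \<psi> dpsi a x)"
    and integral: "(Ia F \<psi> dpsi a has_integral (LINT t|lborel. F (x - t) * psi_a \<psi> a t)) {..x}" if "a > 0" for a x
  proof -
    interpret K: summability_kernel "psi_a \<psi> a" "\<lambda>s. complex_of_real a * dpsi (a * s)"
      by (rule summability_kernel_scale[OF kernel that])
    \<comment> \<open>The exponential factored out of \<open>dphi_ker\<close> leaves the
      \<open>ker\<close> of the dilated kernel, so all results proved at a = 1 apply.\<close>
    have ker: "dphi_ker \<psi> dpsi a y = K.ker y" for y
      by (rule ext) (unfold dphi_ker_def K.ker_def Kker_def, simp add: algebra_simps)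
    show "ft_pair_exists F (dphi_ker \<psi> dpsi a x)"
      unfolding ft_pair_exists_def ker using K.Omega_ker_integral(1)[OF F] by blast
    have "Ia F \<psi> dpsi a = (\<lambda>y. rs_improper_integral (Omega F) (K.ker y) / of_real (2 * pi))"
      by (simp add: fun_eq_iff Ia_def ft_pair_def ker)
    then show "(Ia F \<psi> dpsi a has_integral (LINT t|lborel. F (x - t) * psi_a \<psi> a t)) {..x}"
      using K.Omega_ker_integral(2)[OF F, of x] by (simp add: K.conv_def)
  qed
  have "\<forall>\<^sub>F a in at_right 0. \<forall>x. norm (F x - integral {..x} (Ia F \<psi> dpsi a)) \<le> \<epsilon>" if "\<epsilon> > 0" for \<epsilon>
    using approximate_identity[OF F psi_L1 psi_int that] eventually_at_right_less[of 0]
  proof eventually_elim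
    case (elim a)
    then show ?case using integral_unique[OF integral] by simp
  qed
  with exists integral show ?thesis by blast
qed

end
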